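(* Let $k=6$ or $k\ge 8$ be an integer with $k\equiv i \pmod 3$, let $n\ge N(k)$, and let $\pi=(d_1,\ldots,d_n)$ be a graphic sequence with $$\sigma(\pi)>2\left\lfloor\tfrac{2k}{3}\right\rfloor n-2n-\left\lfloor\tfrac{2k}{3}\right\rfloor^2+\left\lfloor\tfrac{2k}{3}\right\rfloor+1-(-1)^i.$$ Then $\pi$ has a realization containing every 2-tree on $k$ vertices as a subgraph. Moreover, the lower bound $2\lfloor\frac{2k}{3}\rfloor n-2n-\lfloor\frac{2k}{3}\rfloor^2+\lfloor\frac{2k}{3}\rfloor+1-(-1)^i$ on $\sigma(\pi)$ is the best possible.
   Context: A simple graph $G$ is a 2-tree if $G=K_3$, or $G$ has a vertex $v$ of degree 2 whose two neighbors are adjacent and $G-v$ is a 2-tree. A non-increasing sequence $\pi=(d_1,\ldots,d_n)$ of nonnegative integers with $d_1\le n-1$ is graphic if it is the degree sequence of some simple graph on $n$ vertices, called a realization of $\pi$. For such a sequence, $\sigma(\pi)=d_1+\cdots+d_n$. For $k=6$ or $k\ge 8$, $N(k)$ is defined by: $N(k)=20\lfloor\frac{k}{3}\rfloor^2-\lfloor\frac{k}{3}\rfloor$ if $k\equiv 0 \pmod 3$; $N(k)=20\lfloor\frac{k}{3}\rfloor^2+23\lfloor\frac{k}{3}\rfloor+5$ if $k\equiv 1 \pmod 3$; $N(k)=20\lfloor\frac{k}{3}\rfloor^2+31\lfloor\frac{k}{3}\rfloor+12$ if $k\equiv 2 \pmod 3$. *)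

theory Defs
  imports "Graph_Theory.Graph_Theory"
begin

(* Simple graphs are the library's finite symmetric loop-free digraphs without parallel arcs
   (locale graph). An undirected edge is a pair of opposite arcs, so the degree of a vertex is
   its out-degree. *)

inductive two_tree :: "('a, 'b) pre_digraph \<Rightarrow> bool" where
  triangle: "K\<^bsub>3\<^esub> G \<Longrightarrow> two_tree G"
| extend: "\<lbrakk>graph G; v \<in> verts G; out_degree G v = 2;
    v \<rightarrow>\<^bsub>G\<^esub> x; v \<rightarrow>\<^bsub>G\<^esub> y; x \<noteq> y; x \<rightarrow>\<^bsub>G\<^esub> y;
    two_tree (pre_digraph.del_vert G v)\<rbrakk> \<Longrightarrow> two_tree G"

(* Subgraph containment up to isomorphism; the subgraph need not be induced. *)
definition contains_copy :: "('a, 'b) pre_digraph \<Rightarrow> ('c, 'd) pre_digraph \<Rightarrow> bool" where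
  "contains_copy G T \<longleftrightarrow> (\<exists>H. subgraph H G \<and> digraph_iso T H)"

(* Every simple graph on k vertices is isomorphic to one whose vertices are natural numbers. *)
definition contains_every_two_tree :: "nat \<Rightarrow> ('a, 'b) pre_digraph \<Rightarrow> bool" where
  "contains_every_two_tree k G \<longleftrightarrow>
    (\<forall>T :: nat pair_pre_digraph. two_tree (with_proj T) \<and> card (pverts T) = k \<longrightarrow>
       contains_copy G (with_proj T))"

(* Equality of multisets: the vertices of G carry no prescribed order. *)
definition realization :: "nat list \<Rightarrow> ('a, 'b) pre_digraph \<Rightarrow> bool" where
  "realization ds G \<longleftrightarrow> graph G \<and> image_mset (out_degree G) (mset_set (verts G)) = mset ds"

definition graphic :: "nat list \<Rightarrow> bool" where
  "graphic ds \<longleftrightarrow> sorted_wrt (\<ge>) ds \<and> (\<forall>d \<in> set ds. d \<le> length ds - 1) \<and>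
     (\<exists>G :: nat pair_pre_digraph. realization ds (with_proj G))"

(* k = 7 is not meant to be covered. *)
definition N :: "nat \<Rightarrow> nat" where
  "N k = (let q = k div 3 in
     if k mod 3 = 0 then 20 * q\<^sup>2 - q
     else if k mod 3 = 1 then 20 * q\<^sup>2 + 23 * q + 5
     else 20 * q\<^sup>2 + 31 * q + 12)"

(* The exponent of -1 is the residue of k modulo 3, not k itself. *)
definition sigma_bound :: "nat \<Rightarrow> nat \<Rightarrow> int" where
  "sigma_bound k n = (let m = int (2 * k div 3) in
     2 * m * int n - 2 * int n - m\<^sup>2 + m + 1 - (-1) ^ (k mod 3))"

end

theory Submission
  imports Defs
begin

text \<open>
  Put m = 2k div 3 and g = k - m. A 2-tree on k vertices is properly 3-coloured with any two colour classes
  inducing a tree, and its largest class has at least g vertices; so after moving at most one or two vertices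
  of the second class to the largest one, the other two classes have at most m - 1 vertices and the rest is
  nearly independent. It therefore suffices to find a realization with a set P of vertices joined to each other
  and to a large set S on which a few prescribed edges are present.

  Such a realization is reached by exchanging two or three edges at a time while freezing the prescribed edges
  already present. If an exchange for a missing edge uv is impossible, then all unfrozen edges are confined
  to the common neighbourhoods of the unfrozen neighbours of u and of v. Either these neighbours contain
  a clique on k vertices, which contains every 2-tree, or there are too few edges for the given degree sum.
  If at least m - 1 degrees are large, P is the set of the m - 1 largest degrees and one edge inside S is enough
  (two if k mod 3 = 1). If only m - 1 - j degrees are large, the next ones are at least m - 1 + j,
  which leaves room for a bipartite graph of maximum degree 2j on S.
  The bound is sharp for the join of a clique on m - 1 vertices with an independent set, or, if k mod 3 = 1,
  with one edge and isolated vertices: this graph does not contain the square of a path.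
\<close>

section \<open>Edge exchange\<close>

text \<open>Every blocked exchange is refuted by one comparison. If a set \<open>P\<close> of m - 1
  - b vertices is disregarded, the degree sum still forces roughly b * n edges avoiding it, whereas
  confinement leaves at most b times a quadratic expression in k; so a quadratic lower bound on n
  suffices. The obstacle is that degrees are not bounded in terms of k: u may have very many
  unfrozen neighbours. \<open>P\<close> is therefore chosen inside \<open>Z\<close>. When joins or
  edges outside the clique are added, X is bounded through the top vertices outside
  \<open>Z\<close>: each member of X misses one of them, and each of them misses few members of X.
  Two edges are needed for k mod 3 = 1 because the largest class may have exactly g vertices while
  every vertex of the second class has two neighbours in it. Moving one vertex then creates a path
  with two edges; if the two available edges are disjoint, the two classes exchange their roles
  instead. The maximum degree 2 * j is (m - 1 + j) - (m - 1 - j): what the degree bound leaves after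
  all joins to \<open>P\<close>.\<close>

definition edges_on :: "'a set \<Rightarrow> 'a set set \<Rightarrow> bool" where
  "edges_on V E \<longleftrightarrow> (\<forall>e\<in>E. e \<subseteq> V \<and> card e = 2)"

definition nb :: "'a set set \<Rightarrow> 'a \<Rightarrow> 'a set" where
  "nb E v = {w. {v, w} \<in> E}"

definition realizes :: "nat \<Rightarrow> (nat \<Rightarrow> nat) \<Rightarrow> nat set set \<Rightarrow> bool" where
  "realizes n d E \<longleftrightarrow> edges_on {..<n} E \<and> (\<forall>v<n. card (nb E v) = d v)"

lemma nb_iff: "w \<in> nb E v \<longleftrightarrow> {v, w} \<in> E"
  by (simp add: nb_def)

lemma nb_sym: "w \<in> nb E v \<longleftrightarrow> v \<in> nb E w"
  by (simp add: nb_def insert_commute)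

lemma edges_onD:
  assumes "edges_on V E" "{v, w} \<in> E"
  shows "v \<noteq> w" "v \<in> V" "w \<in> V"
  using assms by (auto simp: edges_on_def card_2_iff doubleton_eq_iff)

lemma edges_on_subset: "edges_on V E \<Longrightarrow> F \<subseteq> E \<Longrightarrow> edges_on V F"
  by (auto simp: edges_on_def)

lemma edges_on_obtain:
  assumes "edges_on V E" "e \<in> E"
  obtains a b where "e = {a, b}" "a \<noteq> b" "a \<in> V" "b \<in> V"
  using assms by (metis edges_onD(1,2,3) edges_on_def card_2_iff)

lemma edges_on_finite: "edges_on V E \<Longrightarrow> finite V \<Longrightarrow> finite E"
  by (rule finite_subset[of _ "Pow V"]) (auto simp: edges_on_def)

lemma nb_subset: "edges_on V E \<Longrightarrow> nb E v \<subseteq> V"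
  using edges_onD(3) by (fastforce simp: nb_def)

lemma nb_irrefl: "edges_on V E \<Longrightarrow> v \<notin> nb E v"
  unfolding nb_def using edges_onD(1) by (metis mem_Collect_eq)

lemma finite_nb: "edges_on V E \<Longrightarrow> finite V \<Longrightarrow> finite (nb E v)"
  using nb_subset finite_subset by metis

lemma card_nb:
  assumes "edges_on V E"
  shows "card (nb E v) = card {e \<in> E. v \<in> e}"
proof (rule bij_betw_same_card)
  show "bij_betw (\<lambda>w. {v, w}) (nb E v) {e \<in> E. v \<in> e}"
    unfolding bij_betw_def
  proof
    show "inj_on (\<lambda>w. {v, w}) (nb E v)"
      by (auto simp: inj_on_def doubleton_eq_iff)
    show "(\<lambda>w. {v, w}) ` nb E v = {e \<in> E. v \<in> e}"
    proof (intro equalityI subsetI)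
      fix e assume e: "e \<in> {e \<in> E. v \<in> e}"
      then obtain a b where "e = {a, b}" "a \<noteq> b"
        using assms edges_on_obtain by (metis (no_types, lifting) mem_Collect_eq)
      with e show "e \<in> (\<lambda>w. {v, w}) ` nb E v"
        by (auto simp: nb_def insert_commute)
    qed (auto simp: nb_def)
  qed
qed

lemma sum_card_nb:
  assumes "edges_on V E" "finite V"
  shows "(\<Sum>v\<in>V. card (nb E v)) = 2 * card E"
proof -
  have fE: "finite E" using assms edges_on_finite by blast
  have "(\<Sum>v\<in>V. card (nb E v)) = (\<Sum>v\<in>V. \<Sum>e\<in>E. of_bool (v \<in> e))"
    using fE by (simp add: card_nb[OF assms(1)] sum.If_cases Int_def of_bool_def)
  also have "\<dots> = (\<Sum>e\<in>E. \<Sum>v\<in>V. of_bool (v \<in> e))"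
    by (rule sum.swap)
  also have "\<dots> = (\<Sum>e\<in>E. 2)"
  proof (rule sum.cong[OF refl])
    fix e assume "e \<in> E"
    then have "e \<subseteq> V" "card e = 2" using assms by (auto simp: edges_on_def)
    then show "(\<Sum>v\<in>V. of_bool (v \<in> e)) = (2::nat)"
      using assms(2) by (simp add: of_bool_def sum.If_cases Int_absorb1 Int_commute Collect_mem_eq)
  qed
  finally show ?thesis by simp
qed

text \<open>Degrees depend only on incidence counts, so one argument covers the exchange of two and
  of three edges.\<close>

lemma realizes_exchange:
  assumes "realizes n d E" "R \<subseteq> E" "A \<inter> E = {}" "edges_on {..<n} A"
    and "\<And>v. card {e \<in> R. v \<in> e} = card {e \<in> A. v \<in> e}"
  shows "realizes n d (E - R \<union> A)"
proof -
  have E: "edges_on {..<n} E" using assms(1) by (simp add: realizes_def)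
  then have fE: "finite E" by (rule edges_on_finite) simp
  have fA: "finite A" using assms(4) by (rule edges_on_finite) simp
  have ed: "edges_on {..<n} (E - R \<union> A)"
    using E assms(4) by (auto simp: edges_on_def)
  have "card (nb (E - R \<union> A) v) = card (nb E v)" for v
  proof -
    have "{e \<in> E - R \<union> A. v \<in> e} = ({e \<in> E. v \<in> e} - {e \<in> R. v \<in> e}) \<union> {e \<in> A. v \<in> e}"
      by auto
    moreover have "card (({e \<in> E. v \<in> e} - {e \<in> R. v \<in> e}) \<union> {e \<in> A. v \<in> e})
        = card ({e \<in> E. v \<in> e} - {e \<in> R. v \<in> e}) + card {e \<in> A. v \<in> e}"
      by (rule card_Un_disjoint) (use fE fA assms(3) in auto)
    moreover have "card ({e \<in> E. v \<in> e} - {e \<in> R. v \<in> e}) = card {e \<in> E. v \<in> e} - card {e \<in> R. v \<in> e}"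
      by (rule card_Diff_subset) (use finite_subset[OF assms(2) fE] assms(2) in auto)
    moreover have "card {e \<in> R. v \<in> e} \<le> card {e \<in> E. v \<in> e}"
      by (rule card_mono) (use fE assms(2) in auto)
    ultimately show ?thesis
      using assms(5)[of v] card_nb[OF ed, of v] card_nb[OF E, of v] by simp
  qed
  with ed assms(1) show ?thesis by (simp add: realizes_def)
qed

lemma card_edges_at:
  assumes "finite R"
  shows "card {e \<in> R. v \<in> e} = (\<Sum>e\<in>R. of_bool (v \<in> e))"
  using assms by (simp add: of_bool_def sum.If_cases Int_def)

lemma card_at2: "e1 \<noteq> e2 \<Longrightarrow> card {e \<in> {e1, e2}. w \<in> e} = of_bool (w \<in> e1) + of_bool (w \<in> e2)"
  by (subst card_edges_at) simp_all

lemma card_at3: "e1 \<noteq> e2 \<Longrightarrow> e1 \<noteq> e3 \<Longrightarrow> e2 \<noteq> e3 \<Longrightarrow>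
    card {e \<in> {e1, e2, e3}. w \<in> e} = of_bool (w \<in> e1) + of_bool (w \<in> e2) + of_bool (w \<in> e3)"
  by (subst card_edges_at) simp_all

lemma of_bool_pair: "a \<noteq> b \<Longrightarrow> of_bool (w \<in> {a, b}) = (of_bool (w = a) + of_bool (w = b) :: nat)"
  by auto

lemma swap2:
  assumes E: "realizes n d E" and e: "{u, x} \<in> E" "{v, y} \<in> E"
    and ne: "u \<noteq> v" "x \<noteq> y" "{u, v} \<notin> E" "{x, y} \<notin> E"
  shows "realizes n d (E - {{u, x}, {v, y}} \<union> {{u, v}, {x, y}})"
proof (rule realizes_exchange[OF E])
  have on: "edges_on {..<n} E" using E by (simp add: realizes_def)
  note D = edges_onD[OF on e(1)] edges_onD[OF on e(2)]
  show "edges_on {..<n} {{u, v}, {x, y}}"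
    using D ne by (auto simp: edges_on_def)
  have r: "{u, x} \<noteq> {v, y}" using e ne by (metis doubleton_eq_iff insert_commute)
  have a: "{u, v} \<noteq> {x, y}" using e ne D by (metis doubleton_eq_iff insert_commute)
  fix w
  show "card {e \<in> {{u, x}, {v, y}}. w \<in> e} = card {e \<in> {{u, v}, {x, y}}. w \<in> e}"
    by (simp only: card_at2[OF r] card_at2[OF a] of_bool_pair D ne not_False_eq_True simp_thms)
qed (use e ne in auto)

text \<open>Removed and added edges alternate along the closed walk u, x, z, w, y, v. The premise
  \<open>x = y \<or> {x, y} \<in> E\<close> excludes degenerate coincidences: if, for instance, z =
  y and w = v, then the non-edge xz would be the pair xy.\<close>

lemma swap3:
  assumes E: "realizes n d E" and e: "{u, x} \<in> E" "{v, y} \<in> E" "{z, w} \<in> E"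
    and ne: "u \<noteq> v" "{u, v} \<notin> E" "x = y \<or> {x, y} \<in> E"
      "x \<noteq> z" "{x, z} \<notin> E" "y \<noteq> w" "{y, w} \<notin> E"
  shows "realizes n d (E - {{u, x}, {v, y}, {z, w}} \<union> {{u, v}, {x, z}, {y, w}})"
proof (rule realizes_exchange[OF E])
  have on: "edges_on {..<n} E" using E by (simp add: realizes_def)
  note D = edges_onD[OF on e(1)] edges_onD[OF on e(2)] edges_onD[OF on e(3)]
  show "edges_on {..<n} {{u, v}, {x, z}, {y, w}}"
    using D ne by (auto simp: edges_on_def)
  have r: "{u, x} \<noteq> {v, y}" "{u, x} \<noteq> {z, w}" "{v, y} \<noteq> {z, w}"
    using e ne by (metis doubleton_eq_iff insert_commute)+
  have a: "{u, v} \<noteq> {x, z}" "{u, v} \<noteq> {y, w}" "{x, z} \<noteq> {y, w}"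
    using e ne D by (metis doubleton_eq_iff insert_commute)+
  fix t
  show "card {e \<in> {{u, x}, {v, y}, {z, w}}. t \<in> e} = card {e \<in> {{u, v}, {x, z}, {y, w}}. t \<in> e}"
    by (simp only: card_at3[OF r] card_at3[OF a] of_bool_pair D ne not_False_eq_True simp_thms)
qed (use e ne in auto)

text \<open>The obstruction to adding the edge uv by exchanging two_full or three edges outside the set K of frozen
  edges: every other unfrozen edge is confined by the sets Z and T of vertices that are joined to
  all unfrozen neighbours of u and of v, respectively.\<close>

locale blocked =
  fixes n :: nat and d :: "nat \<Rightarrow> nat" and E K :: "nat set set" and u v :: nat
  assumes E: "realizes n d E" and uv: "u \<noteq> v" "u < n" "v < n" "{u, v} \<notin> E"
    and stuck: "\<And>E'. realizes n d E' \<Longrightarrow> E \<inter> K \<subseteq> E' \<Longrightarrow> {u, v} \<notin> E'"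
begin

definition "X = nb (E - K) u"
definition "Y = nb (E - K) v"
definition "Z = {w. w < n \<and> X \<subseteq> insert w (nb E w)}"
definition "T = {w. w < n \<and> Y \<subseteq> insert w (nb E w)}"

lemma on: "edges_on {..<n} E"
  using E by (simp add: realizes_def)

lemma deg: "w < n \<Longrightarrow> card (nb E w) = d w"
  using E by (simp add: realizes_def)

lemma fin_nb [simp]: "finite (nb E w)"
  using finite_nb[OF on] by simp

lemma X_sub: "X \<subseteq> nb E u" and Y_sub: "Y \<subseteq> nb E v"
  by (auto simp: X_def Y_def nb_def)

lemma fin [simp]: "finite X" "finite Y" "finite Z" "finite T"
  using finite_subset[OF X_sub] finite_subset[OF Y_sub] by (auto simp: Z_def T_def)

lemma XY: "x \<in> X \<Longrightarrow> y \<in> Y \<Longrightarrow> x = y \<or> {x, y} \<in> E"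
proof (rule ccontr)
  assume xy: "x \<in> X" "y \<in> Y" and c: "\<not> (x = y \<or> {x, y} \<in> E)"
  then have "realizes n d (E - {{u, x}, {v, y}} \<union> {{u, v}, {x, y}})"
    by (intro swap2[OF E]) (use uv in \<open>auto simp: X_def Y_def nb_def\<close>)
  from stuck[OF this] xy show False by (auto simp: X_def Y_def nb_def)
qed

lemma blocked3:
  assumes "x \<in> X" "y \<in> Y" "{z, w} \<in> E - K"
  shows "z = x \<or> {x, z} \<in> E \<or> w = y \<or> {y, w} \<in> E"
proof (rule ccontr)
  assume c: "\<not> ?thesis"
  then have "realizes n d (E - {{u, x}, {v, y}, {z, w}} \<union> {{u, v}, {x, z}, {y, w}})"
    using assms uv XY[OF assms(1,2)] by (intro swap3[OF E]) (auto simp: X_def Y_def nb_def)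
  from stuck[OF this] assms show False by (auto simp: X_def Y_def nb_def)
qed

text \<open>If z misses some x in X and w misses some y in Y, the exchange of three edges along x
  and y is possible. As an edge has two orientations, w \<in> Z or z \<in> T holds too; the later
  covers of the edge set use both.\<close>

lemma ZT:
  assumes "{z, w} \<in> E - K"
  shows "z \<in> Z \<or> w \<in> T"
proof (rule ccontr)
  assume "\<not> ?thesis"
  moreover have "z < n" "w < n" using edges_onD[OF on, of z w] assms by auto
  ultimately obtain x y where "x \<in> X" "x \<notin> insert z (nb E z)" "y \<in> Y" "y \<notin> insert w (nb E w)"
    by (auto simp: Z_def T_def)
  with blocked3[OF this(1,3) assms] show False by (auto simp: nb_def insert_commute)
qed

text \<open>This is the impossibility of the exchange of two edges, restated with \<open>Z\<close>
  and \<open>T\<close>.\<close>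

lemma X_T: "X \<subseteq> T" and Y_Z: "Y \<subseteq> Z"
proof -
  have "X \<subseteq> {..<n}" "Y \<subseteq> {..<n}"
    using X_sub Y_sub nb_subset[OF on] by blast+
  then show "X \<subseteq> T" "Y \<subseteq> Z"
    using XY by (fastforce simp: Z_def T_def nb_def insert_commute)+
qed

lemma u_Z: "u \<in> Z" and v_T: "v \<in> T"
  using X_sub Y_sub uv by (auto simp: Z_def T_def)

lemma Z_nb: "w \<in> Z \<Longrightarrow> x \<in> X \<Longrightarrow> x \<noteq> w \<Longrightarrow> w \<in> nb E x"
  by (auto simp: Z_def nb_def insert_commute)

lemma T_nb: "w \<in> T \<Longrightarrow> y \<in> Y \<Longrightarrow> y \<noteq> w \<Longrightarrow> w \<in> nb E y"
  by (auto simp: T_def nb_def insert_commute)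

text \<open>For distinct x and y the edge xy is itself unfrozen, so \<open>ZT\<close> applies to it.
  Either inclusion makes one of the two neighbourhoods a clique, which is where the alternative of a
  clique on k vertices comes from.\<close>

lemma X_Z_or_Y_T:
  assumes "\<And>x y. x \<in> X \<Longrightarrow> y \<in> Y \<Longrightarrow> {x, y} \<notin> K"
  shows "X \<subseteq> Z \<or> Y \<subseteq> T"
proof -
  have "x \<in> Z \<or> y \<in> T" if "x \<in> X" "y \<in> Y" for x y
  proof (cases "x = y")
    case True then show ?thesis using that Y_Z by blast
  next
    case False then show ?thesis using ZT[of x y] XY[OF that] assms[OF that] by blast
  qed
  then show ?thesis by blast
qed

text \<open>\<open>Z\<close> lies in the closed neighbourhood of each member of X, so a single
  member of small degree bounds it.\<close>

lemma card_Z: "x \<in> X \<Longrightarrow> card Z \<le> Suc (d x)"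
proof -
  assume x: "x \<in> X"
  then have "x < n" using X_T by (auto simp: T_def)
  have "Z \<subseteq> insert x (nb E x)" using Z_nb[OF _ x] by auto
  then have "card Z \<le> card (insert x (nb E x))" by (intro card_mono) auto
  then show ?thesis using deg[OF \<open>x < n\<close>] nb_irrefl[OF on, of x] by simp
qed

lemma card_T: "y \<in> Y \<Longrightarrow> card T \<le> Suc (d y)"
proof -
  assume y: "y \<in> Y"
  then have "y < n" using Y_Z by (auto simp: Z_def)
  have "T \<subseteq> insert y (nb E y)" using T_nb[OF _ y] by auto
  then have "card T \<le> card (insert y (nb E y))" by (intro card_mono) auto
  then show ?thesis using deg[OF \<open>y < n\<close>] nb_irrefl[OF on, of y] by simp
qed

lemma unfrozen_cases:
  assumes "e \<in> E - K"
  shows "e \<inter> Z \<noteq> {} \<or> e \<subseteq> T"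
proof -
  obtain a b where "e = {a, b}" using assms on edges_on_obtain by (metis DiffD1)
  then show ?thesis using ZT[of a b] ZT[of b a] assms by (auto simp: insert_commute)
qed

end

section \<open>Saturated realizations and the largest degrees\<close>

definition clique :: "'a set set \<Rightarrow> 'a set \<Rightarrow> bool" where
  "clique E Q \<longleftrightarrow> (\<forall>a\<in>Q. \<forall>b\<in>Q. a \<noteq> b \<longrightarrow> {a, b} \<in> E)"

definition pairs :: "'a set \<Rightarrow> 'a set set" where
  "pairs A = {{a, b} | a b. a \<in> A \<and> b \<in> A \<and> a \<noteq> b}"

definition joins :: "'a set \<Rightarrow> 'a set \<Rightarrow> 'a set set" where
  "joins A C = {{a, b} | a b. a \<in> A \<and> b \<in> C \<and> a \<noteq> b}"

lemma pairs_iff: "{a, b} \<in> pairs A \<longleftrightarrow> a \<in> A \<and> b \<in> A \<and> a \<noteq> b"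
  by (auto simp: pairs_def doubleton_eq_iff)

lemma joins_iff: "{a, b} \<in> joins A C \<longleftrightarrow> a \<noteq> b \<and> (a \<in> A \<and> b \<in> C \<or> b \<in> A \<and> a \<in> C)"
  by (auto simp: joins_def doubleton_eq_iff)

lemma clique_pairs: "clique E Q \<longleftrightarrow> pairs Q \<subseteq> E"
  by (auto simp: clique_def pairs_def)

lemma finite_pairs: "finite A \<Longrightarrow> finite (pairs A)"
  by (rule finite_subset[of _ "Pow A"]) (auto simp: pairs_def)

lemma finite_joins: "finite A \<Longrightarrow> finite C \<Longrightarrow> finite (joins A C)"
  by (rule finite_subset[of _ "Pow (A \<union> C)"]) (auto simp: joins_def)

lemma card_pairs: "finite A \<Longrightarrow> 2 * card (pairs A) = card A * (card A - 1)"
proof -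
  assume f: "finite A"
  have "pairs A = {e. e \<subseteq> A \<and> card e = 2}"
    by (auto simp: pairs_def card_2_iff)
  then have "card (pairs A) = card A choose 2"
    using n_subsets[OF f] by simp
  moreover have "even (card A * (card A - 1))" by (cases "card A") auto
  ultimately show ?thesis by (simp add: choose_two)
qed

lemma card_joins: "finite A \<Longrightarrow> finite C \<Longrightarrow> card (joins A C) \<le> card A * card C"
proof -
  assume f: "finite A" "finite C"
  have "joins A C \<subseteq> (\<lambda>(a, c). {a, c}) ` (A \<times> C)"
    by (auto simp: joins_def)
  then have "card (joins A C) \<le> card ((\<lambda>(a, c). {a, c}) ` (A \<times> C))"
    using f by (intro card_mono) auto
  also have "\<dots> \<le> card (A \<times> C)" using f by (intro card_image_le) auto
  finally show ?thesis by (simp add: card_cartesian_product)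
qed

section \<open>Counting edges inside, leaving or meeting a vertex set\<close>

lemma edges_inside:
  assumes "edges_on V E" "finite A"
  shows "2 * card {e \<in> E. e \<subseteq> A} \<le> card A * (card A - 1)"
proof -
  have "{e \<in> E. e \<subseteq> A} \<subseteq> pairs A"
  proof
    fix e assume "e \<in> {e \<in> E. e \<subseteq> A}"
    moreover from this obtain a b where "e = {a, b}" "a \<noteq> b"
      using assms(1) edges_on_obtain by (metis (no_types, lifting) mem_Collect_eq)
    ultimately show "e \<in> pairs A" by (simp add: pairs_iff)
  qed
  then have "card {e \<in> E. e \<subseteq> A} \<le> card (pairs A)"
    using assms(2) finite_pairs card_mono by blast
  then show ?thesis using card_pairs[OF assms(2)] by linarith
qed

lemma edges_from:
  assumes "finite W" "\<And>z. z \<in> W \<Longrightarrow> finite (nb E z)" "\<And>z. z \<in> W \<Longrightarrow> card (nb E z - S) \<le> b"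
  shows "finite {{z, w} | z w. z \<in> W \<and> w \<in> nb E z - S}" (is "finite ?A")
    "card {{z, w} | z w. z \<in> W \<and> w \<in> nb E z - S} \<le> card W * b"
proof -
  have eq: "?A = (\<Union>z\<in>W. (\<lambda>w. {z, w}) ` (nb E z - S))" by auto
  show "finite ?A" unfolding eq using assms by auto
  have "card ?A \<le> (\<Sum>z\<in>W. card ((\<lambda>w. {z, w}) ` (nb E z - S)))"
    unfolding eq by (rule card_UN_le[OF assms(1)])
  also have "\<dots> \<le> (\<Sum>z\<in>W. b)"
    using assms(2,3) by (intro sum_mono order_trans[OF card_image_le]) auto
  finally show "card ?A \<le> card W * b" by simp
qed

text \<open>The t-th vertex of P adds at most n - t edges not counted before; the form without
  subtraction keeps the induction within the natural numbers.\<close>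

lemma edges_meeting:
  assumes "edges_on {..<n} E" "finite P" "P \<subseteq> {..<n}"
  shows "2 * card {e \<in> E. e \<inter> P \<noteq> {}} + card P * (card P + 1) \<le> 2 * card P * n"
  using assms(2,3)
proof (induction P)
  case (insert b P)
  have fE: "finite E" using assms(1) edges_on_finite by blast
  let ?N = "(\<lambda>w. {b, w}) ` ({..<n} - insert b P)"
  have "{e \<in> E. e \<inter> insert b P \<noteq> {}} \<subseteq> {e \<in> E. e \<inter> P \<noteq> {}} \<union> ?N"
  proof
    fix e assume e: "e \<in> {e \<in> E. e \<inter> insert b P \<noteq> {}}"
    show "e \<in> {e \<in> E. e \<inter> P \<noteq> {}} \<union> ?N"
    proof (cases "e \<inter> P = {}")
      case True
      then have "b \<in> e" using e by auto
      moreover obtain x y where "e = {x, y}" "x \<noteq> y" "x < n" "y < n"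
        using e assms(1) edges_on_obtain by (metis (no_types, lifting) lessThan_iff mem_Collect_eq)
      ultimately show ?thesis using True by (auto simp: insert_commute)
    qed (use e in auto)
  qed
  then have "card {e \<in> E. e \<inter> insert b P \<noteq> {}} \<le> card ({e \<in> E. e \<inter> P \<noteq> {}} \<union> ?N)"
    by (intro card_mono) (use fE in auto)
  also have "\<dots> \<le> card {e \<in> E. e \<inter> P \<noteq> {}} + card ?N" by (rule card_Un_le)
  also have "card ?N \<le> card ({..<n} - insert b P)" by (rule card_image_le) simp
  also have "card ({..<n} - insert b P) = n - Suc (card P)"
    using insert by (subst card_Diff_subset) auto
  finally have 1: "card {e \<in> E. e \<inter> insert b P \<noteq> {}} \<le> card {e \<in> E. e \<inter> P \<noteq> {}} + (n - Suc (card P))"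
    by simp
  have "card (insert b P) \<le> card {..<n}"
    using insert.prems by (intro card_mono) auto
  then have "Suc (card P) \<le> n" using insert by simp
  then obtain r where r: "n = Suc (card P) + r" using le_Suc_ex by blast
  show ?case using 1 insert by (simp add: r algebra_simps)
qed simp

text \<open>Among the realizations keeping \<open>E0 \<inter> K\<close>, one with the most edges of
  K is taken. For each missing edge of K this is the condition \<open>stuck\<close> of the locale
  \<open>blocked\<close>.\<close>

lemma obtain_saturated:
  assumes "realizes n d E0" "finite K"
  obtains E where "realizes n d E" "E0 \<inter> K \<subseteq> E"
    "\<And>E'. realizes n d E' \<Longrightarrow> E \<inter> K \<subseteq> E' \<Longrightarrow> E' \<inter> K \<subseteq> E"
proof -
  let ?P = "\<lambda>E. realizes n d E \<and> E0 \<inter> K \<subseteq> E"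
  have "\<forall>E. ?P E \<longrightarrow> card (E \<inter> K) < Suc (card K)"
    using assms(2) by (auto simp: less_Suc_eq_le intro: card_mono)
  then obtain E where E: "?P E" and max: "\<forall>E'. ?P E' \<longrightarrow> card (E' \<inter> K) \<le> card (E \<inter> K)"
    using ex_has_greatest_nat[of ?P E0 "\<lambda>E. card (E \<inter> K)" "Suc (card K)"] assms(1) by blast
  show thesis
  proof (rule that[of E])
    fix E' assume E': "realizes n d E'" "E \<inter> K \<subseteq> E'"
    then have "card (E' \<inter> K) \<le> card (E \<inter> K)" using max E by blast
    then have "E \<inter> K = E' \<inter> K"
      using card_seteq[of "E' \<inter> K" "E \<inter> K"] E' assms(2) by blast
    then show "E' \<inter> K \<subseteq> E" by blast
  qed (use E in auto)
qed

lemma (in blocked) blocked_sym: "blocked n d E K v u"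
  by unfold_locales (use E uv stuck in \<open>auto simp: insert_commute\<close>)

lemma (in blocked) Y_clique: "Y \<subseteq> T \<Longrightarrow> clique E Y"
proof (unfold clique_def, intro ballI impI)
  fix a b assume "Y \<subseteq> T" "a \<in> Y" "b \<in> Y" "a \<noteq> b"
  with T_nb[of b a] have "b \<in> nb E a" by blast
  then show "{a, b} \<in> E" by (simp add: nb_iff)
qed

lemma (in blocked) X_clique: "X \<subseteq> Z \<Longrightarrow> clique E X"
proof (unfold clique_def, intro ballI impI)
  fix a b assume "X \<subseteq> Z" "a \<in> X" "b \<in> X" "a \<noteq> b"
  with Z_nb[of b a] have "b \<in> nb E a" by blast
  then show "{a, b} \<in> E" by (simp add: nb_iff)
qed

definition has_clique :: "nat \<Rightarrow> nat \<Rightarrow> nat set set \<Rightarrow> bool" where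
  "has_clique n k E \<longleftrightarrow> (\<exists>Q\<subseteq>{..<n}. card Q = k \<and> clique E Q)"

lemma has_cliqueI:
  assumes "clique E Q" "Q \<subseteq> {..<n}" "k \<le> card Q"
  shows "has_clique n k E"
proof -
  obtain Q' where "Q' \<subseteq> Q" "card Q' = k"
    using assms(3) obtain_subset_with_card_n by metis
  then show ?thesis using assms unfolding has_clique_def clique_def by blast
qed

text \<open>The degree sum exceeds that of the join of a clique on m - 1 vertices with an independent set by at
  least 2 * \<eta>. In the application \<eta> is 1, or 2 if k mod 3 = 1.\<close>

locale degree_sequence =
  fixes n k m g \<eta> :: nat and d :: "nat \<Rightarrow> nat"
  assumes mono: "\<And>i j. i \<le> j \<Longrightarrow> j < n \<Longrightarrow> d j \<le> d i"
    and k: "k = m + g" "4 \<le> m" "2 \<le> g" "3 * m \<le> 2 * k" "3 * g \<le> k + 2"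
    and n: "2 * k * k \<le> n"
    and sum_d: "int (m - 1) * (2 * int n - int m) + 2 * int \<eta> \<le> (\<Sum>v<n. int (d v))" "1 \<le> \<eta>"
begin

lemma kn: "k < n" and k6: "6 \<le> k"
proof -
  show "6 \<le> k" using k by simp
  then have "2 * k \<le> 2 * k * k" by simp
  with n \<open>6 \<le> k\<close> show "k < n" by linarith
qed

text \<open>The edge total minus the largest number of edges that can meet P. For b = 0 at least
  \<eta> edges remain; for b > 0 their number grows like b * n, which contradicts every bound
  obtained from confinement.\<close>

lemma avoiding_ge:
  assumes "realizes n d E" "P \<subseteq> {..<n}" "card P + b + 1 = m"
  shows "2 * int b * (int n - int (card P)) - int b * (int b + 1) + 2 * int \<eta>
    \<le> 2 * int (card {e \<in> E. e \<inter> P = {}})"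
proof -
  have on: "edges_on {..<n} E" using assms(1) by (simp add: realizes_def)
  have fE: "finite E" using on edges_on_finite by blast
  have "(\<Sum>v<n. d v) = (\<Sum>v\<in>{..<n}. card (nb E v))"
    using assms(1) by (intro sum.cong) (auto simp: realizes_def)
  then have "(\<Sum>v<n. int (d v)) = 2 * int (card E)"
    using sum_card_nb[OF on] by (simp flip: of_nat_sum)
  moreover have "card E = card {e \<in> E. e \<inter> P = {}} + card {e \<in> E. e \<inter> P \<noteq> {}}"
    using fE by (subst card_Un_disjoint[symmetric]) (auto intro: arg_cong[where f = card])
  moreover have "int (2 * card {e \<in> E. e \<inter> P \<noteq> {}} + card P * (card P + 1)) \<le> int (2 * card P * n)"
    using edges_meeting[OF on _ assms(2)] finite_subset[OF assms(2)] by (simp only: of_nat_le_iff) simp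
  ultimately have *: "int (m - 1) * (2 * int n - int m) + 2 * int \<eta> - 2 * int (card P) * int n
      + int (card P) * (int (card P) + 1) \<le> 2 * int (card {e \<in> E. e \<inter> P = {}})"
    using sum_d(1) by (simp add: algebra_simps)
  have m: "int (m - 1) = int (card P) + int b" "int m = int (card P) + int b + 1"
    using assms(3) by linarith+
  show ?thesis using * unfolding m by (simp add: algebra_simps)
qed

end

locale heavy_top = degree_sequence +
  assumes top: "k - 1 \<le> d (m - 2)"
begin

definition "B = {..<m - 1}"

lemma B: "finite B" "card B = m - 1" "B \<subseteq> {..<n}"
  using kn k by (auto simp: B_def)

lemma d_B: "b \<in> B \<Longrightarrow> k - 1 \<le> d b"
  using top mono[of b "m - 2"] kn k by (intro order_trans[OF top]) (auto simp: B_def)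

lemma d_le: "b \<in> B \<Longrightarrow> w \<notin> B \<Longrightarrow> w < n \<Longrightarrow> d w \<le> d b"
  by (rule mono) (auto simp: B_def)

end

section \<open>Making the m - 1 vertices of largest degree pairwise adjacent\<close>

lemma clique_B_numeric:
  fixes n k m b s :: int
  assumes "2 \<le> b" "b \<le> m - 1" "0 \<le> s" "s \<le> k + b - 2" "2 * k * k \<le> n" "3 * m \<le> 2 * k" "4 \<le> m" "6 \<le> k"
  shows "b * (b - 1) + 2 * (s * (s - 1)) + 2 * (s * (m - 2)) < 2 * b * (n - (m - 1 - b)) - b * (b + 1) + 2"
proof -
  have 1: "s * (s + m - 3) \<le> (k + b - 2) * (k + 2 * m - 6)"
    by (rule mult_mono) (use assms in auto)
  \<comment> \<open>As b \<ge> 2, the factor k + b - 2 is at most b * k / 2. This turns the bound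
    into a multiple of b, to be compared with b * n.\<close>
  have "0 \<le> (b - 2) * (k - 2)" using assms by simp
  then have "2 * (k + b - 2) \<le> b * k" by (simp add: algebra_simps)
  moreover have "3 * (k + 2 * m - 6) \<le> 7 * k - 18" using assms by simp
  ultimately have "(2 * (k + b - 2)) * (3 * (k + 2 * m - 6)) \<le> (b * k) * (7 * k - 18)"
    by (rule mult_mono) (use assms in auto)
  then have 2: "6 * (s * (s + m - 3)) \<le> b * (k * (7 * k - 18))"
    using 1 by (simp add: algebra_simps)
  have "k * (7 * k - 18) \<le> 6 * (n - m + 1)"
  proof -
    define q where "q = k * k"
    have "0 \<le> q" "2 * q \<le> n" using assms by (auto simp: q_def)
    then have "7 * q - 18 * k \<le> 6 * (n - m + 1)" using assms(6-8) by simp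
    then show ?thesis by (simp add: q_def algebra_simps)
  qed
  then have "b * (k * (7 * k - 18)) \<le> b * (6 * (n - m + 1))"
    using assms by (intro mult_left_mono) auto
  then have "s * (s + m - 3) \<le> b * (n - m + 1)" using 2 by (simp add: algebra_simps)
  then show ?thesis by (simp add: algebra_simps)
qed

context heavy_top
begin

text \<open>Inside \<open>B\<close>, v is adjacent neither to itself nor to u, so d v exceeds the
  size of the clique Y by at most m - 3. Every vertex outside \<open>B\<close> has degree at most d
  v. Thus without a clique on k vertices only vertices of \<open>B\<close> can have large degree,
  and the dangerous ones are collected in \<open>P\<close>.\<close>

lemma blocked_clique_B:
  assumes bl: "blocked n d E (pairs B) u v" and uB: "u \<in> B" "v \<in> B"
    and YT: "blocked.Y E (pairs B) v \<subseteq> blocked.T n E (pairs B) v"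
  shows "has_clique n k E"
proof (rule ccontr)
  assume no: "\<not> has_clique n k E"
  interpret blocked n d E "pairs B" u v by (rule bl)
  note fin_nb[simp] fin[simp]
  have Xe: "X = nb E u - B" and Ye: "Y = nb E v - B"
    using uB nb_irrefl[OF on] by (auto simp: X_def Y_def nb_def pairs_iff)
  have Yn: "Y \<subseteq> {..<n}" and Xn: "X \<subseteq> {..<n}" using nb_subset[OF on] Xe Ye by blast+
  have "card Y < k"
    using no has_cliqueI[OF Y_clique[OF YT] Yn] by (metis not_less)
  define c where "c = card Y"
  have uv': "u \<notin> nb E v" "v \<notin> nb E u" using uv by (auto simp: nb_def insert_commute)
  have inB: "card (nb E w \<inter> B) \<le> m - 3" if "w \<in> {u, v}" for w
  proof -
    have "nb E w \<inter> B \<subseteq> B - {u, v}" using uv' nb_irrefl[OF on] that by auto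
    then have "card (nb E w \<inter> B) \<le> card (B - {u, v})" using B by (intro card_mono) auto
    also have "\<dots> = m - 3" using uB uv(1) B k by (subst card_Diff_subset) auto
    finally show ?thesis .
  qed
  have split: "d w = card (nb E w \<inter> B) + card (nb E w - B)" if "w \<in> {u, v}" for w
    using deg[of w] card_Int_Diff[of "nb E w" B] that uB B by auto
  have dv: "d v \<le> c + (m - 3)" and du: "d u \<le> card X + (m - 3)"
    using split[of v] inB[of v] split[of u] inB[of u] by (auto simp: c_def Xe Ye)
  have "c > 0" "card X > 0" using dv du d_B[OF uB(1)] d_B[OF uB(2)] k by linarith+
  then obtain x y where x: "x \<in> X" and y: "y \<in> Y" unfolding c_def by (metis card_gt_0_iff ex_in_conv)
  have cd: "d w \<le> c + m - 3" if "w \<notin> B" "w < n" for w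
    using d_le[OF uB(2) that] dv k by linarith
  have cT: "card T \<le> c + m - 2" and cZ: "card Z \<le> c + m - 2"
    using card_T[OF y] card_Z[OF x] cd[of x] cd[of y] x y Xn Yn Xe Ye k by auto
  \<comment> \<open>Vertices of \<open>B\<close> in both \<open>Z\<close> and \<open>T\<close> are
    the ones whose edges confinement does not control. u and v are left out, which makes b at least
    2: unfrozen edges of u end in X \<subseteq> T, those of v in Y \<subseteq> Z, so both are still
    covered.\<close>
  define P where "P = (B \<inter> Z \<inter> T) - {u, v}"
  have P: "P \<subseteq> {..<n}" "finite P" "P \<subseteq> T" "P \<subseteq> Z" "P \<subseteq> B - {u, v}" using B by (auto simp: P_def)
  have "card P \<le> card (B - {u, v})" using P B by (intro card_mono) auto
  also have "\<dots> = m - 3" using uB uv(1) B k by (subst card_Diff_subset) auto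
  finally have cP: "card P \<le> m - 3" .
  define b where "b = m - 1 - card P"
  have b: "card P + b + 1 = m" "2 \<le> b" using cP k by (auto simp: b_def)
  \<comment> \<open>\<open>T\<close> and \<open>Z\<close> have at most c + m - 2 vertices, and m - 1
    - b of these belong to \<open>P\<close>.\<close>
  define s where "s = c + b - 1"
  define W where "W = (Z \<inter> T) - B"
  have cs: "card (T - P) \<le> s" "card (Z - P) \<le> s" "card W \<le> s"
  proof -
    show 1: "card (T - P) \<le> s" "card (Z - P) \<le> s"
      using P cT cZ b by (auto simp: card_Diff_subset s_def)
    have "W \<subseteq> T - P" using P by (auto simp: W_def)
    then have "card W \<le> card (T - P)" by (intro card_mono) auto
    with 1 show "card W \<le> s" by simp
  qed
  \<comment> \<open>All of Y except possibly w itself is adjacent to w, which uses up c - 1 of at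
    most c + m - 3 edges.\<close>
  have cW: "card (nb E w - Y) \<le> m - 2" if "w \<in> W" for w
  proof -
    have w: "w < n" "w \<notin> B" "Y - {w} \<subseteq> nb E w" using that by (auto simp: W_def T_def)
    have "card (nb E w - Y) = card (nb E w) - card (nb E w \<inter> Y)"
      by (rule card_Diff_subset_Int) simp
    moreover have "card (Y - {w}) \<le> card (nb E w \<inter> Y)" using w by (intro card_mono) auto
    moreover have "c - 1 \<le> card (Y - {w})" by (simp add: c_def card_Diff_singleton_if)
    ultimately show ?thesis using cd[OF w(2,1)] deg[OF w(1)] by linarith
  qed
  let ?F = "pairs (B - P)" and ?L = "{{z, w} | z w. z \<in> W \<and> w \<in> nb E z - Y}"
  have fE: "finite E" using on edges_on_finite by blast
  have cover: "{e \<in> E. e \<inter> P = {}} \<subseteq> ?F \<union> {e \<in> E. e \<subseteq> T - P} \<union> {e \<in> E. e \<subseteq> Z - P} \<union> ?L"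
  proof
    fix e assume e: "e \<in> {e \<in> E. e \<inter> P = {}}"
    then obtain a a' where a: "e = {a, a'}" "a \<noteq> a'"
      using on edges_on_obtain by (metis (no_types, lifting) mem_Collect_eq)
    show "e \<in> ?F \<union> {e \<in> E. e \<subseteq> T - P} \<union> {e \<in> E. e \<subseteq> Z - P} \<union> ?L"
    proof (cases "e \<in> pairs B")
      case True
      then show ?thesis using e a by (auto simp: pairs_iff)
    next
      case False
      \<comment> \<open>\<open>ZT\<close> in both orientations: an unfrozen edge inside neither
        \<open>T\<close> nor \<open>Z\<close> has an end lying in both sets.\<close>
      have key: "e \<subseteq> T \<or> e \<subseteq> Z \<or> e \<in> ?L" if pZT: "e = {p, q}" "p \<in> Z" "p \<in> T" for p q
      proof -
        have pq: "{p, q} \<in> E - pairs B" "{q, p} \<in> E - pairs B" "p \<notin> P"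
          using e False pZT by (auto simp: insert_commute)
        consider "p = u" | "p = v" | "p \<in> W" using pq pZT by (auto simp: P_def W_def)
        then show ?thesis
        proof cases
          case 1 then have "q \<in> X" using pq by (simp add: X_def nb_def)
          then show ?thesis using X_T pZT by auto
        next
          case 2 then have "q \<in> Y" using pq by (simp add: Y_def nb_def)
          then show ?thesis using Y_Z pZT by auto
        next
          case 3
          show ?thesis
          proof (cases "q \<in> Y")
            case True then show ?thesis using YT pZT by auto
          next
            case False then show ?thesis using 3 pq pZT by (auto simp: nb_def)
          qed
        qed
      qed
      have "e \<subseteq> T \<or> e \<subseteq> Z \<or> e \<in> ?L"
        using ZT[of a a'] ZT[of a' a] key[of a a'] key[of a' a] e a False by (auto simp: insert_commute)
      then show ?thesis using e by auto
    qed
  qed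
  have fL: "finite ?L" and cL: "card ?L \<le> card W * (m - 2)"
    using edges_from[of W E Y "m - 2"] cW by (auto simp: W_def)
  have fF: "finite ?F" using B by (intro finite_pairs) auto
  have "card {e \<in> E. e \<inter> P = {}} \<le> card (?F \<union> {e \<in> E. e \<subseteq> T - P} \<union> {e \<in> E. e \<subseteq> Z - P} \<union> ?L)"
    using cover fE fL fF by (intro card_mono) auto
  also have "\<dots> \<le> card ?F + card {e \<in> E. e \<subseteq> T - P} + card {e \<in> E. e \<subseteq> Z - P} + card ?L"
    by (intro order_trans[OF card_Un_le] add_mono order_refl)
  finally have "2 * card {e \<in> E. e \<inter> P = {}} \<le> 2 * card ?F + 2 * card {e \<in> E. e \<subseteq> T - P}
      + 2 * card {e \<in> E. e \<subseteq> Z - P} + 2 * card ?L" by linarith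
  moreover have "2 * card ?F = b * (b - 1)"
  proof -
    have "card (B - P) = b" using P B by (subst card_Diff_subset) (auto simp: b_def)
    then show ?thesis using card_pairs[of "B - P"] B by simp
  qed
  moreover have "2 * card {e \<in> E. e \<subseteq> T - P} \<le> s * (s - 1)"
    using edges_inside[OF on, of "T - P"] mult_le_mono[OF cs(1) diff_le_mono[OF cs(1)], of 1] by simp
  moreover have "2 * card {e \<in> E. e \<subseteq> Z - P} \<le> s * (s - 1)"
    using edges_inside[OF on, of "Z - P"] mult_le_mono[OF cs(2) diff_le_mono[OF cs(2)], of 1] by simp
  moreover have "card ?L \<le> s * (m - 2)"
    using cL mult_le_mono1[OF cs(3), of "m - 2"] by linarith
  ultimately have "2 * card {e \<in> E. e \<inter> P = {}} \<le> b * (b - 1) + 2 * (s * (s - 1)) + 2 * (s * (m - 2))"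
    by linarith
  then have up: "int (2 * card {e \<in> E. e \<inter> P = {}}) \<le> int (b * (b - 1) + 2 * (s * (s - 1)) + 2 * (s * (m - 2)))"
    by (simp only: of_nat_le_iff)
  have s1: "1 \<le> s" using \<open>0 < c\<close> b by (simp add: s_def)
  have "int (b * (b - 1) + 2 * (s * (s - 1)) + 2 * (s * (m - 2)))
      = int b * (int b - 1) + 2 * (int s * (int s - 1)) + 2 * (int s * (int m - 2))"
    using s1 b k by (simp add: of_nat_diff)
  moreover have "int b * (int b - 1) + 2 * (int s * (int s - 1)) + 2 * (int s * (int m - 2))
      < 2 * int b * (int n - (int m - 1 - int b)) - int b * (int b + 1) + 2"
  proof (rule clique_B_numeric[of _ _ _ "int k"])
    show "int s \<le> int k + int b - 2" using \<open>card Y < k\<close> b by (simp add: s_def c_def)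
    show "2 * int k * int k \<le> int n" using n by (metis of_nat_le_iff of_nat_mult of_nat_numeral)
  qed (use b k k6 in auto)
  moreover have "int (card P) = int m - 1 - int b" using b by linarith
  ultimately show False
    using avoiding_ge[OF E P(1) b(1)] up sum_d(2) by simp
qed

lemma realize_clique_B:
  assumes "realizes n d E0"
  obtains E where "realizes n d E" "has_clique n k E \<or> clique E B"
proof -
  obtain E where E: "realizes n d E" "\<And>E'. realizes n d E' \<Longrightarrow> E \<inter> pairs B \<subseteq> E' \<Longrightarrow> E' \<inter> pairs B \<subseteq> E"
    using obtain_saturated[OF assms finite_pairs[OF B(1)]] by metis
  have "has_clique n k E" if "\<not> clique E B"
  proof -
    obtain u v where uB: "u \<in> B" "v \<in> B" "u \<noteq> v" "{u, v} \<notin> E"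
      using \<open>\<not> clique E B\<close> by (auto simp: clique_def)
    interpret blocked n d E "pairs B" u v
    proof
      show "u < n" "v < n" using uB B by auto
      show "{u, v} \<notin> E'" if "realizes n d E'" "E \<inter> pairs B \<subseteq> E'" for E'
        using E(2)[OF that] uB by (auto simp: pairs_iff)
    qed (use E uB in auto)
    have "X \<subseteq> Z \<or> Y \<subseteq> T"
    proof (rule X_Z_or_Y_T)
      fix x y assume "x \<in> X" "y \<in> Y"
      then show "{x, y} \<notin> pairs B" using uB edges_onD(1)[OF on, of u x] by (auto simp: X_def nb_def pairs_iff)
    qed
    then show ?thesis
    proof
      assume "Y \<subseteq> T" then show ?thesis by (rule blocked_clique_B[OF blocked_axioms uB(1,2)])
    next
      assume "X \<subseteq> Z"
      interpret s: blocked n d E "pairs B" v u by (rule blocked_sym)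
      have "s.Y = X" "s.T = Z" by (simp_all add: s.Y_def X_def s.T_def Z_def)
      then show ?thesis using blocked_clique_B[OF s.blocked_axioms uB(2,1)] \<open>X \<subseteq> Z\<close> by simp
    qed
  qed
  then show thesis using that E(1) by blast
qed

end

section \<open>Joining the clique to the next g + 1 vertices\<close>

lemma join_B_U_numeric:
  fixes n k m g a b s :: int
  assumes "2 \<le> b" "b \<le> m - 1" "0 \<le> s" "0 \<le> a" "2 * k * k \<le> n" "3 * m \<le> 2 * k" "4 \<le> m" "6 \<le> k"
    "k = m + g" "3 * g \<le> k + 2" "2 \<le> g"
    and ab: "s \<le> k + b - 2 \<and> a \<le> (b - 1) * (k - 1) \<or> s \<le> g + k - 4 + 2 * b \<and> a \<le> g - 1 + b"
  shows "b * (b - 1) + 2 * (b * (g + 1)) + 2 * (a * s) + 2 * (s * (k - 2)) + (k - 1) * (k - 2)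
    < 2 * b * (n - (m - 1 - b)) - b * (b + 1) + 2"
proof -
  have q: "0 \<le> (k - 1) * (k - 2)" using assms by simp
  \<comment> \<open>The alternatives in \<open>ab\<close> come from \<open>X_Z_or_Y_T\<close>. If Y
    is the clique, s is small and a = |X| is only bounded through the top vertices outside
    \<open>Z\<close>; if X is part of a clique, a is small and s is bounded by comparing
    degrees.\<close>
  have main: "4 * (s * (a + k - 2)) + b * ((k - 1) * (k - 2)) + 4 * (b * (g + 1)) \<le> 4 * (b * (n - m + 1))"
    using ab
  proof
    assume h: "s \<le> k + b - 2 \<and> a \<le> (b - 1) * (k - 1)"
    then have "a + k - 2 \<le> b * (k - 1)" by (simp add: algebra_simps)
    then have "s * (a + k - 2) \<le> (k + m - 3) * (b * (k - 1))"
      using assms h by (intro mult_mono) auto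
    then have 1: "4 * (s * (a + k - 2)) \<le> b * (4 * ((k + m - 3) * (k - 1)))" by (simp add: algebra_simps)
    have t: "3 * ((k + m - 3) * (k - 1)) \<le> (5 * k - 9) * (k - 1)"
      using assms mult_right_mono[of "3 * (k + m - 3)" "5 * k - 9" "k - 1"] by (simp add: algebra_simps)
    define q t where "q = k * k" and "t = (k + m - 3) * (k - 1)"
    have "0 \<le> q" "2 * q \<le> n" using assms(5) by (auto simp: q_def)
    moreover have "3 * t \<le> 5 * q - 14 * k + 9" using t unfolding q_def t_def by (simp add: algebra_simps)
    ultimately have "4 * t + (q - 3 * k + 2) + 4 * (g + 1) \<le> 4 * (n - m + 1)"
      using assms(6-11) by simp
    moreover have "q - 3 * k + 2 = (k - 1) * (k - 2)" by (simp add: q_def algebra_simps)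
    ultimately have "4 * ((k + m - 3) * (k - 1)) + (k - 1) * (k - 2) + 4 * (g + 1) \<le> 4 * (n - m + 1)"
      by (simp only: t_def)
    then have "b * (4 * ((k + m - 3) * (k - 1)) + (k - 1) * (k - 2) + 4 * (g + 1)) \<le> b * (4 * (n - m + 1))"
      using assms by (intro mult_left_mono) auto
    then show ?thesis using 1 by (simp add: algebra_simps)
  next
    assume h: "s \<le> g + k - 4 + 2 * b \<and> a \<le> g - 1 + b"
    have "0 \<le> (b - 2) * (g + k - 4)" using assms by simp
    then have "2 * s \<le> b * (g + k)" using h by (simp add: algebra_simps)
    moreover have "a + k - 2 \<le> 2 * k - 4" using assms h by simp
    moreover have "0 \<le> b * (g + k)" "0 \<le> a + k - 2" using assms by simp_all
    ultimately have "(2 * s) * (a + k - 2) \<le> (b * (g + k)) * (2 * k - 4)"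
      by (rule mult_mono)
    then have 1: "4 * (s * (a + k - 2)) \<le> b * (4 * ((g + k) * (k - 2)))" by (simp add: algebra_simps)
    have t: "3 * ((g + k) * (k - 2)) \<le> (4 * k + 2) * (k - 2)"
      using assms mult_right_mono[of "3 * (g + k)" "4 * k + 2" "k - 2"] by (simp add: algebra_simps)
    define q t where "q = k * k" and "t = (g + k) * (k - 2)"
    have "0 \<le> q" "2 * q \<le> n" using assms(5) by (auto simp: q_def)
    moreover have "3 * t \<le> 4 * q - 6 * k - 4" using t unfolding q_def t_def by (simp add: algebra_simps)
    ultimately have "4 * t + (q - 3 * k + 2) + 4 * (g + 1) \<le> 4 * (n - m + 1)"
      using assms(6-11) by simp
    moreover have "q - 3 * k + 2 = (k - 1) * (k - 2)" by (simp add: q_def algebra_simps)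
    ultimately have "4 * ((g + k) * (k - 2)) + (k - 1) * (k - 2) + 4 * (g + 1) \<le> 4 * (n - m + 1)"
      by (simp only: t_def)
    then have "b * (4 * ((g + k) * (k - 2)) + (k - 1) * (k - 2) + 4 * (g + 1)) \<le> b * (4 * (n - m + 1))"
      using assms by (intro mult_left_mono) auto
    then show ?thesis using 1 by (simp add: algebra_simps)
  qed
  have "2 * ((k - 1) * (k - 2)) \<le> b * ((k - 1) * (k - 2))"
    using assms(1) q by (intro mult_right_mono) auto
  with main have "4 * (s * (a + k - 2)) + 2 * ((k - 1) * (k - 2)) + 4 * (b * (g + 1)) \<le> 4 * (b * (n - m + 1))"
    by linarith
  then show ?thesis by (simp add: algebra_simps)
qed

context heavy_top
begin

text \<open>With these g + 1 vertices, \<open>B \<union> U\<close> has exactly k elements, the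
  number needed for a copy of a 2-tree.\<close>

definition "U = {m - 1..<k}"

lemma U: "finite U" "card U = g + 1" "B \<union> U = {..<k}" "B \<inter> U = {}"
  unfolding U_def B_def using k by auto

lemma d_U: "v \<in> U \<Longrightarrow> k \<le> x \<Longrightarrow> x < n \<Longrightarrow> d x \<le> d v"
  by (rule mono) (auto simp: U_def)

lemma blocked_join_B_U:
  assumes bl: "blocked n d E (pairs B \<union> joins B U) u v" and uB: "u \<in> B" "v \<in> U" "clique E B" "m - 1 \<le> d v"
  shows "has_clique n k E"
proof (rule ccontr)
  assume no: "\<not> has_clique n k E"
  let ?K = "pairs B \<union> joins B U"
  interpret blocked n d E ?K u v by (rule bl)
  note fin_nb[simp] fin[simp]
  have irr: "w \<notin> nb E w" for w using nb_irrefl[OF on] .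
  have K: "{p, q} \<in> ?K \<longleftrightarrow> p \<noteq> q \<and> (p \<in> B \<and> q < k \<or> q \<in> B \<and> p < k)" for p q
    using U(3) by (auto simp: pairs_iff joins_iff)
  have vB: "v \<notin> B" "v < k" using uB U by auto
  have uk: "u < k" using uB U by auto
  have Xe: "X = nb E u - {..<k}" and Ye: "Y = nb E v - B"
    unfolding X_def Y_def set_eq_iff Diff_iff nb_iff K using U(3) uB vB edges_onD(1)[OF on] by auto
  have Yn: "Y \<subseteq> {..<n}" and Xn: "X \<subseteq> {..<n}" using nb_subset[OF on] Xe Ye by blast+
  have XB: "X \<inter> B = {}" "X \<inter> {..<k} = {}" using Xe U(3) by auto
  have uv': "u \<notin> nb E v" "v \<notin> nb E u" using uv by (auto simp: nb_def insert_commute)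
  define c where "c = card Y"
  have dv: "d v \<le> m - 2 + c"
  proof -
    have "nb E v \<inter> B \<subseteq> B - {u}" using uv' by auto
    then have "card (nb E v \<inter> B) \<le> card (B - {u})" using B by (intro card_mono) auto
    then have "card (nb E v \<inter> B) \<le> m - 2" using uB B by simp
    then show ?thesis
      using deg[OF uv(3)] card_Int_Diff[of "nb E v" B] by (simp add: c_def Ye)
  qed
  have du: "d u \<le> card X + (k - 2)"
  proof -
    have "nb E u \<inter> {..<k} \<subseteq> {..<k} - {u, v}" using uv' irr by auto
    then have "card (nb E u \<inter> {..<k}) \<le> card ({..<k} - {u, v})" by (intro card_mono) auto
    also have "\<dots> = k - 2" using uv vB uk by (subst card_Diff_subset) auto
    finally show ?thesis
      using deg[OF uv(2)] card_Int_Diff[of "nb E u" "{..<k}"] by (simp add: Xe)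
  qed
  have "0 < c" using dv uB(4) k by linarith
  moreover have "0 < card X" using du d_B[OF uB(1)] k6 by linarith
  ultimately obtain x0 y where x0: "x0 \<in> X" and y: "y \<in> Y" unfolding c_def by (metis card_gt_0_iff ex_in_conv)
  have yB: "y \<notin> B" "y < n" using y Ye Yn by auto
  have dx: "d x \<le> d v" if "x \<in> X" for x using d_U[OF uB(2), of x] that Xe Xn by auto
  have cT: "card T \<le> Suc (d y)" by (rule card_T[OF y])
  \<comment> \<open>If x were joined to all of \<open>B - Z\<close>, its neighbourhood would contain
    \<open>B \<union> Z\<close> except x, while that of v lies in \<open>B \<union> Z\<close> except
    u. Since d x \<le> d v, both inclusions would be equalities, and then v would be a neighbour of
    itself.\<close>
  have miss: "\<exists>b\<in>B - Z. b \<notin> nb E x" if x: "x \<in> X" for x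
  proof (rule ccontr)
    assume c: "\<not> ?thesis"
    have xx: "x \<notin> B" "x < n" "x \<noteq> u" using x XB Xn uB by auto
    have all: "B \<union> Z - {x} \<subseteq> nb E x"
      using c Z_nb[OF _ x] xx by blast
    have vs: "nb E v \<subseteq> B \<union> Z - {u}"
      using uv' Ye Y_Z by blast
    have fBZ: "finite (B \<union> Z)" using B by simp
    have "card (B \<union> Z - {x}) \<le> d x" using card_mono[OF _ all] deg[OF xx(2)] by simp
    also have "\<dots> \<le> d v" by (rule dx[OF x])
    also have le: "d v \<le> card (B \<union> Z - {u})" using card_mono[OF _ vs] fBZ deg[OF uv(3)] by simp
    finally have le2: "card (B \<union> Z - {x}) \<le> card (B \<union> Z - {u})" .
    have cu: "card (B \<union> Z - {u}) < card (B \<union> Z)" using uB fBZ by (intro psubset_card_mono) auto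
    then have xZ: "x \<in> Z" using le2 xx by (cases "x \<in> B \<union> Z") auto
    then have eq: "card (B \<union> Z - {x}) = card (B \<union> Z - {u})" using uB fBZ by simp
    then have "card (nb E x) \<le> card (B \<union> Z - {x})" using dx[OF x] le deg[OF xx(2)] by simp
    then have ex: "nb E x = B \<union> Z - {x}" using card_seteq[OF _ all] by simp
    then have "card (B \<union> Z - {u}) \<le> card (nb E v)"
      using eq dx[OF x] deg[OF xx(2)] deg[OF uv(3)] by simp
    then have ev: "nb E v = B \<union> Z - {u}" using card_seteq[OF _ vs] fBZ by simp
    have "x \<in> nb E v" using ev xZ xx by auto
    then have "v \<in> nb E x" using nb_sym by metis
    then have "v \<in> nb E v" using ex ev uv by auto
    with irr show False by blast
  qed
  \<comment> \<open>As b is not in \<open>Z\<close>, its unfrozen edges end in \<open>T\<close>,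
    which has at most d y + 1 \<le> d b + 1 elements. The vertex v and the members of X missed by b
    occupy places in \<open>T\<close>. At most k - 1 neighbours of b lie below k, so b can reach its
    degree only if it misses at most k - 1 members of X.\<close>
  have cX1: "card (X - nb E b) \<le> k - 1" if b: "b \<in> B - Z" for b
  proof -
    have bk: "b < n" "b < k" "b \<noteq> v" using b B U vB by auto
    have sub: "nb E b - {..<k} \<subseteq> T"
    proof
      fix w assume "w \<in> nb E b - {..<k}"
      then have "{b, w} \<in> E - ?K" using b U(3) unfolding nb_iff Diff_iff K by (auto simp: nb_iff)
      then show "w \<in> T" using ZT b by blast
    qed
    have "nb E b - {..<k} \<subseteq> T - insert v (X - nb E b)" using sub vB by auto
    then have "card (nb E b - {..<k}) \<le> card (T - insert v (X - nb E b))" by (intro card_mono) auto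
    also have "\<dots> = card T - card (insert v (X - nb E b))" using X_T v_T by (subst card_Diff_subset) auto
    also have "card (insert v (X - nb E b)) = Suc (card (X - nb E b))" using vB XB by (subst card_insert_disjoint) auto
    finally have 1: "card (nb E b - {..<k}) \<le> card T - Suc (card (X - nb E b))" .
    have "card (nb E b \<inter> {..<k}) \<le> card ({..<k} - {b})" using irr by (intro card_mono) auto
    then have 2: "card (nb E b \<inter> {..<k}) \<le> k - 1" using bk by simp
    have "Suc (card (X - nb E b)) \<le> card T"
    proof -
      have "card (insert v (X - nb E b)) \<le> card T" using X_T v_T by (intro card_mono) auto
      then show ?thesis using vB XB by (subst (asm) card_insert_disjoint) auto
    qed
    moreover have "d y \<le> d b" using b d_le[of b y] yB by auto
    ultimately show ?thesis
      using 1 2 cT deg[OF bk(1)] card_Int_Diff[of "nb E b" "{..<k}"] by simp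
  qed
  have cX: "card X \<le> card (B - Z) * (k - 1)"
  proof -
    have "X \<subseteq> (\<Union>b\<in>B - Z. X - nb E b)" using miss nb_sym by fastforce
    then have "card X \<le> card (\<Union>b\<in>B - Z. X - nb E b)" using B by (intro card_mono) auto
    also have "\<dots> \<le> (\<Sum>b\<in>B - Z. card (X - nb E b))" using B by (intro card_UN_le) auto
    also have "\<dots> \<le> (\<Sum>b\<in>B - Z. k - 1)" by (intro sum_mono cX1)
    finally show ?thesis by simp
  qed
  \<comment> \<open>Although u lies in \<open>B \<inter> Z\<close>, it is left out: its unfrozen
    edges all end in X and are counted there, and b becomes one more than the size of
    \<open>B - Z\<close>, hence at least 2, as the numerical estimate requires.\<close>
  define P where "P = B \<inter> Z - {u}"
  have P: "P \<subseteq> {..<n}" "finite P" "P \<subseteq> Z" "P \<subseteq> B" "u \<notin> P" using B by (auto simp: P_def)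
  define b where "b = card (B - Z) + 1"
  have BZ: "card (B \<inter> Z) + card (B - Z) = m - 1" using card_Int_Diff[of B Z] B by simp
  have "card (B - Z) \<noteq> 0" using miss[OF x0] B by auto
  then have b2: "2 \<le> b" by (simp add: b_def)
  have uBZ: "u \<in> B \<inter> Z" using uB u_Z by simp
  have cBZ: "card (B \<inter> Z) = Suc (card P)"
    unfolding P_def using uBZ B by (subst card_Suc_Diff1) auto
  have bP: "card P + b + 1 = m" using BZ cBZ k by (simp add: b_def)
  define s where "s = c + b - 1"
  have xP: "card (nb E x - P) \<le> s" if x: "x \<in> X" for x
  proof -
    have "P \<subseteq> nb E x" using P x XB Z_nb[OF _ x] by blast
    then have "card (nb E x - P) = d x - card P" using P deg[of x] x Xn by (subst card_Diff_subset) auto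
    then show ?thesis using dx[OF x] dv bP b2 by (simp add: s_def)
  qed
  define W where "W = Z - B - X"
  have zW: "card (nb E z - X) \<le> k - 2" if z: "z \<in> W" for z
  proof -
    have "X \<subseteq> nb E z" "z < n" using z by (auto simp: W_def Z_def)
    then have "card (nb E z - X) = d z - card X" using deg[of z] by (subst card_Diff_subset) auto
    moreover have "d z \<le> d u" using d_le[OF uB(1), of z] z \<open>z < n\<close> by (auto simp: W_def)
    ultimately show ?thesis using du by simp
  qed
  have cZ: "card (Z - B) \<le> s"
  proof -
    have "card Z = card (B \<inter> Z) + card (Z - B)"
      using card_Int_Diff[of Z B] by (simp add: Int_commute)
    then show ?thesis using card_Z[OF x0] dx[OF x0] dv cBZ bP b2 by (simp add: s_def)
  qed
  have cW: "card W \<le> s"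
    using card_mono[of "Z - B" W] cZ by (auto simp: W_def)
  have cTX: "card (T - X) \<le> k - 1"
  proof -
    have "card (T - X) = card T - card X" using X_T by (subst card_Diff_subset) auto
    moreover have "d y \<le> d u" using d_le[OF uB(1)] yB by blast
    ultimately show ?thesis using cT du k6 by simp
  qed
  let ?F1 = "pairs (B - P)" and ?F2 = "joins (B - P) U"
    and ?LX = "{{z, w} | z w. z \<in> X \<and> w \<in> nb E z - P}" and ?LZ = "{{z, w} | z w. z \<in> W \<and> w \<in> nb E z - X}"
  have fE: "finite E" using on edges_on_finite by blast
  \<comment> \<open>An unfrozen edge avoiding \<open>P\<close> meets X, or meets \<open>Z\<close>
    outside \<open>B\<close> and X, that is, in \<open>W\<close>, or lies in \<open>T - X\<close>.
    The vertex u causes no further case because its unfrozen neighbours form X.\<close>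
  have cover: "{e \<in> E. e \<inter> P = {}} \<subseteq> ?F1 \<union> ?F2 \<union> ?LX \<union> ?LZ \<union> {e \<in> E. e \<subseteq> T - X}"
  proof
    fix e assume e: "e \<in> {e \<in> E. e \<inter> P = {}}"
    then obtain a a' where a: "e = {a, a'}" "a \<noteq> a'"
      using on edges_on_obtain by (metis (no_types, lifting) mem_Collect_eq)
    show "e \<in> ?F1 \<union> ?F2 \<union> ?LX \<union> ?LZ \<union> {e \<in> E. e \<subseteq> T - X}"
    proof (cases "e \<in> ?K")
      case True
      then show ?thesis using e a by (auto simp: pairs_iff joins_iff)
    next
      case False
      have inX: "e \<in> ?LX" if "e = {p, q}" "p \<in> X" for p q
        using e that by (auto simp: nb_def)
      have inZ: "e \<in> ?LZ" if "e = {p, q}" "p \<in> Z" "p \<notin> X" "q \<notin> X" for p q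
      proof -
        have "p \<noteq> u"
        proof
          assume "p = u"
          then have "q \<in> X" using e False that by (auto simp: X_def nb_def)
          with that show False by simp
        qed
        then have "p \<in> W" using e that by (auto simp: W_def P_def)
        then show ?thesis using e that by (auto simp: nb_def)
      qed
      show ?thesis
        using unfrozen_cases[of e] inX[of a a'] inX[of a' a] inZ[of a a'] inZ[of a' a] e a False
        by (auto simp: insert_commute)
    qed
  qed
  have fX: "finite ?LX" "card ?LX \<le> card X * s"
    using edges_from[of X E P s] xP by auto
  have fZ: "finite ?LZ" "card ?LZ \<le> card W * (k - 2)"
    using edges_from[of W E X "k - 2"] zW by (auto simp: W_def)
  have fF: "finite ?F1" "finite ?F2" using B U by (auto intro: finite_pairs finite_joins)
  have "card {e \<in> E. e \<inter> P = {}} \<le> card (?F1 \<union> ?F2 \<union> ?LX \<union> ?LZ \<union> {e \<in> E. e \<subseteq> T - X})"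
    using cover fE fX fZ fF by (intro card_mono) auto
  also have "\<dots> \<le> card ?F1 + card ?F2 + card ?LX + card ?LZ + card {e \<in> E. e \<subseteq> T - X}"
    by (intro order_trans[OF card_Un_le] add_mono order_refl)
  finally have "2 * card {e \<in> E. e \<inter> P = {}} \<le> 2 * card ?F1 + 2 * card ?F2 + 2 * card ?LX + 2 * card ?LZ
      + 2 * card {e \<in> E. e \<subseteq> T - X}" by linarith
  moreover have BP: "card (B - P) = b" using P B bP by (subst card_Diff_subset) auto
  moreover have "2 * card ?F1 = b * (b - 1)" using card_pairs[of "B - P"] B BP by simp
  moreover have "card ?F2 \<le> b * (g + 1)" using card_joins[of "B - P" U] B U BP by simp
  moreover have "2 * card {e \<in> E. e \<subseteq> T - X} \<le> (k - 1) * (k - 2)"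
    using edges_inside[OF on, of "T - X"] mult_le_mono[OF cTX diff_le_mono[OF cTX], of 1] by (simp add: numeral_2_eq_2)
  moreover have "card ?LZ \<le> s * (k - 2)" using fZ(2) mult_le_mono1[OF cW, of "k - 2"] by linarith
  ultimately have "2 * card {e \<in> E. e \<inter> P = {}} \<le> b * (b - 1) + 2 * (b * (g + 1)) + 2 * (card X * s)
      + 2 * (s * (k - 2)) + (k - 1) * (k - 2)" using fX(2) by linarith
  then have up: "int (2 * card {e \<in> E. e \<inter> P = {}}) \<le> int (b * (b - 1) + 2 * (b * (g + 1)) + 2 * (card X * s)
      + 2 * (s * (k - 2)) + (k - 1) * (k - 2))"
    by (simp only: of_nat_le_iff)
  have eqs: "int (b - 1) = int b - 1" "int (k - 1) = int k - 1" "int (k - 2) = int k - 2"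
    using b2 k6 by auto
  have "int (b * (b - 1) + 2 * (b * (g + 1)) + 2 * (card X * s) + 2 * (s * (k - 2)) + (k - 1) * (k - 2))
      = int b * (int b - 1) + 2 * (int b * (int g + 1)) + 2 * (int (card X) * int s)
        + 2 * (int s * (int k - 2)) + (int k - 1) * (int k - 2)"
    by (simp only: of_nat_add of_nat_mult of_nat_numeral of_nat_1 eqs)
  moreover have "int b * (int b - 1) + 2 * (int b * (int g + 1)) + 2 * (int (card X) * int s)
        + 2 * (int s * (int k - 2)) + (int k - 1) * (int k - 2)
      < 2 * int b * (int n - (int m - 1 - int b)) - int b * (int b + 1) + 2"
  proof (rule join_B_U_numeric)
    show "2 * int k * int k \<le> int n" using n by (metis of_nat_le_iff of_nat_mult of_nat_numeral)
    have "X \<subseteq> Z \<or> Y \<subseteq> T"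
    proof (rule X_Z_or_Y_T)
      fix x y assume xy: "x \<in> X" "y \<in> Y"
      then have "\<not> x < k" "x \<notin> B" "y \<notin> B" using XB Ye by auto
      then show "{x, y} \<notin> ?K" unfolding K by simp
    qed
    then show "int s \<le> int k + int b - 2 \<and> int (card X) \<le> (int b - 1) * (int k - 1)
        \<or> int s \<le> int g + int k - 4 + 2 * int b \<and> int (card X) \<le> int g - 1 + int b"
    proof
      assume YT: "Y \<subseteq> T"
      have "c < k" using no has_cliqueI[OF Y_clique[OF YT] Yn] unfolding c_def by (metis not_less)
      moreover have "int (card X) \<le> int (card (B - Z) * (k - 1))" using cX by (simp only: of_nat_le_iff)
      ultimately show ?thesis using b2 k6 by (simp add: s_def b_def of_nat_diff)
    next
      \<comment> \<open>The clique is now X together with the m - b vertices of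
        \<open>B \<inter> Z\<close>, so X has fewer than g + b elements; d v \<le> d u carries this
        over to Y.\<close>
      assume XZ: "X \<subseteq> Z"
      have "clique E (X \<union> (B \<inter> Z))"
        unfolding clique_def
      proof (intro ballI impI)
        fix p q assume pq: "p \<in> X \<union> (B \<inter> Z)" "q \<in> X \<union> (B \<inter> Z)" "p \<noteq> q"
        show "{p, q} \<in> E"
          using pq uB(3) X_clique[OF XZ] Z_nb[of p q] Z_nb[of q p] XB by (auto simp: clique_def nb_def insert_commute)
      qed
      moreover have "X \<union> (B \<inter> Z) \<subseteq> {..<n}" using Xn B by auto
      ultimately have "card (X \<union> (B \<inter> Z)) < k" using no has_cliqueI by (metis not_less)
      then have "card X + card (B \<inter> Z) < k" using XB B by (subst (asm) card_Un_disjoint) auto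
      then have cXb: "card X + m < k + b" using cBZ bP by simp
      moreover have "d v \<le> d u" using d_le[OF uB(1) vB(1) uv(3)] .
      moreover have "c \<le> d v" using deg[OF uv(3)] card_mono[of "nb E v" Y] Ye by (auto simp: c_def)
      ultimately have c2: "c + 2 \<le> card X + k" using du k6 by linarith
      have c1: "card X + 1 \<le> g + b" using cXb k(1) by linarith
      have "s + 4 \<le> g + k + 2 * b" using c1 c2 b2 by (simp add: s_def)
      with c1 show ?thesis by linarith
    qed
  qed (use b2 k k6 bP in auto)
  moreover have "int (card P) = int m - 1 - int b" using bP by linarith
  ultimately show False
    using avoiding_ge[OF E P(1) bP] up sum_d(2) by simp
qed

lemma realize_join_B_U:
  assumes "realizes n d E0" "clique E0 B" "m - 1 \<le> d (k - 1)"
  obtains E where "realizes n d E" "has_clique n k E \<or> clique E B \<and> joins B U \<subseteq> E"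
proof -
  let ?K = "pairs B \<union> joins B U"
  have "finite ?K" using B U by (simp add: finite_pairs finite_joins)
  then obtain E where E: "realizes n d E" "E0 \<inter> ?K \<subseteq> E"
    "\<And>E'. realizes n d E' \<Longrightarrow> E \<inter> ?K \<subseteq> E' \<Longrightarrow> E' \<inter> ?K \<subseteq> E"
    using obtain_saturated[OF assms(1)] by metis
  have cl: "clique E B" using E(2) assms(2) by (auto simp: clique_pairs)
  have "has_clique n k E" if "\<not> joins B U \<subseteq> E"
  proof -
    obtain u v where uB: "u \<in> B" "v \<in> U" "u \<noteq> v" "{u, v} \<notin> E"
      using \<open>\<not> joins B U \<subseteq> E\<close> by (auto simp: joins_def)
    interpret blocked n d E ?K u v
    proof
      show "u < n" "v < n" using uB B U kn by (auto simp: U_def)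
      show "{u, v} \<notin> E'" if "realizes n d E'" "E \<inter> ?K \<subseteq> E'" for E'
        using E(3)[OF that] uB by (auto simp: joins_iff)
    qed (use E uB in auto)
    have "m - 1 \<le> d v" using uB kn by (intro order_trans[OF assms(3) mono]) (auto simp: U_def)
    then show ?thesis using blocked_join_B_U[OF blocked_axioms uB(1,2) cl] by simp
  qed
  then show thesis using that E(1) cl by blast
qed

end

section \<open>An edge between two vertices joined to the whole clique\<close>

lemma full_edge_numeric:
  fixes n k m g a b s h \<eta> :: int
  assumes "1 \<le> b" "b \<le> m - 1" "0 \<le> s" "0 \<le> a" "0 \<le> h" "1 \<le> \<eta>" "4 \<le> m" "2 \<le> g" "k = m + g"
    and a: "a \<le> b * (k - 1 + 2 * h)" and s: "s \<le> k - 1 + b + 2 * h"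
    and room: "2 * ((k - 1 + 2 * h) * (m + k - 1 + 2 * h) + (m - 1 + h) + (m - 1) + h * (k + 2 * h)
        + (g + 1 + 2 * h) + h) + (m + h) * (m + h - 1) \<le> 2 * (n - m + 1)"
  shows "b * (b - 1) + 2 * (b * (g + 1 + 2 * h)) + 2 * h + 2 * (a * s) + 2 * ((s + 1) * (m - 1 + h))
      + (m + h) * (m + h - 1) < 2 * b * (n - (m - 1 - b)) - b * (b + 1) + 2 * \<eta>"
proof -
  define K where "K = k - 1 + 2 * h"
  define M where "M = m - 1 + h"
  define N where "N = (m + h) * (m + h - 1)"
  have K0: "0 \<le> K" and M0: "0 \<le> M" and N0: "0 \<le> N" using assms by (auto simp: K_def M_def N_def)
  have "a * s \<le> (b * K) * (K + b)"
    using a s K0 assms(1,3,4) by (intro mult_mono) (auto simp: K_def)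
  moreover have "(s + 1) * M \<le> (K + 1 + b) * M"
    using s M0 by (intro mult_right_mono) (auto simp: K_def)
  moreover have "b * b * K \<le> (m * b - (m - 1)) * K"
  proof (intro mult_right_mono K0)
    \<comment> \<open>The square of b lies below its chord over the interval from 1 to m - 1.
      Replacing it by this linear function lets both sides be compared as multiples of b, so that
      \<open>room\<close> does not mention b.\<close>
    have "0 \<le> (b - 1) * (m - 1 - b)" using assms by simp
    then show "b * b \<le> m * b - (m - 1)" by (simp add: algebra_simps)
  qed
  ultimately have "a * s + (s + 1) * M \<le> b * (K * (m + K) + M) + ((K + 1) * M - (m - 1) * K)"
    by (simp add: algebra_simps)
  also have "(K + 1) * M - (m - 1) * K = (m - 1) + h * (k + 2 * h)"
    by (simp add: K_def M_def algebra_simps)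
  also have "\<dots> \<le> b * ((m - 1) + h * (k + 2 * h))"
    using mult_right_mono[OF assms(1), of "(m - 1) + h * (k + 2 * h)"] assms by simp
  finally have 1: "2 * (a * s + (s + 1) * M) \<le> b * (2 * (K * (m + K) + M + (m - 1) + h * (k + 2 * h)))"
    by (simp add: algebra_simps)
  have 2: "N \<le> b * N" "2 * h \<le> b * (2 * h)"
    using mult_right_mono[OF assms(1) N0] mult_right_mono[OF assms(1), of "2 * h"] assms by auto
  have "b * (2 * (K * (m + K) + M + (m - 1) + h * (k + 2 * h) + (g + 1 + 2 * h) + h) + N) \<le> b * (2 * (n - m + 1))"
    using room assms(1) by (intro mult_left_mono) (simp_all add: K_def M_def N_def algebra_simps)
  then have "2 * (a * s) + 2 * ((s + 1) * M) + N + 2 * (b * (g + 1 + 2 * h)) + 2 * h \<le> 2 * b * (n - m + 1)"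
    using 1 2 by (simp add: algebra_simps)
  then show ?thesis using assms(6) unfolding M_def N_def by (simp add: algebra_simps)
qed

context heavy_top
begin

text \<open>The set on which a 2-tree is later placed outside \<open>B\<close>. It may be larger
  than \<open>U\<close>: an edge between any two of these vertices serves the purpose, so it may be
  assumed that none is present.\<close>

definition full :: "nat set set \<Rightarrow> nat set" where
  "full E = {w. w < n \<and> w \<notin> B \<and> B \<subseteq> nb E w}"

lemma full_joins: "joins B A \<subseteq> E \<Longrightarrow> A \<subseteq> {..<n} \<Longrightarrow> A \<inter> B = {} \<Longrightarrow> A \<subseteq> full E"
proof
  fix w assume w: "joins B A \<subseteq> E" "A \<subseteq> {..<n}" "A \<inter> B = {}" "w \<in> A"
  then have "{b, w} \<in> E" if "b \<in> B" for b
    using that joins_iff[of b w B A] by blast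
  then show "w \<in> full E" using w by (auto simp: full_def nb_def insert_commute)
qed

lemma blocked_full_edge:
  assumes bl: "blocked n d E (pairs B \<union> joins B A \<union> Fz) u v"
    and cl: "clique E B" "joins B A \<subseteq> E" "Fz \<subseteq> E"
    and A: "U \<subseteq> A" "A \<subseteq> {..<n}" "A \<inter> B = {}" "card A \<le> g + 1 + 2 * h"
    and Fz: "Fz \<subseteq> pairs A" "card Fz \<le> h" "\<And>p. card (nb Fz p) \<le> h"
    and full: "\<And>p q. p \<in> full E \<Longrightarrow> q \<in> full E \<Longrightarrow> {p, q} \<in> E \<Longrightarrow> {p, q} \<in> Fz"
    and uU: "u \<in> U" "v \<in> U" "d v \<le> d u"
    and uX: "\<not> nb E u \<subseteq> B \<union> nb Fz u" and vY: "\<not> nb E v \<subseteq> B \<union> nb Fz v"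
    and big: "\<And>z. z \<in> U \<Longrightarrow> d u < d z \<Longrightarrow> nb E z \<subseteq> B \<union> full E"
    and room: "2 * ((int k - 1 + 2 * int h) * (int m + int k - 1 + 2 * int h) + (int m - 1 + int h) + (int m - 1)
        + int h * (int k + 2 * int h) + (int g + 1 + 2 * int h) + int h) + (int m + int h) * (int m + int h - 1)
        \<le> 2 * (int n - int m + 1)"
  shows "has_clique n k E"
proof (rule ccontr)
  assume no: "\<not> has_clique n k E"
  let ?K = "pairs B \<union> joins B A \<union> Fz"
  interpret blocked n d E ?K u v by (rule bl)
  note fin_nb[simp] fin[simp]
  have irr: "w \<notin> nb E w" for w using nb_irrefl[OF on] .
  have fA: "finite A" using A(2) finite_subset by blast
  have finFz: "finite (nb Fz p)" for p using finite_nb[OF edges_on_subset[OF on cl(3)]] by simp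
  have AF: "A \<subseteq> full E" by (rule full_joins[OF cl(2) A(2,3)])
  have K: "{p, q} \<in> ?K \<longleftrightarrow> p \<noteq> q \<and> (p \<in> B \<and> q \<in> B \<union> A \<or> q \<in> B \<and> p \<in> B \<union> A) \<or> q \<in> nb Fz p" for p q
    unfolding nb_iff Un_iff pairs_iff joins_iff by blast
  have uv_A: "u \<in> A" "v \<in> A" "u \<notin> B" "v \<notin> B" using uU A by auto
  have uvb: "B \<subseteq> nb E u" "B \<subseteq> nb E v" using AF uv_A by (auto simp: full_def)
  have nbFz: "p \<in> A \<Longrightarrow> nb Fz p \<subseteq> A" for p using Fz(1) pairs_iff by (fastforce simp: nb_def)
  have Xe: "X = nb E u - B - nb Fz u" and Ye: "Y = nb E v - B - nb Fz v"
    unfolding X_def Y_def set_eq_iff Diff_iff nb_iff[of _ "E - _"] K using uv_A edges_onD(1)[OF on]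
    by (auto simp: nb_iff)
  have Yn: "Y \<subseteq> {..<n}" and Xn: "X \<subseteq> {..<n}" using nb_subset[OF on] Xe Ye by blast+
  have X_full: "X \<inter> full E = {}"
    using full[of u] uv_A AF by (auto simp: Xe nb_iff)
  have Y_full: "Y \<inter> full E = {}"
    using full[of v] uv_A AF by (auto simp: Ye nb_iff)
  have XB: "X \<inter> (B \<union> A) = {}" "Y \<inter> (B \<union> A) = {}" using X_full Y_full AF Xe Ye by auto
  have ge: "k \<le> w" if "w \<notin> B \<union> A" for w
  proof (rule ccontr)
    assume "\<not> k \<le> w"
    then have "w \<in> B \<union> U" using U(3) by auto
    with that A(1) show False by blast
  qed
  have Xk: "k \<le> x" if "x \<in> X" for x using ge that XB by blast
  have Yk: "k \<le> y" if "y \<in> Y" for y using ge that XB by blast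
  define c where "c = card Y"
  have degs: "m - 1 + card (nb E w - B - nb Fz w) \<le> d w \<and> d w \<le> m - 1 + card (nb E w - B - nb Fz w) + h"
    if "w \<in> {u, v}" for w
  proof -
    have w: "w < n" "w \<in> A" "B \<subseteq> nb E w" using that uv uv_A uvb by auto
    have "card (nb E w - B) = d w - (m - 1)" using w B deg[of w] by (subst card_Diff_subset) auto
    moreover have "card B \<le> card (nb E w)" using w by (intro card_mono) auto
    then have "m - 1 \<le> d w" using w deg[of w] B by simp
    moreover have "card (nb E w - B) \<le> card (nb E w - B - nb Fz w) + card (nb Fz w)"
    proof -
      have "card (nb E w - B) \<le> card ((nb E w - B - nb Fz w) \<union> nb Fz w)"
        by (rule card_mono) (use finFz in auto)
      then show ?thesis using card_Un_le le_trans by blast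
    qed
    moreover have "card (nb E w - B - nb Fz w) \<le> card (nb E w - B)" by (rule card_mono) auto
    ultimately show ?thesis using Fz(3)[of w] by linarith
  qed
  have du: "m - 1 + card X \<le> d u" "d u \<le> m - 1 + card X + h" and dv: "m - 1 + c \<le> d v" "d v \<le> m - 1 + c + h"
    using degs[of u] degs[of v] by (auto simp: Xe Ye c_def)
  obtain x0 y where x0: "x0 \<in> X" and y: "y \<in> Y" using uX vY by (auto simp: Xe Ye)
  have yB: "y \<notin> B" "y < n" using y Ye Yn by auto
  have dx: "d x \<le> d v" if "x \<in> X" for x using d_U[OF uU(2), of x] that Xk Xn by auto
  have dy: "d y \<le> d u" using d_U[OF uU(1), of y] y Yk yB by auto
  have cT: "card T \<le> Suc (d y)" by (rule card_T[OF y])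
  have miss: "\<exists>b\<in>B - Z. b \<notin> nb E x" if x: "x \<in> X" for x
  proof -
    have "x \<notin> B" "x < n" "x \<notin> full E" using x XB X_full Xn by auto
    then obtain b where "b \<in> B" "b \<notin> nb E x" by (auto simp: full_def)
    moreover from this have "b \<notin> Z" using Z_nb[OF _ x] \<open>x \<notin> B\<close> by blast
    ultimately show ?thesis by blast
  qed
  define Q where "Q = B \<union> A"
  have Q: "finite Q" "card Q \<le> k + 2 * h" "Q \<subseteq> {..<n}" "v \<in> Q" "X \<inter> Q = {}"
  proof -
    have "card Q = card B + card A" unfolding Q_def using B fA A(3) by (intro card_Un_disjoint) auto
    then show "card Q \<le> k + 2 * h" using A(4) B k by simp
  qed (use B fA A uv_A XB in \<open>auto simp: Q_def\<close>)
  \<comment> \<open>The same count as for the joins, with \<open>Q\<close> in place of the first k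
    vertices; its size k + 2 * h accounts for the term 2 * h.\<close>
  have cX1: "card (X - nb E b) \<le> k - 1 + 2 * h" if b: "b \<in> B - Z" for b
  proof -
    have bk: "b < n" "b \<in> Q" "b \<noteq> v" "b \<notin> A" using b B uv_A A by (auto simp: Q_def)
    have sub: "nb E b - Q \<subseteq> T"
    proof
      fix w assume w: "w \<in> nb E b - Q"
      have "b \<notin> nb Fz w" using nbFz[of w] bk(4) Fz(1) nb_sym pairs_iff by (fastforce simp: nb_def)
      then have "w \<notin> nb Fz b" using nb_sym by metis
      then have "{b, w} \<in> E - ?K" using w b unfolding Diff_iff K by (auto simp: nb_iff Q_def)
      then show "w \<in> T" using ZT b by blast
    qed
    have "nb E b - Q \<subseteq> T - insert v (X - nb E b)" using sub Q by auto
    then have "card (nb E b - Q) \<le> card (T - insert v (X - nb E b))" by (intro card_mono) auto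
    also have "\<dots> = card T - card (insert v (X - nb E b))" using X_T v_T by (subst card_Diff_subset) auto
    also have "card (insert v (X - nb E b)) = Suc (card (X - nb E b))" using Q by (subst card_insert_disjoint) auto
    finally have 1: "card (nb E b - Q) \<le> card T - Suc (card (X - nb E b))" .
    have "card (nb E b \<inter> Q) \<le> card (Q - {b})" using irr Q by (intro card_mono) auto
    then have 2: "card (nb E b \<inter> Q) \<le> k + 2 * h - 1" using bk Q by simp
    have "Suc (card (X - nb E b)) \<le> card T"
    proof -
      have "card (insert v (X - nb E b)) \<le> card T" using X_T v_T by (intro card_mono) auto
      then show ?thesis using Q by (subst (asm) card_insert_disjoint) auto
    qed
    moreover have "d y \<le> d b" using b d_le[of b y] yB by auto
    ultimately show ?thesis
      using 1 2 cT deg[OF bk(1)] card_Int_Diff[of "nb E b" Q] k6 by simp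
  qed
  have cX: "card X \<le> card (B - Z) * (k - 1 + 2 * h)"
  proof -
    have "X \<subseteq> (\<Union>b\<in>B - Z. X - nb E b)" using miss nb_sym by fastforce
    then have "card X \<le> card (\<Union>b\<in>B - Z. X - nb E b)" using B by (intro card_mono) auto
    also have "\<dots> \<le> (\<Sum>b\<in>B - Z. card (X - nb E b))" using B by (intro card_UN_le) auto
    also have "\<dots> \<le> (\<Sum>b\<in>B - Z. k - 1 + 2 * h)" by (intro sum_mono cX1)
    finally show ?thesis by simp
  qed
  define P where "P = B \<inter> Z"
  have P: "P \<subseteq> {..<n}" "finite P" "P \<subseteq> Z" "P \<subseteq> B" using B by (auto simp: P_def)
  define b where "b = card (B - Z)"
  have "card P + card (B - Z) = m - 1" using card_Int_Diff[of B Z] B by (simp add: P_def)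
  then have bP: "card P + b + 1 = m" using k by (simp add: b_def)
  have "card (B - Z) \<noteq> 0" using miss[OF x0] B by auto
  then have b1: "1 \<le> b" by (simp add: b_def)
  define s where "s = c + b + h"
  have xP: "card (nb E x - P) \<le> s" if x: "x \<in> X" for x
  proof -
    have "P \<subseteq> nb E x" using P x XB Z_nb[OF _ x] by blast
    then have "card (nb E x - P) = d x - card P" using P deg[of x] x Xn by (subst card_Diff_subset) auto
    then show ?thesis using dx[OF x] dv bP b1 by (simp add: s_def)
  qed
  \<comment> \<open>The restriction on d z makes d z minus the size of X small. Vertices of
    \<open>Z\<close> outside \<open>B\<close> with larger degree lie in \<open>U\<close>, since from
    k on degrees do not exceed d u; they contribute no unfrozen edges by \<open>big\<close>.\<close>
  define W where "W = {z \<in> Z - B - X. d z \<le> d u}"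
  have W: "finite W" "W \<subseteq> Z - B" by (auto simp: W_def)
  have zW: "card (nb E z - X) \<le> m - 1 + h" if z: "z \<in> W" for z
  proof -
    have "X \<subseteq> nb E z" "z < n" using z by (auto simp: W_def Z_def)
    then have "card (nb E z - X) = d z - card X" using deg[of z] by (subst card_Diff_subset) auto
    moreover have "d z \<le> d u" using z by (auto simp: W_def)
    ultimately show ?thesis using du by simp
  qed
  have cZ: "card (Z - B) \<le> s + 1"
  proof -
    have "card Z = card P + card (Z - B)"
      using card_Int_Diff[of Z B] by (simp add: Int_commute P_def)
    then show ?thesis using card_Z[OF x0] dx[OF x0] dv bP b1 by (simp add: s_def)
  qed
  have cW: "card W \<le> s + 1"
    using card_mono[of "Z - B" W] cZ W by simp
  have cTX: "card (T - X) \<le> m + h"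
  proof -
    have "card (T - X) = card T - card X" using X_T by (subst card_Diff_subset) auto
    then show ?thesis using cT dy du k by simp
  qed
  let ?F1 = "pairs (B - P)" and ?F2 = "joins (B - P) A"
    and ?LX = "{{z, w} | z w. z \<in> X \<and> w \<in> nb E z - P}" and ?LZ = "{{z, w} | z w. z \<in> W \<and> w \<in> nb E z - X}"
  have fE: "finite E" using on edges_on_finite by blast
  have cover: "{e \<in> E. e \<inter> P = {}} \<subseteq> ?F1 \<union> ?F2 \<union> Fz \<union> ?LX \<union> ?LZ \<union> {e \<in> E. e \<subseteq> T - X}"
  proof
    fix e assume e: "e \<in> {e \<in> E. e \<inter> P = {}}"
    then obtain a a' where a: "e = {a, a'}" "a \<noteq> a'"
      using on edges_on_obtain by (metis (no_types, lifting) mem_Collect_eq)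
    show "e \<in> ?F1 \<union> ?F2 \<union> Fz \<union> ?LX \<union> ?LZ \<union> {e \<in> E. e \<subseteq> T - X}"
    proof (cases "e \<in> ?K")
      case True
      then show ?thesis using e a by (auto simp: pairs_iff joins_iff)
    next
      case False
      have inX: "e \<in> ?LX" if "e = {p, q}" "p \<in> X" for p q
        using e that by (auto simp: nb_def)
      have inZ: "e \<in> ?LZ" if pq: "e = {p, q}" "p \<in> Z" "p \<notin> X" "q \<notin> X" for p q
      proof -
        have pB: "p \<notin> B" using pq e by (auto simp: P_def)
        have "d p \<le> d u"
        proof (rule ccontr)
          assume c: "\<not> d p \<le> d u"
          have "p < n" using pq by (auto simp: Z_def)
          then have "p < k" using c d_U[OF uU(1), of p] by (meson not_le)
          then have pU: "p \<in> U" using U(3) pB by blast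
          then have "nb E p \<subseteq> B \<union> full E" using big c by simp
          moreover have "q \<in> nb E p" using pq e by (auto simp: nb_def)
          moreover have "p \<in> full E" using pU A AF by auto
          moreover have "{p, q} \<notin> Fz" using False pq by auto
          ultimately have "q \<in> B" using full[of p q] by (auto simp: nb_def)
          then have "{p, q} \<in> ?K" using pU A(1) pB by (auto simp: joins_iff)
          then show False using False pq by simp
        qed
        then have "p \<in> W" using pB pq by (auto simp: W_def)
        then show ?thesis using e pq by (auto simp: nb_def)
      qed
      show ?thesis
        using unfrozen_cases[of e] inX[of a a'] inX[of a' a] inZ[of a a'] inZ[of a' a] e a False
        by (auto simp: insert_commute)
    qed
  qed
  have fX: "finite ?LX" "card ?LX \<le> card X * s"
    using edges_from[of X E P s] xP by auto
  have fZ: "finite ?LZ" "card ?LZ \<le> card W * (m - 1 + h)"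
    using edges_from[of W E X "m - 1 + h"] zW W by auto
  have fF: "finite ?F1" "finite ?F2" using B fA by (auto intro: finite_pairs finite_joins)
  have fFz: "finite Fz" using finite_subset[OF cl(3) fE] .
  have "card {e \<in> E. e \<inter> P = {}} \<le> card (?F1 \<union> ?F2 \<union> Fz \<union> ?LX \<union> ?LZ \<union> {e \<in> E. e \<subseteq> T - X})"
    using cover fE fX fZ fF fFz by (intro card_mono) auto
  also have "\<dots> \<le> card ?F1 + card ?F2 + card Fz + card ?LX + card ?LZ + card {e \<in> E. e \<subseteq> T - X}"
    by (intro order_trans[OF card_Un_le] add_mono order_refl)
  finally have "2 * card {e \<in> E. e \<inter> P = {}} \<le> 2 * card ?F1 + 2 * card ?F2 + 2 * card Fz + 2 * card ?LX + 2 * card ?LZ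
      + 2 * card {e \<in> E. e \<subseteq> T - X}" by linarith
  moreover have BP: "card (B - P) = b" using P B bP by (subst card_Diff_subset) auto
  moreover have "2 * card ?F1 = b * (b - 1)" using card_pairs[of "B - P"] B BP by simp
  moreover have "card ?F2 \<le> b * (g + 1 + 2 * h)"
    using card_joins[of "B - P" A] B fA BP mult_le_mono2[OF A(4), of b] by simp
  moreover have "2 * card {e \<in> E. e \<subseteq> T - X} \<le> (m + h) * (m + h - 1)"
    using edges_inside[OF on, of "T - X"] mult_le_mono[OF cTX diff_le_mono[OF cTX], of 1] by simp
  moreover have "card ?LZ \<le> (s + 1) * (m - 1 + h)" using fZ(2) mult_le_mono1[OF cW, of "m - 1 + h"] by linarith
  ultimately have "2 * card {e \<in> E. e \<inter> P = {}} \<le> b * (b - 1) + 2 * (b * (g + 1 + 2 * h)) + 2 * h + 2 * (card X * s)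
      + 2 * ((s + 1) * (m - 1 + h)) + (m + h) * (m + h - 1)" using fX(2) Fz(2) by linarith
  then have up: "int (2 * card {e \<in> E. e \<inter> P = {}}) \<le> int (b * (b - 1) + 2 * (b * (g + 1 + 2 * h)) + 2 * h + 2 * (card X * s)
      + 2 * ((s + 1) * (m - 1 + h)) + (m + h) * (m + h - 1))"
    by (simp only: of_nat_le_iff)
  have eqs: "int (b - 1) = int b - 1" "int (m - 1) = int m - 1" "int (m + h - 1) = int m + int h - 1"
    using b1 k by auto
  have "int (b * (b - 1) + 2 * (b * (g + 1 + 2 * h)) + 2 * h + 2 * (card X * s)
      + 2 * ((s + 1) * (m - 1 + h)) + (m + h) * (m + h - 1))
      = int b * (int b - 1) + 2 * (int b * (int g + 1 + 2 * int h)) + 2 * int h + 2 * (int (card X) * int s)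
      + 2 * ((int s + 1) * (int m - 1 + int h)) + (int m + int h) * (int m + int h - 1)"
    by (simp only: of_nat_add of_nat_mult of_nat_numeral of_nat_1 eqs)
  moreover have "int b * (int b - 1) + 2 * (int b * (int g + 1 + 2 * int h)) + 2 * int h + 2 * (int (card X) * int s)
      + 2 * ((int s + 1) * (int m - 1 + int h)) + (int m + int h) * (int m + int h - 1)
      < 2 * int b * (int n - (int m - 1 - int b)) - int b * (int b + 1) + 2 * int \<eta>"
  proof (rule full_edge_numeric[OF _ _ _ _ _ _ _ _ _ _ _ room])
    have "X \<subseteq> Z \<or> Y \<subseteq> T"
    proof (rule X_Z_or_Y_T)
      fix x y assume xy: "x \<in> X" "y \<in> Y"
      have "x \<notin> A" "x \<notin> B" "y \<notin> B" using XB xy by auto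
      moreover have "y \<notin> nb Fz x" using Fz(1) \<open>x \<notin> A\<close> pairs_iff by (fastforce simp: nb_def)
      ultimately show "{x, y} \<notin> ?K" unfolding K by simp
    qed
    then have "c \<le> k - 1 + h"
    proof
      assume YT: "Y \<subseteq> T"
      have "c < k" using no has_cliqueI[OF Y_clique[OF YT] Yn] unfolding c_def by (metis not_less)
      then show ?thesis by simp
    next
      assume XZ: "X \<subseteq> Z"
      have "card X < k" using no has_cliqueI[OF X_clique[OF XZ] Xn] by (metis not_less)
      then show ?thesis using dv(1) du(2) uU(3) by simp
    qed
    then show "int s \<le> int k - 1 + int b + 2 * int h" using k6 by (simp add: s_def)
    have "int (card X) \<le> int (b * (k - 1 + 2 * h))" using cX unfolding b_def by (simp only: of_nat_le_iff)
    moreover have "int (k - 1 + 2 * h) = int k - 1 + 2 * int h" using k6 by simp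
    ultimately show "int (card X) \<le> int b * (int k - 1 + 2 * int h)" by (simp only: of_nat_mult)
  qed (use b1 k k6 bP sum_d(2) in auto)
  moreover have "int (card P) = int m - 1 - int b" using bP by linarith
  ultimately show False
    using avoiding_ge[OF E P(1) bP] up by simp
qed

text \<open>The premise \<open>room\<close> of \<open>blocked_full_edge\<close> at h = 0, with the
  zeros kept so that it matches literally.\<close>

lemma full_edge_room:
  "2 * ((int k - 1 + 2 * int 0) * (int m + int k - 1 + 2 * int 0) + (int m - 1 + int 0) + (int m - 1)
    + int 0 * (int k + 2 * int 0) + (int g + 1 + 2 * int 0) + int 0) + (int m + int 0) * (int m + int 0 - 1)
    \<le> 2 * (int n - int m + 1)"
proof -
  define q p r where "q = int k * int k" and "p = int m * int k" and "r = int m * int m"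
  have km: "3 * int m \<le> 2 * int k" using k by linarith
  have "int (2 * k * k) \<le> int n" using n by (simp only: of_nat_le_iff)
  then have "2 * q \<le> int n" by (simp add: q_def)
  moreover have "3 * p \<le> 2 * q" using mult_right_mono[OF km, of "int k"] by (simp add: p_def q_def)
  moreover have "3 * r \<le> 2 * p" using mult_left_mono[OF km, of "int m"] by (simp add: p_def r_def algebra_simps)
  moreover have "int k = int m + int g" using k by simp
  ultimately have "2 * (p + q - 2 * int k - int m + 1 + (int m - 1) + (int m - 1) + (int g + 1)) + (r - int m)
      \<le> 2 * (int n - int m + 1)"
    using km by simp
  then show ?thesis by (simp add: p_def q_def r_def algebra_simps)
qed

lemma U_full: "joins B U \<subseteq> E \<Longrightarrow> U \<subseteq> full E"
  by (rule full_joins) (use U kn in \<open>auto simp: U_def\<close>)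

lemma joins_full:
  assumes "A \<subseteq> full E"
  shows "joins B A \<subseteq> E"
proof
  fix e assume "e \<in> joins B A"
  then obtain a b where e: "e = {a, b}" "a \<in> B" "b \<in> A" by (auto simp: joins_def)
  then have "a \<in> nb E b" using assms by (auto simp: full_def)
  then show "e \<in> E" using e by (simp add: nb_def insert_commute)
qed

lemma not_in_B:
  assumes "realizes n d E" "w < n" "m \<le> d w"
  shows "\<not> nb E w \<subseteq> B"
  using assms card_mono[of B "nb E w"] B k by (auto simp: realizes_def)

lemma realize_full_edge:
  assumes E0: "realizes n d E0" "clique E0 B" "joins B U \<subseteq> E0" and dm: "m \<le> d m"
  obtains E where "realizes n d E"
    "has_clique n k E \<or> clique E B \<and> joins B U \<subseteq> E \<and> (\<exists>p\<in>full E. \<exists>q\<in>full E. {p, q} \<in> E)"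
proof (cases "\<exists>p\<in>full E0. \<exists>q\<in>full E0. {p, q} \<in> E0")
  case True
  then show thesis using that E0 by blast
next
  case False
  \<comment> \<open>These have the two largest degrees in \<open>U\<close>. No vertex of
    \<open>U\<close> exceeds d u, so \<open>big\<close> holds vacuously, and degree at least m gives
    both a neighbour outside \<open>B\<close>.\<close>
  define u v where "u = m - 1" and "v = m"
  have uv: "u \<in> U" "v \<in> U" "u \<noteq> v" "u < n" "v < n" unfolding u_def v_def U_def using k kn by auto
  have dd: "d v \<le> d u" "m \<le> d v" "m \<le> d u"
    using mono[of u v] dm uv by (auto simp: u_def v_def)
  let ?K = "pairs B \<union> joins B U"
  have UF: "U \<subseteq> full E0" by (rule U_full[OF E0(3)])
  show thesis
  proof (cases "\<exists>E'. realizes n d E' \<and> E0 \<inter> ?K \<subseteq> E' \<and> {u, v} \<in> E'")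
    case True
    then obtain E' where E': "realizes n d E'" "E0 \<inter> ?K \<subseteq> E'" "{u, v} \<in> E'" by blast
    have "clique E' B" "joins B U \<subseteq> E'" using E'(2) E0 by (auto simp: clique_pairs)
    moreover from this have "u \<in> full E'" "v \<in> full E'" using U_full uv by auto
    ultimately show thesis using that E' by blast
  next
    case nex: False
    interpret b: blocked n d E0 "?K \<union> {}" u v
      by unfold_locales (use E0 uv UF False nex in auto)
    have "has_clique n k E0"
    proof (rule blocked_full_edge[OF b.blocked_axioms E0(2,3), where h = 0])
      show "\<not> nb E0 u \<subseteq> B \<union> nb {} u" "\<not> nb E0 v \<subseteq> B \<union> nb {} v"
        using not_in_B[OF E0(1)] uv dd by (simp_all add: nb_def)
      show "nb E0 z \<subseteq> B \<union> full E0" if "z \<in> U" "d u < d z" for z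
        using that mono[of u z] kn by (auto simp: U_def u_def)
      show "{p, q} \<in> {}" if "p \<in> full E0" "q \<in> full E0" "{p, q} \<in> E0" for p q
        using that False by blast
    qed (use U uv dd kn full_edge_room in \<open>auto simp: nb_def U_def\<close>)
    then show thesis using that E0 by blast
  qed
qed

section \<open>A second edge between vertices joined to the whole clique\<close>

definition two_full :: "nat set set \<Rightarrow> bool" where
  "two_full E \<longleftrightarrow> (\<exists>e1\<in>E. \<exists>e2\<in>E. e1 \<noteq> e2 \<and> e1 \<subseteq> full E \<and> e2 \<subseteq> full E)"

text \<open>The vertices that can be used as u or v in \<open>blocked_full_edge\<close>: a neighbour
  outside \<open>B \<union> full E\<close> is unfrozen whatever edge inside \<open>full E\<close> is
  kept.\<close>

definition eligible :: "nat set set \<Rightarrow> nat \<Rightarrow> bool" where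
  "eligible E a \<longleftrightarrow> a \<in> U \<and> \<not> nb E a \<subseteq> B \<union> full E"

lemma two_fullI: "e1 \<in> E \<Longrightarrow> e2 \<in> E \<Longrightarrow> e1 \<noteq> e2 \<Longrightarrow> e1 \<subseteq> full E \<Longrightarrow> e2 \<subseteq> full E \<Longrightarrow> two_full E"
  unfolding two_full_def by blast

text \<open>If ff' is the only edge inside \<open>full E\<close>, then within
  \<open>B \<union> full E\<close> the vertex a has m - 1 neighbours, or m if it is an end of ff'. A
  larger degree forces a neighbour elsewhere.\<close>

lemma eligibleI:
  assumes E: "realizes n d E" "joins B U \<subseteq> E" "\<not> two_full E"
    and f: "f \<in> full E" "f' \<in> full E" "{f, f'} \<in> E"
    and a: "a \<in> U" "m \<le> d a" "a \<notin> {f, f'} \<or> m + 1 \<le> d a"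
  shows "eligible E a"
proof (rule ccontr)
  assume "\<not> eligible E a"
  then have sub: "nb E a \<subseteq> B \<union> full E" using a by (simp add: eligible_def)
  have on: "edges_on {..<n} E" using E by (simp add: realizes_def)
  have an: "a < n" "a \<in> full E" using a kn U_full[OF E(2)] by (auto simp: U_def)
  have eq: "{a, w} = {f, f'}" if "w \<in> nb E a - B" for w
  proof -
    have "{a, w} \<in> E" "w \<in> full E" using that sub by (auto simp: nb_def)
    then show ?thesis using E(3) f an two_fullI[of "{a, w}" E "{f, f'}"] by auto
  qed
  obtain w where w: "w \<in> nb E a - B" using not_in_B[OF E(1) an(1) a(2)] by blast
  have "nb E a \<subseteq> insert w B"
  proof
    fix w' assume w': "w' \<in> nb E a"
    show "w' \<in> insert w B"
    proof (cases "w' \<in> B")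
      case False
      then have "{a, w'} = {a, w}" using eq[OF w] eq[of w'] w' by simp
      then show ?thesis by (auto simp: doubleton_eq_iff)
    qed simp
  qed
  then have "d a \<le> card (insert w B)"
    using E(1) an B card_mono[of "insert w B" "nb E a"] by (auto simp: realizes_def)
  also have "\<dots> \<le> m" using B k card_insert_le_m1[of m B w] by simp
  finally have "a \<notin> {f, f'}" using a by simp
  then show False using eq[OF w] by auto
qed

lemma second_full_edge:
  assumes E: "realizes n d E" "clique E B" "joins B U \<subseteq> E" "\<not> two_full E"
    and f: "f \<in> full E" "f' \<in> full E" "{f, f'} \<in> E"
    and a: "eligible E a" "eligible E a'" "a \<noteq> a'" "{a, a'} \<noteq> {f, f'}"
    and room: "2 * ((int k - 1 + 2 * int 1) * (int m + int k - 1 + 2 * int 1) + (int m - 1 + int 1) + (int m - 1)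
        + int 1 * (int k + 2 * int 1) + (int g + 1 + 2 * int 1) + int 1) + (int m + int 1) * (int m + int 1 - 1)
        \<le> 2 * (int n - int m + 1)"
  shows "\<exists>E'. realizes n d E' \<and> (has_clique n k E' \<or> clique E' B \<and> joins B U \<subseteq> E' \<and> two_full E')"
proof -
  have on: "edges_on {..<n} E" using E by (simp add: realizes_def)
  let ?P = "{a. eligible E a}"
  have fP: "finite ?P" using U finite_subset[of ?P U] by (auto simp: eligible_def)
  \<comment> \<open>Taking u of largest degree among the eligible vertices yields
    \<open>big\<close>: a vertex of \<open>U\<close> with larger degree is not eligible.\<close>
  have "Max (d ` ?P) \<in> d ` ?P" using a(1) fP by (intro Max_in) auto
  then obtain u where u: "eligible E u" "d u = Max (d ` ?P)" by auto
  have u2: "d z \<le> d u" if "eligible E z" for z using that fP u(2) by (auto intro: Max_ge)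
  obtain v where v: "eligible E v" "v \<noteq> u" "{u, v} \<noteq> {f, f'}"
  proof -
    consider "u = a" | "u = a'" | "u \<noteq> a" "u \<noteq> a'" "{u, a} \<noteq> {f, f'}" | "u \<noteq> a" "u \<noteq> a'" "{u, a'} \<noteq> {f, f'}"
      using a(3) by (auto simp: doubleton_eq_iff)
    then show thesis using that[of a] that[of a'] a by cases (auto simp: insert_commute)
  qed
  \<comment> \<open>The ends of the edge found before need not lie in \<open>U\<close>; adding them
    explains the allowance of 2 * h further vertices.\<close>
  let ?A = "U \<union> {f, f'}" and ?F = "{{f, f'}}"
  let ?K = "pairs B \<union> joins B ?A \<union> ?F"
  have ff: "f \<noteq> f'" using edges_onD(1)[OF on f(3)] .
  have AF: "?A \<subseteq> full E" using U_full[OF E(3)] f by auto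
  have jA: "joins B ?A \<subseteq> E"
    by (rule joins_full[OF AF])
  have uvU: "u \<in> U" "v \<in> U" using u v by (auto simp: eligible_def)
  have uvE: "{u, v} \<notin> E"
    using E(4) f AF uvU v two_fullI[of "{u, v}" E "{f, f'}"] by auto
  have Fnb: "nb ?F p \<subseteq> {f, f'}" "card (nb ?F p) \<le> 1" for p
  proof -
    show "nb ?F p \<subseteq> {f, f'}" by (auto simp: nb_def doubleton_eq_iff)
    have "nb ?F p \<subseteq> {if p = f then f' else f}" by (auto simp: nb_def doubleton_eq_iff)
    from card_mono[OF _ this] show "card (nb ?F p) \<le> 1" by simp
  qed
  show ?thesis
  proof (cases "\<exists>E'. realizes n d E' \<and> E \<inter> ?K \<subseteq> E' \<and> {u, v} \<in> E'")
    case True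
    then obtain E' where E': "realizes n d E'" "E \<inter> ?K \<subseteq> E'" "{u, v} \<in> E'" by blast
    have "clique E' B" using E'(2) E by (auto simp: clique_pairs)
    moreover have jA': "joins B ?A \<subseteq> E'" using E'(2) jA by auto
    moreover have "joins B U \<subseteq> joins B ?A" by (auto simp: joins_def)
    moreover have "?A \<subseteq> full E'"
      by (rule full_joins[OF jA']) (use AF in \<open>auto simp: full_def\<close>)
    then have "two_full E'" using E' f v uvU by (intro two_fullI[of "{u, v}" _ "{f, f'}"]) auto
    ultimately show ?thesis using E' by blast
  next
    case nex: False
    interpret b: blocked n d E ?K u v
      by unfold_locales (use E uvU uvE v kn nex in \<open>auto simp: U_def\<close>)
    have "has_clique n k E"
    proof (rule blocked_full_edge[OF b.blocked_axioms E(2) jA, where h = 1])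
      show "card ?A \<le> g + 1 + 2 * 1"
        using card_Un_le[of U "{f, f'}"] U ff by simp
      show "?F \<subseteq> pairs ?A" using ff by (auto simp: pairs_def)
      show "{p, q} \<in> ?F" if "p \<in> full E" "q \<in> full E" "{p, q} \<in> E" for p q
        using that E(4) f two_fullI[of "{p, q}" E "{f, f'}"] by auto
      show "\<not> nb E u \<subseteq> B \<union> nb ?F u" "\<not> nb E v \<subseteq> B \<union> nb ?F v"
        using u(1) v(1) Fnb(1)[of u] Fnb(1)[of v] f unfolding eligible_def by auto
      show "nb E z \<subseteq> B \<union> full E" if "z \<in> U" "d u < d z" for z
        using u2[of z] that by (auto simp: eligible_def)
      show "card (nb ?F p) \<le> 1" for p by (rule Fnb(2))
      show "?A \<subseteq> {..<n}" "?A \<inter> B = {}" using AF by (auto simp: full_def)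
      show "d v \<le> d u" by (rule u2[OF v(1)])
    qed (use uvU u(1) v f room in auto)
    then show ?thesis using E by blast
  qed
qed

text \<open>Three vertices of \<open>U\<close> have degree at least m. The obstacle is an edge ff'
  joining two of them that both have degree exactly m: then only the third, w, is known to be
  eligible.\<close>

lemma realize_second_full_edge:
  assumes E0: "realizes n d E" "clique E B" "joins B U \<subseteq> E"
    and f: "f \<in> full E" "f' \<in> full E" "{f, f'} \<in> E"
    and dm: "m \<le> d (m + 1)" "m + 1 \<le> d (m - 1) \<or> m \<le> d (m + 2)" and g: "3 \<le> g"
    and room: "2 * ((int k - 1 + 2 * int 1) * (int m + int k - 1 + 2 * int 1) + (int m - 1 + int 1) + (int m - 1)
        + int 1 * (int k + 2 * int 1) + (int g + 1 + 2 * int 1) + int 1) + (int m + int 1) * (int m + int 1 - 1)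
        \<le> 2 * (int n - int m + 1)"
  shows "\<exists>E'. realizes n d E' \<and> (has_clique n k E' \<or> clique E' B \<and> joins B U \<subseteq> E' \<and> two_full E')"
proof (cases "two_full E")
  case True then show ?thesis using E0 by blast
next
  case nt: False
  note core = second_full_edge[OF _ _ _ _ _ _ _ _ _ _ _ room]
  have on: "edges_on {..<n} E" using E0 by (simp add: realizes_def)
  have I: "m - 1 \<in> U" "m \<in> U" "m + 1 \<in> U" "m + 2 \<in> U" unfolding U_def using k g by auto
  have dI: "m \<le> d (m - 1)" "m \<le> d m" by (rule order_trans[OF dm(1) mono]; use k kn in simp)+
  define I where "I = {m - 1, m, m + 1}"
  have II: "a \<in> U" "m \<le> d a" if "a \<in> I" for a using that I dI dm by (auto simp: I_def)
  have "m - 1 \<noteq> m" "m - 1 \<noteq> m + 1" using k by auto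
  then have cI: "card I = 3" by (simp add: I_def)
  note el = eligibleI[OF E0(1,3) nt f]
  show ?thesis
  proof (cases "\<exists>a\<in>I. \<exists>a'\<in>I. a \<noteq> a' \<and> a \<notin> {f, f'} \<and> a' \<notin> {f, f'}")
    case True
    then obtain a a' where a: "a \<in> I" "a' \<in> I" "a \<noteq> a'" "a \<notin> {f, f'}" "a' \<notin> {f, f'}" by blast
    then have "eligible E a" "eligible E a'" using el II by auto
    then show ?thesis using core[OF E0 nt f, of a a'] a by (auto simp: doubleton_eq_iff)
  next
    case False
    then have c1: "card (I - {f, f'}) \<le> Suc 0"
      by (subst card_le_Suc0_iff_eq) (auto simp: I_def)
    have c3: "card (I \<inter> {f, f'}) + card (I - {f, f'}) = 3"
      using cI card_Int_Diff[of I "{f, f'}"] by (simp add: I_def)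
    have ff: "f \<noteq> f'" using edges_onD(1)[OF on f(3)] .
    have "card (I \<inter> {f, f'}) \<le> card {f, f'}" by (intro card_mono) auto
    then have c2: "card (I \<inter> {f, f'}) = card {f, f'}" "card (I - {f, f'}) = 1" using c1 c3 ff by auto
    then have "I \<inter> {f, f'} = {f, f'}" by (intro card_subset_eq) auto
    then have ffI: "f \<in> I" "f' \<in> I" "f \<noteq> f'" using ff by auto
    obtain w where "I - {f, f'} = {w}" using c2(2) card_1_singletonE by blast
    then have w: "w \<in> I" "w \<notin> {f, f'}" and Iw: "I = {w, f, f'}" using ffI by auto
    have wel: "eligible E w" using el w II by auto
    show ?thesis
    proof (cases "m + 1 \<le> d f \<or> m + 1 \<le> d f'")
      case True
      then have "eligible E f \<or> eligible E f'" using el II ffI by auto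
      then show ?thesis using core[OF E0 nt f wel, of f] core[OF E0 nt f wel, of f'] w
        by (auto simp: doubleton_eq_iff)
    next
      case ffm: False
      then have dff: "d f = m" "d f' = m" using II(2)[OF ffI(1)] II(2)[OF ffI(2)] by auto
      show ?thesis
      proof (cases "m + 1 \<le> d w")
        case False
        then have "d w = m" using II(2)[OF w(1)] by simp
        have "m - 1 \<in> {w, f, f'}" using Iw by (auto simp: I_def)
        then have "d (m - 1) = m" using \<open>d w = m\<close> dff by auto
        \<comment> \<open>All three degrees equal m here, so the disjunction in \<open>dm\<close>
          supplies a fourth vertex; 3 \<le> g puts it into \<open>U\<close>.\<close>
        then have "m \<le> d (m + 2)" using dm by simp
        moreover have "m + 2 \<notin> {w, f, f'}" unfolding Iw[symmetric] by (simp add: I_def)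
        ultimately have "eligible E (m + 2)" using el I by auto
        then show ?thesis using core[OF E0 nt f wel, of "m + 2"] w \<open>m + 2 \<notin> {w, f, f'}\<close>
          by (auto simp: doubleton_eq_iff)
      next
        case True
        obtain x where x: "x \<in> nb E w" "x \<notin> B" "x \<notin> full E" using wel by (auto simp: eligible_def)
        have nU: "w < n" "f' < n" "w \<notin> B" "f \<notin> B" "f' \<notin> B" "w \<in> full E"
          using II(1)[OF w(1)] II(1)[OF ffI(1)] II(1)[OF ffI(2)] kn U_full[OF E0(3)]
          by (auto simp: U_def B_def)
        have "insert f B \<subseteq> nb E f'" using f by (auto simp: full_def nb_def insert_commute)
        moreover have "card (insert f B) = m" using nU B k by simp
        moreover have "card (nb E f') = m" using E0 nU dff by (simp add: realizes_def)
        ultimately have nbf: "nb E f' = insert f B"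
          using card_seteq[of "nb E f'" "insert f B"] finite_nb[OF on] by simp
        have xf: "x \<noteq> f" "x \<noteq> f'" "{x, f'} \<notin> E"
          using x f nbf nb_iff[of x E f'] by (auto simp: insert_commute)
        have wf: "{w, f} \<notin> E"
          using nt f nU w two_fullI[of "{w, f}" E "{f, f'}"] by (auto simp: doubleton_eq_iff)
        \<comment> \<open>As w has degree to spare, the edge inside \<open>full E\<close> is moved
          from ff' to wf. Now f' is no end of it and has degree m, so f' becomes eligible, and w
          stays eligible because its degree exceeds m.\<close>
        let ?E = "E - {{w, x}, {f, f'}} \<union> {{w, f}, {x, f'}}"
        have E': "realizes n d ?E"
          using swap2[OF E0(1), of w x f f'] x f w xf wf by (auto simp: nb_iff)
        have cl: "clique ?E B"
          using E0(2) nU by (auto simp: clique_def doubleton_eq_iff)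
        have jo: "joins B U \<subseteq> ?E"
        proof
          fix e assume e: "e \<in> joins B U"
          then have "e \<in> E" "e \<inter> B \<noteq> {}" using E0(3) by (auto simp: joins_def)
          moreover have "{w, x} \<inter> B = {}" "{f, f'} \<inter> B = {}" using nU x by auto
          ultimately show "e \<in> ?E" by auto
        qed
        show ?thesis
        proof (cases "two_full ?E")
          case True then show ?thesis using E' cl jo by blast
        next
          case nt': False
          have fl: "w \<in> full ?E" "f \<in> full ?E" using U_full[OF jo] II w ffI by auto
          have "{w, f} \<in> ?E" by simp
          note el' = eligibleI[OF E' jo nt' fl this]
          have "eligible ?E w" using el' II w True by auto
          moreover have "eligible ?E f'" using el' II ffI w by auto
          ultimately show ?thesis
            using core[OF E' cl jo nt' fl \<open>{w, f} \<in> ?E\<close>, of w f'] w ffI by (auto simp: doubleton_eq_iff)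
        qed
      qed
    qed
  qed
qed

end

section \<open>Degrees forced by the degree sum\<close>

context degree_sequence
begin

lemma sum_d_split:
  assumes "s \<le> n"
  shows "(\<Sum>v<n. int (d v)) = (\<Sum>v<s. int (d v)) + (\<Sum>v=s..<n. int (d v))"
proof -
  have "{..<n} = {..<s} \<union> {s..<n}" using assms by auto
  then show ?thesis by (simp add: sum.union_disjoint ivl_disj_int)
qed

lemma sum_d_tail:
  assumes "s \<le> n" "d s \<le> t \<or> s = n"
  shows "(\<Sum>v=s..<n. int (d v)) \<le> int t * (int n - int s)"
proof -
  have "(\<Sum>v=s..<n. int (d v)) \<le> (\<Sum>v=s..<n. int t)"
    using assms(2) by (intro sum_mono) (use mono[of s] in fastforce)
  then show ?thesis using assms(1) by (simp add: of_nat_diff mult.commute)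
qed

text \<open>A bound in the style of Erdos and Gallai: apart from the edges among the first s
  vertices, each edge is charged to an end of degree at most t.\<close>

lemma sum_d_le:
  assumes E: "realizes n d E" and s: "s < n" "d s \<le> t"
  shows "(\<Sum>v<n. int (d v)) \<le> int s * (int s - 1) + 2 * int t * (int n - int s)"
proof -
  have on: "edges_on {..<n} E" using E by (simp add: realizes_def)
  have fE: "finite E" using on edges_on_finite by blast
  let ?A = "{..<s}" and ?C = "{s..<n}"
  have "card E \<le> card {e \<in> E. e \<subseteq> ?A} + card {e \<in> E. e \<inter> ?C \<noteq> {}}"
  proof -
    have "E \<subseteq> {e \<in> E. e \<subseteq> ?A} \<union> {e \<in> E. e \<inter> ?C \<noteq> {}}"
      using on by (fastforce simp: edges_on_def)
    then have "card E \<le> card ({e \<in> E. e \<subseteq> ?A} \<union> {e \<in> E. e \<inter> ?C \<noteq> {}})"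
      using fE by (intro card_mono) auto
    then show ?thesis using card_Un_le le_trans by blast
  qed
  moreover have "card {e \<in> E. e \<inter> ?C \<noteq> {}} \<le> (\<Sum>v\<in>?C. d v)"
  proof -
    have "{e \<in> E. e \<inter> ?C \<noteq> {}} = (\<Union>v\<in>?C. {e \<in> E. v \<in> e})" by auto
    then have "card {e \<in> E. e \<inter> ?C \<noteq> {}} \<le> (\<Sum>v\<in>?C. card {e \<in> E. v \<in> e})"
      by (simp add: card_UN_le)
    also have "\<dots> = (\<Sum>v\<in>?C. d v)"
      using E card_nb[OF on] by (intro sum.cong) (auto simp: realizes_def)
    finally show ?thesis .
  qed
  moreover have "2 * card {e \<in> E. e \<subseteq> ?A} \<le> s * (s - 1)"
    using edges_inside[OF on, of ?A] by simp
  moreover have "(\<Sum>v<n. d v) = 2 * card E"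
    using sum_card_nb[OF on] E by (simp add: realizes_def)
  ultimately have "(\<Sum>v<n. d v) \<le> s * (s - 1) + 2 * (\<Sum>v\<in>?C. d v)" by linarith
  then have "int (\<Sum>v<n. d v) \<le> int (s * (s - 1) + 2 * (\<Sum>v\<in>?C. d v))" by (simp only: of_nat_le_iff)
  also have "int (s * (s - 1)) = int s * (int s - 1)" by (cases s) (auto simp: algebra_simps)
  then have "int (s * (s - 1) + 2 * (\<Sum>v\<in>?C. d v)) = int s * (int s - 1) + 2 * (\<Sum>v\<in>?C. int (d v))"
    by (simp only: of_nat_add of_nat_mult of_nat_sum of_nat_numeral)
  also have "\<dots> \<le> int s * (int s - 1) + 2 * (int t * (int n - int s))"
    using sum_d_tail[of s t] s by simp
  finally show ?thesis by (simp add: mult.assoc)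
qed

lemma d_le_n1:
  assumes E: "realizes n d E" and v: "v < n"
  shows "d v \<le> n - 1"
proof -
  have on: "edges_on {..<n} E" using E by (simp add: realizes_def)
  have "nb E v \<subseteq> {..<n} - {v}" using nb_subset[OF on] nb_irrefl[OF on] by blast
  then have "card (nb E v) \<le> card ({..<n} - {v})" by (intro card_mono) auto
  then show ?thesis using E v by (simp add: realizes_def)
qed

lemma d_k1:
  assumes E: "realizes n d E"
  shows "m - 1 \<le> d (k - 1)"
proof (rule ccontr)
  assume c: "\<not> m - 1 \<le> d (k - 1)"
  have "(\<Sum>v<n. int (d v)) \<le> int (k - 1) * (int (k - 1) - 1) + 2 * int (m - 2) * (int n - int (k - 1))"
    by (rule sum_d_le[OF E]) (use c kn k in auto)
  moreover have eqs: "int (k - 1) = int k - 1" "int (m - 2) = int m - 2" "int (m - 1) = int m - 1" using k by auto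
  define q p r M where "q = int k * int k" and "p = int m * int k" and "r = int m * int m" and "M = int m * int n"
  ultimately have "2 * M - r + int m - 2 * int n + 2 * int \<eta> \<le> q - 3 * int k + 2 + 2 * (M - p + int m - 2 * int n + 2 * int k - 2)"
    using sum_d(1) unfolding eqs by (simp add: q_def p_def r_def M_def algebra_simps)
  then have "2 * int n + 2 * int \<eta> + 2 * p \<le> q + r + int k + int m - 2" by simp
  moreover have "int (2 * k * k) \<le> int n" using n by (simp only: of_nat_le_iff)
  then have "2 * q \<le> int n" by (simp add: q_def)
  moreover have "r \<le> p" using k by (simp add: r_def p_def)
  moreover have "int k \<le> q" "int m \<le> int k" "0 \<le> p" using k by (simp_all add: q_def p_def)
  ultimately show False using sum_d(2) by linarith
qed

text \<open>For s = m and t = m - 1 the upper bound \<open>sum_d_le\<close> is exactly (m - 1) * (2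
  * n - m), so any positive surplus excludes it.\<close>

lemma d_m:
  assumes E: "realizes n d E"
  shows "m \<le> d m"
proof (rule ccontr)
  assume c: "\<not> m \<le> d m"
  have "(\<Sum>v<n. int (d v)) \<le> int m * (int m - 1) + 2 * int (m - 1) * (int n - int m)"
    by (rule sum_d_le[OF E]) (use c kn k in auto)
  moreover have "int (m - 1) = int m - 1" using k by auto
  ultimately show False using sum_d by (simp add: algebra_simps)
qed

text \<open>For s = m + 1 and t = m - 1 the bound is larger than (m - 1) * (2 * n - m) by 2, while
  the surplus is at least 4.\<close>

lemma d_m1:
  assumes E: "realizes n d E" and \<eta>: "2 \<le> \<eta>"
  shows "m \<le> d (m + 1)"
proof (rule ccontr)
  assume c: "\<not> m \<le> d (m + 1)"
  have "(\<Sum>v<n. int (d v)) \<le> int (m + 1) * (int (m + 1) - 1) + 2 * int (m - 1) * (int n - int (m + 1))"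
    by (rule sum_d_le[OF E]) (use c kn k in auto)
  moreover have "int (m - 1) = int m - 1" using k by auto
  ultimately show False using sum_d \<eta> by (simp add: algebra_simps)
qed

text \<open>Otherwise m - 1 degrees are at most n - 1, three are at most m and the others at most m
  - 1. The sum is then at most (m - 1) * (2 * n - m) + 3, one short of the surplus 4.\<close>

lemma d_m2:
  assumes E: "realizes n d E" and \<eta>: "2 \<le> \<eta>" and g: "3 \<le> g"
  shows "m + 1 \<le> d (m - 1) \<or> m \<le> d (m + 2)"
proof (rule ccontr)
  assume c: "\<not> ?thesis"
  have le: "m + 2 < n" using kn k g by linarith
  have s1: "{..<m + 2} = {..<m - 1} \<union> {m - 1..<m + 2}" by auto
  have s2: "(\<Sum>v<m + 2. int (d v)) = (\<Sum>v<m - 1. int (d v)) + (\<Sum>v=m - 1..<m + 2. int (d v))"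
    unfolding s1 by (rule sum.union_disjoint) auto
  have "(\<Sum>v<n. int (d v)) = (\<Sum>v<m - 1. int (d v)) + (\<Sum>v=m - 1..<m + 2. int (d v)) + (\<Sum>v=m + 2..<n. int (d v))"
    using sum_d_split[of "m + 2"] le s2 by simp
  moreover have "(\<Sum>v<m - 1. int (d v)) \<le> (\<Sum>v<m - 1. int n - 1)"
  proof (rule sum_mono)
    fix v assume "v \<in> {..<m - 1}"
    then have "d v \<le> n - 1" "1 \<le> n" using d_le_n1[OF E, of v] le by auto
    then show "int (d v) \<le> int n - 1" by linarith
  qed
  moreover have "(\<Sum>v=m - 1..<m + 2. int (d v)) \<le> (\<Sum>v=m - 1..<m + 2. int m)"
    using c mono[of "m - 1"] le by (intro sum_mono) fastforce
  moreover have "(\<Sum>v=m + 2..<n. int (d v)) \<le> int (m - 1) * (int n - int (m + 2))"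
    by (rule sum_d_tail) (use c le in auto)
  moreover have "int (m - 1) = int m - 1" using k by auto
  moreover have "m + 2 - (m - 1) = 3" using k by auto
  ultimately show False using sum_d \<eta> by (simp add: algebra_simps)
qed

end

context heavy_top
begin

lemma one_full_edge:
  assumes "realizes n d E0"
  shows "\<exists>E. realizes n d E \<and> (has_clique n k E \<or>
    clique E B \<and> joins B U \<subseteq> E \<and> (\<exists>p\<in>full E. \<exists>q\<in>full E. {p, q} \<in> E))"
proof -
  obtain E1 where E1: "realizes n d E1" "has_clique n k E1 \<or> clique E1 B"
    using realize_clique_B[OF assms] by blast
  show ?thesis
  proof (cases "has_clique n k E1")
    case False
    then obtain E2 where E2: "realizes n d E2" "has_clique n k E2 \<or> clique E2 B \<and> joins B U \<subseteq> E2"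
      using E1 realize_join_B_U[OF E1(1) _ d_k1[OF assms]] by blast
    then show ?thesis using realize_full_edge[OF E2(1) _ _ d_m[OF assms]] by metis
  qed (use E1 in blast)
qed

lemma two_full_edges:
  assumes "realizes n d E0" "2 \<le> \<eta>" "k + 2 = 3 * g" "4 \<le> g" "20 * (g * g) + 2 \<le> n + 17 * g"
  shows "\<exists>E. realizes n d E \<and> (has_clique n k E \<or> clique E B \<and> joins B U \<subseteq> E \<and> two_full E)"
proof -
  obtain E where E: "realizes n d E" "has_clique n k E \<or>
    clique E B \<and> joins B U \<subseteq> E \<and> (\<exists>p\<in>full E. \<exists>q\<in>full E. {p, q} \<in> E)"
    using one_full_edge[OF assms(1)] by blast
  show ?thesis
  proof (cases "has_clique n k E")
    case False
    then obtain p q where pq: "p \<in> full E" "q \<in> full E" "{p, q} \<in> E" and cl: "clique E B" "joins B U \<subseteq> E"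
      using E by blast
    show ?thesis
    proof (rule realize_second_full_edge[OF E(1) cl pq d_m1[OF assms(1,2)] d_m2[OF assms(1,2)]])
      have kk: "int k = 3 * int g - 2" "int m = 2 * int g - 2" using assms(3) k(1) by linarith+
      define G where "G = int g * int g"
      have "4 * int g \<le> G" using assms(4) by (simp add: G_def)
      moreover have "int (20 * (g * g) + 2) \<le> int (n + 17 * g)" using assms(5) by (simp only: of_nat_le_iff)
      then have "20 * G + 2 \<le> int n + 17 * int g" by (simp add: G_def)
      \<comment> \<open>Substituting k = 3 * g - 2 and m = 2 * g - 2 turns the left-hand side of
        \<open>room\<close> at h = 1 into this polynomial.\<close>
      ultimately have "34 * G - 18 * int g + 6 \<le> 2 * (int n - int m + 1)" using assms(4) unfolding kk by simp
      then show "2 * ((int k - 1 + 2 * int 1) * (int m + int k - 1 + 2 * int 1) + (int m - 1 + int 1) + (int m - 1)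
        + int 1 * (int k + 2 * int 1) + (int g + 1 + 2 * int 1) + int 1) + (int m + int 1) * (int m + int 1 - 1)
        \<le> 2 * (int n - int m + 1)"
        unfolding kk G_def by (simp add: algebra_simps)
    qed (use assms in auto)
  qed (use E in blast)
qed

end

section \<open>Fewer than m - 1 large degrees\<close>

context degree_sequence
begin

text \<open>The threshold k + g is the number of other vertices in \<open>P \<union> S\<close>, so a
  vertex of degree at least k + g can be joined to all of them, while degrees below it bound
  \<open>Z\<close> and \<open>T\<close>. Nowhere do the prescribed edges exceed the given degrees,
  so both ends of a missing one have an unprescribed neighbour. No clique alternative is
  needed.\<close>

lemma light_top:
  assumes E0: "realizes n d E0" and room: "(k + g) * (k + g) + 2 \<le> n" and light: "d (m - 2) < k + g"
  obtains p j where "p + j + 1 = m" "1 \<le> j"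
    "\<And>F. F \<subseteq> pairs {p..<p + (2 * g + 2 + j)} \<Longrightarrow> (\<And>v. card (nb F v) \<le> 2 * j) \<Longrightarrow>
      \<exists>E. realizes n d E \<and> pairs {..<p} \<union> joins {..<p} {p..<p + (2 * g + 2 + j)} \<union> F \<subseteq> E"
proof -
  define p where "p = (LEAST i. d i < k + g)"
  define j where "j = m - 1 - p"
  have pm: "p \<le> m - 2" unfolding p_def by (rule Least_le) (rule light)
  then have pj: "p + j + 1 = m" "1 \<le> j" using k by (auto simp: j_def)
  have "d p < k + g" unfolding p_def by (rule LeastI) (rule light)
  then have low: "d i < k + g" if "p \<le> i" "i < n" for i using mono[of p i] that by simp
  have high: "k + g \<le> d i" if "i < p" for i
    using not_less_Least[of i "\<lambda>i. d i < k + g"] that by (auto simp: p_def)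
  have "k + g \<le> (k + g) * (k + g)" by (rule le_square)
  then have kgn: "k + g < n" using room by linarith
  \<comment> \<open>Otherwise p degrees are below n and those from position k + g on are at most m -
    2 + j. The coefficient of n in the sum is then at most p + m - 2 + j = 2 * m - 3, one less than
    required.\<close>
  have dS: "m - 1 + j \<le> d (k + g)"
  proof (rule ccontr)
    assume c: "\<not> ?thesis"
    have s1: "{..<k + g} = {..<p} \<union> {p..<k + g}" using pj k by auto
    have s2: "(\<Sum>v<k + g. int (d v)) = (\<Sum>v<p. int (d v)) + (\<Sum>v=p..<k + g. int (d v))"
      unfolding s1 by (rule sum.union_disjoint) auto
    have s3: "(\<Sum>v<n. int (d v)) = (\<Sum>v<p. int (d v)) + (\<Sum>v=p..<k + g. int (d v)) + (\<Sum>v=k + g..<n. int (d v))"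
      using sum_d_split[of "k + g"] kgn s2 by simp
    have "(\<Sum>v<p. int (d v)) \<le> (\<Sum>v<p. int n - 1)"
    proof (rule sum_mono)
      fix v assume "v \<in> {..<p}"
      then have "d v \<le> n - 1" "1 \<le> n" using d_le_n1[OF E0, of v] kgn pj k by auto
      then show "int (d v) \<le> int n - 1" by linarith
    qed
    then have b1: "(\<Sum>v<p. int (d v)) \<le> int p * (int n - 1)" by simp
    have "(\<Sum>v=p..<k + g. int (d v)) \<le> (\<Sum>v=p..<k + g. int k + int g - 1)"
      using low kgn by (intro sum_mono) fastforce
    moreover have "int (k + g - p) = int k + int g - int p" using pj k by simp
    ultimately have b2: "(\<Sum>v=p..<k + g. int (d v)) \<le> (int k + int g - int p) * (int k + int g - 1)" by simp
    have "(\<Sum>v=k + g..<n. int (d v)) \<le> int (m - 2 + j) * (int n - int (k + g))"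
      by (rule sum_d_tail) (use c kgn k in auto)
    moreover have "int (m - 2 + j) = int m - 2 + int j" using k by simp
    ultimately have b3: "(\<Sum>v=k + g..<n. int (d v)) \<le> (int m - 2 + int j) * (int n - int (k + g))"
      by (simp only:)
    have le: "(\<Sum>v<n. int (d v)) \<le> int p * (int n - 1) + (int k + int g - int p) * (int k + int g - 1)
      + (int m - 2 + int j) * (int n - int (k + g))"
      unfolding s3 by (intro add_mono b1 b2 b3)
    have eqs: "int k = int p + int j + 1 + int g" "int m = int p + int j + 1" "int (m - 1) = int p + int j"
      using pj k by auto
    define q where "q = int k * int k"
    have "int (2 * k * k) \<le> int n" using n by (simp only: of_nat_le_iff)
    then have q: "2 * q \<le> int n" by (simp add: q_def)
    have k6': "6 * int k \<le> q" using k6 by (simp add: q_def)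
    have "(2 * int g - int m + 2) * (int k + int g) \<le> 4 * (int k + int g)"
      using k by (intro mult_right_mono) auto
    moreover have "3 * (int m * (int m - 1)) \<le> 2 * int k * (int m - 1)"
      using mult_right_mono[of "3 * int m" "2 * int k" "int m - 1"] k by (simp add: algebra_simps)
    moreover have "int k * (3 * (int m - 1)) \<le> int k * (2 * int k - 3)"
      using k by (intro mult_left_mono) auto
    then have "3 * (2 * int k * (int m - 1)) \<le> 4 * q - 6 * int k" by (simp add: q_def algebra_simps)
    ultimately have "9 * (int m * (int m - 1)) + 9 * ((2 * int g - int m + 2) * (int k + int g)) \<le>
      4 * q - 6 * int k + 36 * (int k + int g)" by linarith
    moreover have "4 * q - 6 * int k + 36 * (int k + int g) < 9 * int n + 18"
    proof -
      have "int k = int m + int g" "4 \<le> int m" "0 \<le> int g" "0 \<le> int p" "3 * int g \<le> int k + 2" using k by auto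
      then show ?thesis using q k6' by (smt (verit))
    qed
    ultimately have "int m * (int m - 1) + (2 * int g - int m + 2) * (int k + int g) < int n + 2"
      by linarith
    then show False using le sum_d unfolding of_nat_add eqs by (simp add: algebra_simps)
  qed
  define S where "S = {p..<p + (2 * g + 2 + j)}"
  have S: "finite S" "S \<subseteq> {..<n}" "card S = 2 * g + 2 + j" "p + (2 * g + 2 + j) = k + g + 1"
    using pj k kgn by (auto simp: S_def)
  have dS': "m - 1 + j \<le> d v" if "v \<in> S" for v
    using dS mono[of v "k + g"] that kgn S(4) by (auto simp: S_def)
  have "\<exists>E. realizes n d E \<and> pairs {..<p} \<union> joins {..<p} S \<union> F \<subseteq> E"
    if F: "F \<subseteq> pairs S" "\<And>v. card (nb F v) \<le> 2 * j" for F
  proof -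
    let ?P = "{..<p}"
    let ?K = "pairs ?P \<union> joins ?P S \<union> F"
    have pn: "p < n" using kgn pj k by simp
    have "finite F" using finite_subset[OF F(1)] finite_pairs[OF S(1)] by blast
    then have fK: "finite ?K" using S(1) by (simp add: finite_pairs finite_joins)
    obtain E where E: "realizes n d E" "\<And>E'. realizes n d E' \<Longrightarrow> E \<inter> ?K \<subseteq> E' \<Longrightarrow> E' \<inter> ?K \<subseteq> E"
      using obtain_saturated[OF E0 fK] by metis
    have onF: "edges_on S F" using F(1) by (auto simp: edges_on_def pairs_def)
    have disj: "?P \<inter> S = {}" by (auto simp: S_def)
    have "?K \<subseteq> E"
    proof (rule ccontr)
      assume "\<not> ?K \<subseteq> E"
      then obtain e where e: "e \<in> ?K" "e \<notin> E" by blast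
      have "\<exists>u v. e = {u, v} \<and> u \<noteq> v \<and> u \<in> ?P \<union> S \<and> v \<in> ?P \<union> S"
        using e(1) F(1) unfolding pairs_def joins_def by blast
      then obtain u v where uv: "e = {u, v}" "u \<noteq> v" "u \<in> ?P \<union> S" "v \<in> ?P \<union> S" by blast
      note uv' = uv
      interpret blocked n d E ?K u v
      proof
        show "u < n" "v < n" using uv(3,4) S(2) pn by auto
        show "{u, v} \<notin> E'" if "realizes n d E'" "E \<inter> ?K \<subseteq> E'" for E'
          using E(2)[OF that] e uv(1) by blast
      qed (use E uv e in auto)
      have K: "{a, b} \<in> ?K \<longleftrightarrow> a \<noteq> b \<and> (a \<in> ?P \<and> b \<in> ?P \<union> S \<or> b \<in> ?P \<and> a \<in> S) \<or> b \<in> nb F a" for a b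
        unfolding nb_iff Un_iff pairs_iff joins_iff by blast
      have fin_nbF: "finite (nb F a)" for a using finite_nb[OF onF S(1)] .
      have nbF: "nb F a \<subseteq> S" for a using nb_subset[OF onF] .
      \<comment> \<open>A vertex of \<open>P\<close> has at most k + g prescribed neighbours, one of
        \<open>S\<close> at most p + 2 * j = m - 1 + j.\<close>
      have fnbK: "finite (nb ?K a)" and nbK: "card (nb ?K a) \<le> d a" if a: "a \<in> ?P \<union> S" for a
      proof -
        have "finite (nb ?K a) \<and> card (nb ?K a) \<le> d a"
        proof (cases "a \<in> ?P")
          case True
          have "a \<notin> nb F a" using nb_irrefl[OF onF] .
          then have sub: "nb ?K a \<subseteq> ?P \<union> S - {a}" using nbF[of a] unfolding subset_iff nb_iff[of _ ?K] K by blast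
          have "card (nb ?K a) \<le> card (?P \<union> S - {a})" using S by (intro card_mono[OF _ sub]) auto
          also have "\<dots> = card (?P \<union> S) - 1" using a by simp
          also have "card (?P \<union> S) = p + (2 * g + 2 + j)" using disj S by (subst card_Un_disjoint) auto
          finally show ?thesis using high[of a] True S finite_subset[OF sub] by simp
        next
          case False
          then have aS: "a \<in> S" using a by blast
          have sub: "nb ?K a \<subseteq> ?P \<union> nb F a" using False unfolding subset_iff nb_iff[of _ ?K] K by blast
          have "card (nb ?K a) \<le> card (?P \<union> nb F a)" using fin_nbF by (intro card_mono[OF _ sub]) auto
          also have "\<dots> \<le> p + 2 * j" using card_Un_le[of ?P "nb F a"] F(2)[of a] by simp
          finally show ?thesis using dS'[OF aS] pj finite_subset[OF sub] fin_nbF by simp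
        qed
        then show "finite (nb ?K a)" "card (nb ?K a) \<le> d a" by auto
      qed
      \<comment> \<open>A missing prescribed edge leaves room for an unprescribed one. Its other end
        is outside \<open>P\<close>, because all pairs between \<open>P\<close> and
        \<open>P \<union> S\<close> are prescribed.\<close>
      have nbEK: "nb (E - ?K) a \<noteq> {}" "nb (E - ?K) a \<inter> ?P = {}"
        if a: "a \<in> ?P \<union> S" "a' \<in> nb ?K a" "a' \<notin> nb E a" for a a'
      proof -
        have an: "a < n" using a(1) S(2) pn by auto
        have "nb (E - ?K) a \<noteq> {}"
        proof
          assume "nb (E - ?K) a = {}"
          then have "nb E a \<subseteq> nb ?K a - {a'}" using a(3) by (auto simp: nb_def)
          then have "card (nb E a) \<le> card (nb ?K a - {a'})" using fnbK[OF a(1)] by (intro card_mono) auto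
          also have "\<dots> < card (nb ?K a)" using fnbK[OF a(1)] a(2) by (intro psubset_card_mono) auto
          also have "\<dots> \<le> d a" by (rule nbK[OF a(1)])
          finally show False using deg[OF an] by simp
        qed
        moreover have "x \<notin> ?P" if "x \<in> nb (E - ?K) a" for x
        proof
          assume "x \<in> ?P"
          moreover have "{a, x} \<in> E" "{a, x} \<notin> ?K" using that by (auto simp: nb_def)
          moreover from this have "a \<noteq> x" using edges_onD(1)[OF on] by blast
          ultimately show False using a(1) unfolding K by blast
        qed
        ultimately show "nb (E - ?K) a \<noteq> {}" "nb (E - ?K) a \<inter> ?P = {}" by auto
      qed
      have uvK: "v \<in> nb ?K u" "u \<in> nb ?K v" "v \<notin> nb E u" "u \<notin> nb E v"
        using e[unfolded uv'(1)] by (simp_all only: nb_iff insert_commute[of v u] not_False_eq_True)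
      obtain x where x: "x \<in> X" "x \<notin> ?P" using nbEK[OF uv'(3) uvK(1,3)] unfolding X_def by blast
      obtain y where y: "y \<in> Y" "y \<notin> ?P" using nbEK[OF uv'(4) uvK(2,4)] unfolding Y_def by blast
      have "x < n" "y < n" using x y X_T Y_Z by (auto simp: T_def Z_def)
      then have cZ: "card Z \<le> k + g" and cT: "card T \<le> k + g"
        using card_Z[OF x(1)] card_T[OF y(1)] low[of x] low[of y] x y by auto
      define G where "G = {e \<in> E. e \<inter> ?P = {}} - F"
      have fE: "finite E" using on edges_on_finite by blast
      have fG: "finite G" using fE by (simp add: G_def)
      have at: "card {e \<in> G. w \<in> e} \<le> k + g - 1" if "w \<in> Z \<union> T" for w
      proof (cases "w \<in> ?P")
        case True
        then have "{e \<in> G. w \<in> e} = {}" by (auto simp: G_def)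
        then have "card {e \<in> G. w \<in> e} = 0" by (simp only: card.empty)
        then show ?thesis by linarith
      next
        case False
        have wn: "w < n" using that by (auto simp: Z_def T_def)
        have "card {e \<in> G. w \<in> e} \<le> card {e \<in> E. w \<in> e}" using fE by (intro card_mono) (auto simp: G_def)
        then show ?thesis using low[of w] False wn deg[OF wn] card_nb[OF on, of w] by simp
      qed
      have meet: "(\<Sum>e\<in>G. card (e \<inter> A)) \<le> (k + g) * (k + g - 1)"
        if A: "A \<subseteq> Z \<union> T" "card A \<le> k + g" "finite A" for A
      proof -
        have "(\<Sum>e\<in>G. card (e \<inter> A)) = (\<Sum>e\<in>G. \<Sum>w\<in>A. of_bool (w \<in> e))"
          using A(3) by (simp add: of_bool_def sum.If_cases Int_commute Collect_mem_eq)
        also have "\<dots> = (\<Sum>w\<in>A. card {e \<in> G. w \<in> e})"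
          by (subst sum.swap) (simp add: card_edges_at[OF fG])
        also have "\<dots> \<le> (\<Sum>w\<in>A. k + g - 1)" using at A by (intro sum_mono) blast
        also have "\<dots> \<le> (k + g) * (k + g - 1)" using A(2) by simp
        finally show ?thesis .
      qed
      \<comment> \<open>Double counting: by \<open>ZT\<close> in both orientations each edge of
        \<open>G\<close> has at least two incidences with \<open>Z\<close> and \<open>T\<close>
        together, and a vertex lies on at most k + g - 1 edges of \<open>G\<close>.\<close>
      have "2 * card G = (\<Sum>e\<in>G. 2)" by simp
      also have "\<dots> \<le> (\<Sum>e\<in>G. card (e \<inter> Z) + card (e \<inter> T))"
      proof (rule sum_mono)
        fix e assume e: "e \<in> G"
        then have e': "e \<in> E" "e \<inter> ?P = {}" "e \<notin> F" by (auto simp: G_def)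
        obtain a b where ab: "e = {a, b}" "a \<noteq> b"
          using edges_on_obtain[OF on e'(1)] .
        have "a \<notin> ?P" "b \<notin> ?P" "b \<notin> nb F a" using e'(2,3) unfolding ab(1) by (auto simp: nb_iff)
        then have "{a, b} \<notin> ?K" unfolding K by blast
        then have "{a, b} \<in> E - ?K" "{b, a} \<in> E - ?K" using e'(1) unfolding ab(1) by (simp_all only: Diff_iff insert_commute[of b a] simp_thms not_False_eq_True)
        from ZT[OF this(1)] ZT[OF this(2)]
        have "(a \<in> Z \<or> b \<in> T) \<and> (b \<in> Z \<or> a \<in> T)" by simp
        moreover have "card (e \<inter> A) = of_bool (a \<in> A) + of_bool (b \<in> A)" for A
          using ab by (simp add: Int_insert_left)
        ultimately show "2 \<le> card (e \<inter> Z) + card (e \<inter> T)" by auto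
      qed
      also have "\<dots> = (\<Sum>e\<in>G. card (e \<inter> Z)) + (\<Sum>e\<in>G. card (e \<inter> T))" by (rule sum.distrib)
      also have "\<dots> \<le> (k + g) * (k + g - 1) + (k + g) * (k + g - 1)"
        using cZ cT by (intro add_mono meet) auto
      finally have cG: "card G \<le> (k + g) * (k + g - 1)" by simp
      have "2 * card F = (\<Sum>v\<in>S. card (nb F v))" using sum_card_nb[OF onF S(1)] by simp
      also have "\<dots> \<le> (\<Sum>v\<in>S. 2 * j)" using F(2) by (intro sum_mono) auto
      finally have cF: "card F \<le> (2 * g + 2 + j) * j" using S(3) by simp
      have "card {e \<in> E. e \<inter> ?P = {}} \<le> card (G \<union> F)"
        using fG \<open>finite F\<close> by (intro card_mono) (auto simp: G_def)
      then have "card {e \<in> E. e \<inter> ?P = {}} \<le> (k + g) * (k + g - 1) + (2 * g + 2 + j) * j"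
        using card_Un_le[of G F] cG cF by linarith
      then have "int (card {e \<in> E. e \<inter> ?P = {}}) \<le> int ((k + g) * (k + g - 1) + (2 * g + 2 + j) * j)"
        by (simp only: of_nat_le_iff)
      moreover have "int (k + g - 1) = int k + int g - 1" using k by simp
      ultimately have up: "int (card {e \<in> E. e \<inter> ?P = {}}) \<le>
          (int k + int g) * (int k + int g - 1) + (2 * int g + 2 + int j) * int j"
        by (simp only: of_nat_add of_nat_mult of_nat_numeral)
      have "2 * int j * (int n - int p) - int j * (int j + 1) + 2 * int \<eta> \<le> 2 * int (card {e \<in> E. e \<inter> ?P = {}})"
        using avoiding_ge[OF E(1), of ?P j] pn pj by simp
      \<comment> \<open>This reduces the comparison to j = 1, where \<open>room\<close> leaves
        exactly 2 * \<eta> \<le> 0, a contradiction.\<close>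
      moreover have "0 \<le> (int j - 1) * (2 * int n - 2 * int m - 4 * int g - 4 - int j)"
      proof (rule mult_nonneg_nonneg)
        have "int (2 * k * k) \<le> int n" using n by (simp only: of_nat_le_iff)
        moreover have "6 * int k \<le> int k * int k" using k6 by simp
        ultimately have "12 * int k \<le> int n" by simp
        then show "0 \<le> 2 * int n - 2 * int m - 4 * int g - 4 - int j" using pj k by simp
      qed (use pj in simp)
      moreover have "int ((k + g) * (k + g) + 2) \<le> int n" using room by (simp only: of_nat_le_iff)
      moreover have "int m = int p + int j + 1" "int k = int p + int j + 1 + int g" using pj k by auto
      ultimately show False using up sum_d(2) by (simp add: algebra_simps)
    qed
    then show ?thesis using E(1) by blast
  qed
  then show thesis using that[OF pj] unfolding S_def by blast
qed

end

section \<open>Colour classes of 2-trees\<close>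

inductive set_two_tree :: "'a set \<Rightarrow> 'a set set \<Rightarrow> bool" where
  triangle: "a \<noteq> b \<Longrightarrow> a \<noteq> c \<Longrightarrow> b \<noteq> c \<Longrightarrow> set_two_tree {a, b, c} {{a, b}, {a, c}, {b, c}}"
| extend: "set_two_tree V E \<Longrightarrow> v \<notin> V \<Longrightarrow> {x, y} \<in> E \<Longrightarrow> x \<noteq> y \<Longrightarrow>
    set_two_tree (insert v V) (insert {v, x} (insert {v, y} E))"

lemma set_two_tree_edges:
  assumes "set_two_tree V E"
  shows "finite V" "edges_on V E" "V \<noteq> {}"
  using assms
proof (induction rule: set_two_tree.induct)
  case (extend V E v x y)
  { case 2
    have "x \<in> V" "y \<in> V" using edges_onD[OF extend.IH(2) extend.hyps(3)] by auto
    then have "card {v, x} = 2" "card {v, y} = 2" using extend.hyps by (auto simp: card_insert_if)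
    then show ?case using extend.IH(2) \<open>x \<in> V\<close> \<open>y \<in> V\<close> by (auto simp: edges_on_def)
  }
qed (auto simp: edges_on_def)

lemma set_two_tree_degree_two:
  assumes "set_two_tree V E"
  shows "\<exists>v\<in>V. card (nb E v) = 2"
  using assms
proof cases
  case (triangle a b c)
  have "nb E a = {b, c}" unfolding triangle using triangle by (auto simp: nb_def doubleton_eq_iff)
  then show ?thesis using triangle by auto
next
  case (extend V' E' v x y)
  have on: "edges_on V' E'" using set_two_tree_edges(2)[OF extend(3)] .
  have "x \<in> V'" "y \<in> V'" using edges_onD[OF on extend(5)] by auto
  moreover have "{v, w} \<notin> E'" for w using edges_onD(2)[OF on, of v w] extend by blast
  ultimately have "nb E v = {x, y}" unfolding extend using extend by (auto simp: nb_def doubleton_eq_iff)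
  then show ?thesis using extend by auto
qed

text \<open>The last two conditions express that two colour classes induce a tree: the edge count of
  a tree, and the sparsity of a forest on every nonempty vertex set missing a colour. Counts replace
  cycles and connectivity because the embedding argument only counts.\<close>

definition tree_colouring :: "'a set \<Rightarrow> 'a set set \<Rightarrow> ('a \<Rightarrow> nat) \<Rightarrow> bool" where
  "tree_colouring V E f \<longleftrightarrow> (\<forall>v\<in>V. f v < 3) \<and> (\<forall>a b. {a, b} \<in> E \<longrightarrow> f a \<noteq> f b) \<and>
    (\<forall>v\<in>V. \<forall>i<3. i \<noteq> f v \<longrightarrow> (\<exists>w\<in>nb E v. f w = i)) \<and>
    (\<forall>i<3. card {e \<in> E. i \<notin> f ` e} + 1 = card {v \<in> V. f v \<noteq> i}) \<and>
    (\<forall>X\<subseteq>V. X \<noteq> {} \<longrightarrow> (\<exists>i<3. i \<notin> f ` X) \<longrightarrow> card {e \<in> E. e \<subseteq> X} < card X)"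

lemma triangle_colouring:
  assumes "a \<noteq> b" "a \<noteq> c" "b \<noteq> c"
  shows "tree_colouring {a, b, c} {{a, b}, {a, c}, {b, c}} (\<lambda>x. if x = a then 0 else if x = b then 1 else 2)"
    (is "tree_colouring ?V ?E ?f")
  unfolding tree_colouring_def
proof (intro conjI allI impI ballI)
  have cases3: "i = 0 \<or> i = 1 \<or> i = 2" if "i < 3" for i :: nat using that by auto
  note a = assms assms[symmetric]
  show "?f v < 3" for v by simp
  show "?f x \<noteq> ?f y" if "{x, y} \<in> ?E" for x y
    using that a by (auto simp: doubleton_eq_iff)
  show "\<exists>w\<in>nb ?E v. ?f w = i" if "v \<in> ?V" "i < 3" "i \<noteq> ?f v" for v i
  proof -
    have "b \<in> nb ?E a" "c \<in> nb ?E a" "a \<in> nb ?E b" "c \<in> nb ?E b" "a \<in> nb ?E c" "b \<in> nb ?E c"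
      by (simp_all add: nb_def insert_commute)
    moreover have "?f a = 0" "?f b = 1" "?f c = 2" using a by simp_all
    moreover have "v = a \<or> v = b \<or> v = c" using that(1) by simp
    ultimately show ?thesis using cases3[OF that(2)] that(3) by metis
  qed
  show "card {e \<in> ?E. i \<notin> ?f ` e} + 1 = card {v \<in> ?V. ?f v \<noteq> i}" if "i < 3" for i
  proof -
    have sel: "{e \<in> ?E. R e} = (if R {a, b} then {{a, b}} else {}) \<union> (if R {a, c} then {{a, c}} else {})
      \<union> (if R {b, c} then {{b, c}} else {})" for R by auto
    have selV: "{v \<in> ?V. R v} = (if R a then {a} else {}) \<union> (if R b then {b} else {}) \<union> (if R c then {c} else {})"
      for R by auto
    have f: "?f a = 0" "?f b = 1" "?f c = 2" using a by simp_all
    have ne: "{a, b} \<noteq> {a, c}" "{a, b} \<noteq> {b, c}" "{a, c} \<noteq> {b, c}" using a by (auto simp: doubleton_eq_iff)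
    show ?thesis
      unfolding sel[of "\<lambda>e. i \<notin> ?f ` e"] selV[of "\<lambda>v. ?f v \<noteq> i"] image_insert image_empty f
      using cases3[OF that] by (elim disjE) (simp_all add: a ne)
  qed
  show "card {e \<in> ?E. e \<subseteq> X} < card X" if X: "X \<subseteq> ?V" "X \<noteq> {}" "\<exists>i<3. i \<notin> ?f ` X" for X
  proof -
    have "X \<noteq> ?V" using X(3) cases3 a by auto
    then have "card X < card ?V" using X(1) by (intro psubset_card_mono) auto
    then have c2: "card X \<le> 2" using a by simp
    have fX: "finite X" using X(1) finite_subset by blast
    have "{e \<in> ?E. e \<subseteq> X} \<subseteq> (if card X = 2 then {X} else {})"
    proof
      fix e assume e: "e \<in> {e \<in> ?E. e \<subseteq> X}"
      then have "card e = 2" using a by auto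
      moreover have "card e \<le> card X" using e fX by (auto intro: card_mono)
      ultimately show "e \<in> (if card X = 2 then {X} else {})"
        using e c2 fX card_subset_eq[of X e] by auto
    qed
    then have le: "card {e \<in> ?E. e \<subseteq> X} \<le> card (if card X = 2 then {X} else {})"
      by (rule card_mono[rotated]) simp
    have "card X \<noteq> 0" unfolding card_0_eq[OF fX] by (rule X(2))
    moreover have "card (if card X = 2 then {X} else {}) = (if card X = 2 then 1 else 0)" by simp
    moreover have "r < c" if "c \<noteq> 0" "r \<le> (if c = 2 then 1 else 0)" for r c :: nat
      using that by (auto split: if_splits)
    ultimately show ?thesis using le by (simp only:)
  qed
qed

lemma third_colour:
  fixes a b :: nat
  assumes "a < 3" "b < 3" "a \<noteq> b"
  shows "3 - a - b < 3 \<and> 3 - a - b \<noteq> a \<and> 3 - a - b \<noteq> b \<and> (\<forall>i<3. i = 3 - a - b \<or> i = a \<or> i = b)"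
proof -
  have "a = 0 \<or> a = 1 \<or> a = 2" "b = 0 \<or> b = 1 \<or> b = 2" using assms(1,2) by auto
  then show ?thesis using assms(3) by (elim disjE) auto
qed

text \<open>The new vertex takes the colour absent from x and y. It becomes a leaf in the two
  bicoloured trees using that colour, and the third tree is unchanged.\<close>

lemma extend_colouring:
  assumes T: "set_two_tree V E" "v \<notin> V" "{x, y} \<in> E" "x \<noteq> y" and f: "tree_colouring V E f"
  shows "tree_colouring (insert v V) (insert {v, x} (insert {v, y} E)) (f(v := 3 - f x - f y))"
    (is "tree_colouring ?V ?E ?f")
proof -
  note fin = set_two_tree_edges(1)[OF T(1)] and on = set_two_tree_edges(2)[OF T(1)]
  have fE: "finite E" using edges_on_finite[OF on fin] .
  have xy: "x \<in> V" "y \<in> V" "x \<noteq> v" "y \<noteq> v" using edges_onD[OF on T(3)] T(2) by auto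
  have col: "f x < 3" "f y < 3" "f x \<noteq> f y" using f xy T(3) by (auto simp: tree_colouring_def)
  define c where "c = 3 - f x - f y"
  have c: "c < 3" "c \<noteq> f x" "c \<noteq> f y" "\<And>i. i < 3 \<Longrightarrow> i = c \<or> i = f x \<or> i = f y"
    using third_colour[OF col] by (auto simp: c_def)
  have fv: "?f v = c" "?f x = f x" "?f y = f y" using xy by (auto simp: c_def)
  have same: "?f w = f w" if "w \<in> V" for w using that T(2) by auto
  have eV: "e \<subseteq> V" "v \<notin> e" if "e \<in> E" for e using that on T(2) by (auto simp: edges_on_def)
  have img: "?f ` e = f ` e" if "e \<in> E" for e using same eV[OF that] by (intro image_cong) auto
  have new: "{v, x} \<notin> E" "{v, y} \<notin> E" "{v, x} \<noteq> {v, y}" using eV T(4) by (auto simp: doubleton_eq_iff)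
  show ?thesis
    unfolding tree_colouring_def
  proof (intro conjI allI impI ballI)
    show "?f w < 3" if "w \<in> ?V" for w using that f c fv same by (auto simp: tree_colouring_def)
    show "?f a \<noteq> ?f b" if ab: "{a, b} \<in> ?E" for a b
    proof (cases "{a, b} \<in> E")
      case True
      then have "a \<in> V" "b \<in> V" "f a \<noteq> f b" using f edges_onD[OF on True] by (auto simp: tree_colouring_def)
      then show ?thesis using same by metis
    next
      case False
      then show ?thesis using ab c fv by (auto simp: doubleton_eq_iff)
    qed
    show "\<exists>w\<in>nb ?E u. ?f w = i" if u: "u \<in> ?V" "i < 3" "i \<noteq> ?f u" for u i
    proof (cases "u = v")
      case True
      have "x \<in> nb ?E v" "y \<in> nb ?E v" by (auto simp: nb_def)
      then show ?thesis using c(4)[OF u(2)] u(3) fv unfolding True by metis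
    next
      case False
      then have uV: "u \<in> V" using u(1) by simp
      then have "i \<noteq> f u" using u(3) same by simp
      then obtain w where w: "w \<in> nb E u" "f w = i"
        using uV u(2) f unfolding tree_colouring_def by blast
      then have "w \<in> V" using nb_subset[OF on] by blast
      then have "?f w = i" using same w by simp
      moreover have "w \<in> nb ?E u" using w by (simp add: nb_def)
      ultimately show ?thesis by blast
    qed
    show "card {e \<in> ?E. i \<notin> ?f ` e} + 1 = card {w \<in> ?V. ?f w \<noteq> i}" if i: "i < 3" for i
    proof -
      let ?G = "{e \<in> E. i \<notin> f ` e}" and ?W = "{w \<in> V. f w \<noteq> i}"
      have IH: "card ?G + 1 = card ?W" using f i by (auto simp: tree_colouring_def)
      have old: "{e \<in> E. i \<notin> ?f ` e} = ?G" "{w \<in> V. ?f w \<noteq> i} = ?W"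
        using img same by (auto simp del: fun_upd_apply)
      have sel: "{e \<in> ?E. R e} = {e \<in> E. R e} \<union> (if R {v, x} then {{v, x}} else {}) \<union> (if R {v, y} then {{v, y}} else {})"
        for R by auto
      have "i \<notin> ?f ` {v, x} \<longleftrightarrow> i \<noteq> c \<and> i \<noteq> f x" "i \<notin> ?f ` {v, y} \<longleftrightarrow> i \<noteq> c \<and> i \<noteq> f y"
        unfolding image_insert fv by auto
      then have E': "{e \<in> ?E. i \<notin> ?f ` e} = ?G \<union> (if i \<noteq> c \<and> i \<noteq> f x then {{v, x}} else {})
          \<union> (if i \<noteq> c \<and> i \<noteq> f y then {{v, y}} else {})"
        using sel[of "\<lambda>e. i \<notin> ?f ` e"] unfolding old(1) by (simp only:)
      have "{w \<in> ?V. ?f w \<noteq> i} = {w \<in> V. ?f w \<noteq> i} \<union> (if ?f v \<noteq> i then {v} else {})" by auto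
      then have W': "{w \<in> ?V. ?f w \<noteq> i} = ?W \<union> (if i \<noteq> c then {v} else {})"
        unfolding old(2) fv by (simp only: eq_commute[of i])
      have fG: "finite ?G" "finite ?W" "{v, x} \<notin> ?G" "{v, y} \<notin> ?G" "v \<notin> ?W" using fE fin new T(2) by auto
      show ?thesis unfolding E' W' using c(2,3) c(4)[OF i] IH fG col(3) new(3) by (elim disjE) simp_all
    qed
    show "card {e \<in> ?E. e \<subseteq> X} < card X" if X: "X \<subseteq> ?V" "X \<noteq> {}" "\<exists>i<3. i \<notin> ?f ` X" for X
    proof -
      have IH: "card {e \<in> E. e \<subseteq> Z} < card Z" if "Z \<subseteq> V" "Z \<noteq> {}" "\<exists>i<3. i \<notin> f ` Z" for Z
        using f that unfolding tree_colouring_def by blast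
      let ?Z = "X - {v}"
      have Z: "?Z \<subseteq> V" using X(1) by auto
      have fX: "finite X" using X(1) fin finite_subset by blast
      have EZ: "{e \<in> E. e \<subseteq> X} = {e \<in> E. e \<subseteq> ?Z}" using eV by auto
      have iZ: "\<exists>i<3. i \<notin> f ` ?Z"
      proof -
        have "f ` ?Z = ?f ` ?Z" using same Z by (intro image_cong) (auto simp del: fun_upd_apply)
        then show ?thesis using X(3) by auto
      qed
      show ?thesis
      proof (cases "v \<in> X")
        case False
        then have "{e \<in> ?E. e \<subseteq> X} = {e \<in> E. e \<subseteq> ?Z}" "?Z = X" using EZ by auto
        then show ?thesis using IH[OF Z _ iZ] X(2) by simp
      next
        case True
        \<comment> \<open>With v, x and y all three colours would occur in X. So v brings at most
          one edge, and none if X = {v}, a case that \<open>e0\<close> treats because sparsity is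
          strict only for nonempty sets.\<close>
        have "\<not> (x \<in> X \<and> y \<in> X)"
        proof
          assume "x \<in> X \<and> y \<in> X"
          then have "{c, f x, f y} \<subseteq> ?f ` X" using True fv by (metis empty_subsetI image_eqI insert_subset)
          then show False using X(3) c(4) by blast
        qed
        then have "{e \<in> ?E. e \<subseteq> X} \<subseteq> insert (if x \<in> X then {v, x} else {v, y}) {e \<in> E. e \<subseteq> ?Z}"
          using EZ by auto
        moreover have e0: "?Z = {} \<longrightarrow> {e \<in> ?E. e \<subseteq> X} = {}"
        proof
          assume e: "?Z = {}"
          then have "x \<notin> X" "y \<notin> X" using xy by auto
          moreover have "\<not> h \<subseteq> X" if "h \<in> E" for h
            using that eV[OF that] e on by (fastforce simp: edges_on_def card_2_iff)
          ultimately show "{e \<in> ?E. e \<subseteq> X} = {}" by auto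
        qed
        moreover have fG: "finite {e \<in> E. e \<subseteq> ?Z}" using fE by simp
        ultimately have "card {e \<in> ?E. e \<subseteq> X} \<le> card (insert (if x \<in> X then {v, x} else {v, y}) {e \<in> E. e \<subseteq> ?Z})"
          by (intro card_mono) simp_all
        moreover have "\<dots> \<le> Suc (card {e \<in> E. e \<subseteq> ?Z})"
          using fG by (simp add: card_insert_if)
        ultimately have "card {e \<in> ?E. e \<subseteq> X} \<le> Suc (card {e \<in> E. e \<subseteq> ?Z})" by linarith
        moreover have "card X = Suc (card ?Z)" using card_Suc_Diff1[OF fX True] by simp
        ultimately show ?thesis using IH[OF Z _ iZ] e0 by (cases "?Z = {}") (simp_all only: card.empty not_False_eq_True simp_thms, linarith+)
      qed
    qed
  qed
qed

lemma set_two_tree_colouring: "set_two_tree V E \<Longrightarrow> \<exists>f. tree_colouring V E f"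
proof (induction rule: set_two_tree.induct)
  case (triangle a b c)
  then show ?case by (intro exI, rule triangle_colouring)
next
  case (extend V E v x y)
  then obtain f where "tree_colouring V E f" by blast
  then show ?case by (intro exI, rule extend_colouring[OF extend.hyps])
qed

section \<open>Embedding 2-trees\<close>

definition copy_in :: "nat \<Rightarrow> nat set set \<Rightarrow> 'a set \<Rightarrow> 'a set set \<Rightarrow> bool" where
  "copy_in n E V T \<longleftrightarrow>
    (\<exists>\<phi>. inj_on \<phi> V \<and> \<phi> ` V \<subseteq> {..<n} \<and> (\<forall>a b. {a, b} \<in> T \<longrightarrow> {\<phi> a, \<phi> b} \<in> E))"

lemma copy_in_clique:
  assumes "has_clique n k E" "finite V" "card V = k" "edges_on V T"
  shows "copy_in n E V T"
proof -
  obtain Q where Q: "Q \<subseteq> {..<n}" "card Q = k" "clique E Q"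
    using assms(1) by (auto simp: has_clique_def)
  have "finite Q" using Q(1) finite_subset by blast
  then obtain \<phi> where \<phi>: "bij_betw \<phi> V Q"
    using finite_same_card_bij[OF assms(2)] Q(2) assms(3) by blast
  have "{\<phi> a, \<phi> b} \<in> E" if "{a, b} \<in> T" for a b
    using edges_onD[OF assms(4) that] \<phi> Q(3) unfolding clique_def bij_betw_def inj_on_def by blast
  then show ?thesis using \<phi> Q(1) unfolding copy_in_def bij_betw_def by blast
qed

lemma inj_extend:
  assumes "inj_on \<psi> W" "\<psi> ` W \<inter> M = {}" "finite X" "finite M" "card X \<le> card M" "X \<inter> W = {}"
  shows "\<exists>\<psi>'. inj_on \<psi>' (W \<union> X) \<and> (\<forall>w\<in>W. \<psi>' w = \<psi> w) \<and> (\<forall>x\<in>X. \<psi>' x \<in> M)"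
proof -
  obtain f where f: "f ` X \<subseteq> M" "inj_on f X" using card_le_inj[OF assms(3-5)] by blast
  show ?thesis
  proof (intro exI[of _ "\<lambda>x. if x \<in> X then f x else \<psi> x"] conjI)
    have ne: "f x \<noteq> \<psi> w" if "x \<in> X" "w \<in> W" for x w
      using that f(1) assms(2) by (metis IntI empty_iff image_subset_iff imageI)
    show "inj_on (\<lambda>x. if x \<in> X then f x else \<psi> x) (W \<union> X)"
    proof (rule inj_onI)
      fix a b
      assume ab: "a \<in> W \<union> X" "b \<in> W \<union> X" "(if a \<in> X then f a else \<psi> a) = (if b \<in> X then f b else \<psi> b)"
      show "a = b"
      proof (cases "a \<in> X"; cases "b \<in> X")
        assume "a \<in> X" "b \<in> X" then show ?thesis using ab(3) inj_onD[OF f(2), of a b] by simp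
      next
        assume "a \<in> X" "b \<notin> X" then show ?thesis using ab ne[of a b] by simp
      next
        assume "a \<notin> X" "b \<in> X" then show ?thesis using ab ne[of b a] by simp
      next
        assume "a \<notin> X" "b \<notin> X" then show ?thesis using ab inj_onD[OF assms(1), of a b] by simp
      qed
    qed
  qed (use assms(6) f(1) in auto)
qed

text \<open>Vertices outside \<open>V1\<close> and \<open>W\<close> have neighbours only in
  \<open>V1\<close>, whose image lies in P; they can be put on any vertices still free, in S or in
  what is left of P.\<close>

lemma copy_in_join:
  assumes V: "finite V" "edges_on V T" "V1 \<subseteq> V" "W \<subseteq> V" "V1 \<inter> W = {}"
    and E: "pairs P \<union> joins P S \<subseteq> E" "finite P" "finite S" "P \<inter> S = {}" "P \<union> S \<subseteq> {..<n}"
    and c: "card V1 \<le> card P" "card V \<le> card P + card S"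
    and \<psi>: "inj_on \<psi> W" "\<psi> ` W \<subseteq> S" "\<And>a b. a \<in> W \<Longrightarrow> b \<in> W \<Longrightarrow> {a, b} \<in> T \<Longrightarrow> {\<psi> a, \<psi> b} \<in> E"
    and R: "\<And>a. a \<in> V \<Longrightarrow> a \<notin> V1 \<Longrightarrow> a \<notin> W \<Longrightarrow> nb T a \<subseteq> V1"
  shows "copy_in n E V T"
proof -
  have fin: "finite V1" "finite W" using V finite_subset by blast+
  have "\<psi> ` W \<inter> P = {}" using \<psi>(2) E(4) by blast
  from inj_extend[OF \<psi>(1) this fin(1) E(2) c(1) V(5)]
  obtain \<chi> where \<chi>: "inj_on \<chi> (W \<union> V1)" "\<And>w. w \<in> W \<Longrightarrow> \<chi> w = \<psi> w" "\<And>x. x \<in> V1 \<Longrightarrow> \<chi> x \<in> P"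
    by blast
  let ?R = "V - (W \<union> V1)" and ?M = "P \<union> S - \<chi> ` (W \<union> V1)"
  have img: "\<chi> ` (W \<union> V1) \<subseteq> P \<union> S" using \<chi>(2,3) \<psi>(2) by auto
  have "card ?M = card (P \<union> S) - card (W \<union> V1)"
    using img fin card_image[OF \<chi>(1)] by (simp add: card_Diff_subset)
  also have "card (P \<union> S) = card P + card S" using E by (simp add: card_Un_disjoint)
  finally have "card ?R \<le> card ?M" using V fin c(2) by (simp add: card_Diff_subset)
  moreover have "\<chi> ` (W \<union> V1) \<inter> ?M = {}" "finite ?R" "finite ?M" "?R \<inter> (W \<union> V1) = {}" using E V(1) by auto
  ultimately have "\<exists>\<psi>'. inj_on \<psi>' (W \<union> V1 \<union> ?R) \<and> (\<forall>w\<in>W \<union> V1. \<psi>' w = \<chi> w) \<and> (\<forall>x\<in>?R. \<psi>' x \<in> ?M)"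
    by (intro inj_extend[OF \<chi>(1)])
  then obtain \<phi> where \<phi>: "inj_on \<phi> (W \<union> V1 \<union> ?R)" "\<And>w. w \<in> W \<union> V1 \<Longrightarrow> \<phi> w = \<chi> w" "\<And>x. x \<in> ?R \<Longrightarrow> \<phi> x \<in> ?M"
    by blast
  have VR: "W \<union> V1 \<union> ?R = V" using V by blast
  have inP: "\<phi> x \<in> P" if "x \<in> V1" for x using \<phi>(2) \<chi>(3) that by simp
  have inS: "\<phi> x = \<psi> x" if "x \<in> W" for x using \<phi>(2) \<chi>(2) that by simp
  have all: "\<phi> x \<in> P \<union> S" if "x \<in> V" for x
    using that inP inS \<psi>(2) \<phi>(3)[of x] by blast
  have one: "{\<phi> a, \<phi> b} \<in> E" if ab: "{a, b} \<in> T" "a \<in> V1" for a b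
  proof -
    have "a \<noteq> b" "b \<in> V" "a \<in> V" using edges_onD[OF V(2) ab(1)] by auto
    then have "\<phi> a \<noteq> \<phi> b" using \<phi>(1) unfolding VR inj_on_def by blast
    then have "{\<phi> a, \<phi> b} \<in> pairs P \<union> joins P S"
      using inP[OF ab(2)] all[OF \<open>b \<in> V\<close>] unfolding Un_iff pairs_iff joins_iff by blast
    then show ?thesis using E(1) by blast
  qed
  have "{\<phi> a, \<phi> b} \<in> E" if ab: "{a, b} \<in> T" for a b
  proof (cases "a \<in> V1 \<or> b \<in> V1")
    case True
    then show ?thesis using one[of a b] one[of b a] ab by (auto simp: insert_commute)
  next
    case False
    have V': "a \<in> V" "b \<in> V" using edges_onD[OF V(2) ab] by auto
    have "b \<in> nb T a" "a \<in> nb T b" using ab by (auto simp: nb_def insert_commute)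
    then have "a \<in> W" "b \<in> W" using R[of a] R[of b] False V' by blast+
    then show ?thesis using \<psi>(3)[OF _ _ ab] inS by simp
  qed
  moreover have "\<phi> ` V \<subseteq> {..<n}" using all E(5) by blast
  ultimately show ?thesis using \<phi>(1) unfolding copy_in_def VR by blast
qed

text \<open>A greedy choice of minima; summing the inequalities between chosen and remaining
  elements shows that the chosen values do not exceed the average.\<close>

lemma lowest_subset:
  fixes f :: "'a \<Rightarrow> nat"
  assumes "finite A" "t \<le> card A"
  shows "\<exists>S\<subseteq>A. card S = t \<and> (\<forall>x\<in>S. \<forall>y\<in>A - S. f x \<le> f y) \<and> card A * sum f S \<le> t * sum f A"
proof -
  have "\<exists>S\<subseteq>A. card S = t \<and> (\<forall>x\<in>S. \<forall>y\<in>A - S. f x \<le> f y)"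
    using assms(2)
  proof (induction t)
    case (Suc t)
    then obtain S where S: "S \<subseteq> A" "card S = t" "\<forall>x\<in>S. \<forall>y\<in>A - S. f x \<le> f y" by auto
    have fS: "finite S" using S(1) assms(1) finite_subset by blast
    have "A - S \<noteq> {}" using Suc.prems S card_mono[OF fS, of A] by auto
    then obtain z where z: "z \<in> A - S" "\<And>y. y \<in> A - S \<Longrightarrow> f z \<le> f y"
      using arg_min_if_finite(1)[of "A - S" f] arg_min_least[of "A - S" _ f] assms(1) that by blast
    have "card (insert z S) = Suc t" using S z fS by simp
    moreover have "\<forall>x\<in>insert z S. \<forall>y\<in>A - insert z S. f x \<le> f y" using S z by auto
    ultimately show ?case using S z by (intro exI[of _ "insert z S"]) auto
  qed (auto intro: exI[of _ "{}"])
  then obtain S where S: "S \<subseteq> A" "card S = t" "\<forall>x\<in>S. \<forall>y\<in>A - S. f x \<le> f y" by blast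
  have fS: "finite S" using S(1) assms(1) finite_subset by blast
  have "card (A - S) * sum f S = (\<Sum>x\<in>S. \<Sum>y\<in>A - S. f x)" by (simp add: sum_distrib_left)
  also have "\<dots> \<le> (\<Sum>x\<in>S. \<Sum>y\<in>A - S. f y)" using S(3) by (intro sum_mono) blast
  also have "\<dots> = t * sum f (A - S)" using S(2) by simp
  finally have "card (A - S) * sum f S + t * sum f S \<le> t * (sum f (A - S) + sum f S)" by (simp add: algebra_simps)
  moreover have "sum f (A - S) + sum f S = sum f A" using S(1) assms(1) by (simp add: sum.subset_diff[symmetric])
  moreover have "card (A - S) + t = card A" using S fS assms by (simp add: card_Diff_subset card_mono)
  ultimately have "card A * sum f S \<le> t * sum f A" by (metis add_mult_distrib)
  then show ?thesis using S by blast
qed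

section \<open>The tree induced by the two largest colour classes\<close>

locale colour_classes =
  fixes V :: "'a set" and T :: "'a set set" and A B C :: "'a set"
  assumes V: "finite V" "V = A \<union> B \<union> C" "A \<inter> B = {}" "A \<inter> C = {}" "B \<inter> C = {}"
    and on: "edges_on V T"
    and indep: "\<And>a. a \<in> A \<Longrightarrow> nb T a \<inter> A = {}" "\<And>b. b \<in> B \<Longrightarrow> nb T b \<inter> B = {}"
    and pos: "\<And>a. a \<in> A \<Longrightarrow> nb T a \<inter> B \<noteq> {}" "\<And>b. b \<in> B \<Longrightarrow> nb T b \<inter> A \<noteq> {}"
    and total: "(\<Sum>b\<in>B. card (nb T b \<inter> A)) + 1 = card A + card B"
    and sparse: "\<And>X Y. X \<subseteq> A \<Longrightarrow> Y \<subseteq> B \<Longrightarrow> X \<union> Y \<noteq> {} \<Longrightarrow> (\<Sum>y\<in>Y. card (nb T y \<inter> X)) < card X + card Y"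
    and order: "card C \<le> card B" "card B \<le> card A"

lemma sum_card_nb_Int:
  assumes "finite X" "finite Y"
  shows "(\<Sum>y\<in>Y. card (nb T y \<inter> X)) = (\<Sum>x\<in>X. card (nb T x \<inter> Y))"
proof -
  have card: "card (nb T y \<inter> X) = (\<Sum>x\<in>X. of_bool (x \<in> nb T y))" if "finite X" for y X
    using that by (simp add: of_bool_def sum.If_cases Int_commute Collect_mem_eq)
  have "(\<Sum>y\<in>Y. card (nb T y \<inter> X)) = (\<Sum>y\<in>Y. \<Sum>x\<in>X. of_bool (x \<in> nb T y))"
    by (simp only: card[OF assms(1)])
  also have "\<dots> = (\<Sum>x\<in>X. \<Sum>y\<in>Y. of_bool (x \<in> nb T y))" by (rule sum.swap)
  also have "\<dots> = (\<Sum>x\<in>X. \<Sum>y\<in>Y. of_bool (y \<in> nb T x))"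
    using nb_sym[of _ T] by (intro sum.cong refl arg_cong[where f = of_bool]) blast
  also have "\<dots> = (\<Sum>x\<in>X. card (nb T x \<inter> Y))" by (simp only: card[OF assms(2)])
  finally show ?thesis .
qed

lemma obtain_sorted3:
  fixes c :: "nat \<Rightarrow> nat"
  obtains i j l where "i < 3" "j < 3" "l < 3" "i \<noteq> j" "i \<noteq> l" "j \<noteq> l" "c l \<le> c j" "c j \<le> c i"
proof -
  consider "c 0 \<le> c 1 \<and> c 1 \<le> c 2" | "c 0 \<le> c 2 \<and> c 2 \<le> c 1" | "c 1 \<le> c 0 \<and> c 0 \<le> c 2"
    | "c 1 \<le> c 2 \<and> c 2 \<le> c 0" | "c 2 \<le> c 0 \<and> c 0 \<le> c 1" | "c 2 \<le> c 1 \<and> c 1 \<le> c 0"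
    by linarith
  then show thesis
  proof cases
    case 1 then show thesis using that[of 2 1 0] by simp
  next
    case 2 then show thesis using that[of 1 2 0] by simp
  next
    case 3 then show thesis using that[of 2 0 1] by simp
  next
    case 4 then show thesis using that[of 0 2 1] by simp
  next
    case 5 then show thesis using that[of 1 0 2] by simp
  next
    case 6 then show thesis using that[of 0 1 2] by simp
  qed
qed

lemma obtain_colour_classes:
  assumes "set_two_tree V T"
  obtains A B C where "colour_classes V T A B C"
proof -
  note fin = set_two_tree_edges(1)[OF assms] and on = set_two_tree_edges(2)[OF assms]
  obtain f where f: "tree_colouring V T f" using set_two_tree_colouring[OF assms] by blast
  have col: "\<And>v. v \<in> V \<Longrightarrow> f v < 3" "\<And>a b. {a, b} \<in> T \<Longrightarrow> f a \<noteq> f b"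
    and near: "\<And>v i. v \<in> V \<Longrightarrow> i < 3 \<Longrightarrow> i \<noteq> f v \<Longrightarrow> \<exists>w\<in>nb T v. f w = i"
    and tree: "\<And>i. i < 3 \<Longrightarrow> card {e \<in> T. i \<notin> f ` e} + 1 = card {v \<in> V. f v \<noteq> i}"
    and forest: "\<And>X. X \<subseteq> V \<Longrightarrow> X \<noteq> {} \<Longrightarrow> \<exists>i<3. i \<notin> f ` X \<Longrightarrow> card {e \<in> T. e \<subseteq> X} < card X"
  proof -
    note f = f[unfolded tree_colouring_def]
    note all = f[THEN conjunct1] f[THEN conjunct2, THEN conjunct1] f[THEN conjunct2, THEN conjunct2, THEN conjunct1]
      f[THEN conjunct2, THEN conjunct2, THEN conjunct2, THEN conjunct1]
      f[THEN conjunct2, THEN conjunct2, THEN conjunct2, THEN conjunct2]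
    show "\<And>v. v \<in> V \<Longrightarrow> f v < 3" using all(1) by (rule bspec)
    show "\<And>a b. {a, b} \<in> T \<Longrightarrow> f a \<noteq> f b" using all(2) by simp
    show "\<And>v i. v \<in> V \<Longrightarrow> i < 3 \<Longrightarrow> i \<noteq> f v \<Longrightarrow> \<exists>w\<in>nb T v. f w = i" using all(3) by simp
    show "\<And>i. i < 3 \<Longrightarrow> card {e \<in> T. i \<notin> f ` e} + 1 = card {v \<in> V. f v \<noteq> i}" using all(4) by simp
    show "\<And>X. X \<subseteq> V \<Longrightarrow> X \<noteq> {} \<Longrightarrow> \<exists>i<3. i \<notin> f ` X \<Longrightarrow> card {e \<in> T. e \<subseteq> X} < card X"
      using all(5) by blast
  qed
  obtain i j l where ijl: "i < 3" "j < 3" "l < 3" "i \<noteq> j" "i \<noteq> l" "j \<noteq> l"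
    and le: "card {v \<in> V. f v = l} \<le> card {v \<in> V. f v = j}" "card {v \<in> V. f v = j} \<le> card {v \<in> V. f v = i}"
    using obtain_sorted3[of "\<lambda>i. card {v \<in> V. f v = i}"] by blast
  define A B C where "A = {v \<in> V. f v = i}" and "B = {v \<in> V. f v = j}" and "C = {v \<in> V. f v = l}"
  have all: "x = i \<or> x = j \<or> x = l" if "x < 3" for x using that ijl by linarith
  have nbf: "f a \<noteq> f w" if "w \<in> nb T a" for a w using col(2) that by (simp add: nb_iff)
  have indep: "nb T a \<inter> A = {}" if "a \<in> A" for a using that nbf by (fastforce simp: A_def)
  have indep': "nb T b \<inter> B = {}" if "b \<in> B" for b using that nbf by (fastforce simp: B_def)
  \<comment> \<open>Both classes are independent, so every edge inside \<open>X \<union> Y\<close>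
    has exactly one end in Y. This translates edge counts of the tree into degree sums.\<close>
  have count: "(\<Sum>y\<in>Y. card (nb T y \<inter> X)) = card {e \<in> T. e \<subseteq> X \<union> Y}" if XY: "X \<subseteq> A" "Y \<subseteq> B" for X Y
  proof -
    let ?G = "{e \<in> T. e \<subseteq> X \<union> Y}"
    have onG: "edges_on V ?G" by (rule edges_on_subset[OF on]) simp
    have fG: "finite ?G" using edges_on_finite[OF onG fin] .
    have "Y \<subseteq> V" using XY(2) by (auto simp: B_def)
    then have fY: "finite Y" using fin by (rule finite_subset)
    have disj: "X \<inter> Y = {}" using XY ijl by (auto simp: A_def B_def)
    have "(\<Sum>y\<in>Y. card (nb T y \<inter> X)) = (\<Sum>y\<in>Y. card {e \<in> ?G. y \<in> e})"
    proof (rule sum.cong[OF refl])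
      fix y assume y: "y \<in> Y"
      have "nb ?G y = nb T y \<inter> X" using y indep'[of y] XY by (auto simp: nb_def)
      then show "card (nb T y \<inter> X) = card {e \<in> ?G. y \<in> e}" using card_nb[OF onG, of y] by simp
    qed
    also have "\<dots> = (\<Sum>y\<in>Y. \<Sum>e\<in>?G. of_bool (y \<in> e))" by (simp only: card_edges_at[OF fG])
    also have "\<dots> = (\<Sum>e\<in>?G. \<Sum>y\<in>Y. of_bool (y \<in> e))" by (rule sum.swap)
    also have "\<dots> = (\<Sum>e\<in>?G. 1)"
    proof (rule sum.cong[OF refl])
      fix e assume e: "e \<in> ?G"
      obtain a b where ab: "e = {a, b}" "a \<noteq> b" using edges_on_obtain[OF onG e] .
      have "f a \<noteq> f b" using e ab col(2) by blast
      moreover have "{a, b} \<subseteq> X \<union> Y" using e ab by blast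
      ultimately have "a \<in> X \<and> b \<in> Y \<or> b \<in> X \<and> a \<in> Y" using XY by (auto simp: A_def B_def)
      then have "Y \<inter> e = {if a \<in> Y then a else b}" using ab disj by auto
      moreover have "(\<Sum>y\<in>Y. of_bool (y \<in> e)) = card (Y \<inter> e)"
        using fY by (simp add: of_bool_def sum.If_cases Collect_mem_eq)
      ultimately show "(\<Sum>y\<in>Y. of_bool (y \<in> e)) = (1::nat)" by simp
    qed
    finally show ?thesis by simp
  qed
  have "colour_classes V T A B C"
  proof
    show "finite V" "edges_on V T" by (rule fin on)+
    show "V = A \<union> B \<union> C" using col(1) all by (auto simp: A_def B_def C_def)
    show "A \<inter> B = {}" "A \<inter> C = {}" "B \<inter> C = {}" using ijl by (auto simp: A_def B_def C_def)
    show "card C \<le> card B" "card B \<le> card A" using le by (simp_all add: A_def B_def C_def)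
    show "nb T a \<inter> B \<noteq> {}" if "a \<in> A" for a
      using near[of a j] that ijl nb_subset[OF on, of a] by (auto simp: A_def B_def)
    show "nb T b \<inter> A \<noteq> {}" if "b \<in> B" for b
      using near[of b i] that ijl nb_subset[OF on, of b] by (auto simp: A_def B_def)
    have "{e \<in> T. e \<subseteq> A \<union> B} = {e \<in> T. l \<notin> f ` e}"
    proof -
      have "e \<subseteq> A \<union> B \<longleftrightarrow> l \<notin> f ` e" if "e \<in> T" for e
      proof -
        have "e \<subseteq> V" using on that by (auto simp: edges_on_def)
        then show ?thesis using all col(1) ijl by (auto simp: A_def B_def)
      qed
      then show ?thesis by blast
    qed
    moreover have "{v \<in> V. f v \<noteq> l} = A \<union> B" using all col(1) ijl by (auto simp: A_def B_def)
    moreover have "card (A \<union> B) = card A + card B" using fin ijl by (intro card_Un_disjoint) (auto simp: A_def B_def)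
    ultimately show "(\<Sum>b\<in>B. card (nb T b \<inter> A)) + 1 = card A + card B"
      using tree[OF ijl(3)] count[of A B] by simp
    show "(\<Sum>y\<in>Y. card (nb T y \<inter> X)) < card X + card Y" if XY: "X \<subseteq> A" "Y \<subseteq> B" "X \<union> Y \<noteq> {}" for X Y
    proof -
      have XYV: "l \<notin> f ` (X \<union> Y)" "X \<union> Y \<subseteq> V" using XY ijl by (auto simp: A_def B_def)
      have "card {e \<in> T. e \<subseteq> X \<union> Y} < card (X \<union> Y)"
        by (rule forest[OF XYV(2) XY(3)]) (use XYV(1) ijl(3) in blast)
      then show ?thesis using count[OF XY(1,2)] card_Un_le[of X Y] by simp
    qed
  qed (use indep indep' in auto)
  then show thesis by (rule that)
qed

context colour_classes
begin

lemma finABC: "finite A" "finite B" "finite C"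
  using V by auto

lemma card_V: "card V = card A + card B + card C"
proof -
  have "card (A \<union> B \<union> C) = card (A \<union> B) + card C"
    using finABC V by (intro card_Un_disjoint) auto
  also have "card (A \<union> B) = card A + card B" using finABC V by (intro card_Un_disjoint) auto
  finally show ?thesis using V(2) by simp
qed

definition "reach Y = (\<Union>y\<in>Y. nb T y \<inter> A)"

lemma reach: "finite (reach Y)" "reach Y \<subseteq> A" "Y \<subseteq> B \<Longrightarrow> reach Y \<inter> Y = {}"
  using finite_subset[OF _ finABC(1)] V by (auto simp: reach_def)

lemma card_reach_le: "finite Y \<Longrightarrow> card (reach Y) \<le> (\<Sum>y\<in>Y. card (nb T y \<inter> A))"
  unfolding reach_def by (rule card_UN_le)

text \<open>Moving a set Y of vertices of B out of the part that is placed on P; the vertices of A without a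
  neighbour in Y then have all their neighbours on P.\<close>

lemma copy_in_move:
  assumes Y: "Y \<subseteq> B" "card C + card B \<le> card P + card Y"
    and E: "pairs P \<union> joins P S \<subseteq> E" "finite P" "finite S" "P \<inter> S = {}" "P \<union> S \<subseteq> {..<n}"
    and c: "card V \<le> card P + card S"
    and \<psi>: "inj_on \<psi> (Y \<union> reach Y)" "\<psi> ` (Y \<union> reach Y) \<subseteq> S" "\<And>y a. y \<in> Y \<Longrightarrow> a \<in> nb T y \<inter> A \<Longrightarrow> {\<psi> y, \<psi> a} \<in> E"
  shows "copy_in n E V T"
proof (rule copy_in_join[OF V(1) on _ _ _ E _ c \<psi>(1,2)])
  let ?V1 = "C \<union> (B - Y)"
  have fY: "finite Y" using Y finABC finite_subset by blast
  show "?V1 \<subseteq> V" "Y \<union> reach Y \<subseteq> V" "?V1 \<inter> (Y \<union> reach Y) = {}" using V Y reach(2)[of Y] by auto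
  have "card ?V1 = card C + card (B - Y)" using finABC V by (intro card_Un_disjoint) auto
  also have "card (B - Y) = card B - card Y" using fY Y by (simp add: card_Diff_subset)
  finally show "card ?V1 \<le> card P" using Y card_mono[OF finABC(2) Y(1)] by simp
  show "{\<psi> a, \<psi> b} \<in> E" if ab: "a \<in> Y \<union> reach Y" "b \<in> Y \<union> reach Y" "{a, b} \<in> T" for a b
  proof -
    have nbs: "b \<in> nb T a" "a \<in> nb T b" using ab(3) by (auto simp: nb_def insert_commute)
    have AB: "a \<in> Y \<or> a \<in> A" "b \<in> Y \<or> b \<in> A" using ab reach(2)[of Y] by auto
    show ?thesis
    proof (cases "a \<in> Y")
      case True
      then have "b \<in> A" using AB indep(2)[of a] nbs Y by blast
      then show ?thesis using \<psi>(3)[OF True] nbs by blast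
    next
      case False
      then have "b \<in> Y" using AB indep(1)[of a] nbs by blast
      then have "{\<psi> b, \<psi> a} \<in> E" using \<psi>(3)[of b a] nbs False AB by blast
      then show ?thesis by (simp add: insert_commute)
    qed
  qed
  show "nb T a \<subseteq> ?V1" if a: "a \<in> V" "a \<notin> ?V1" "a \<notin> Y \<union> reach Y" for a
  proof -
    have aA: "a \<in> A" using a V by blast
    have "nb T a \<inter> Y = {}"
    proof (rule ccontr)
      assume "nb T a \<inter> Y \<noteq> {}"
      then obtain y where "y \<in> Y" "y \<in> nb T a" by blast
      then have "a \<in> reach Y" using aA by (auto simp: reach_def nb_def insert_commute)
      then show False using a by blast
    qed
    then show ?thesis using indep(1)[OF aA] nb_subset[OF on, of a] V by blast
  qed
qed

end

section \<open>Embedding into prescribed edges when few degrees are large\<close>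

lemma light_numeric:
  fixes g j e b :: int
  assumes "1 \<le> e" "e \<le> j" "j + 2 \<le> g" "2 * g - 2 - e \<le> 2 * b"
  shows "(j + 1 - e) * (g + e - 1) < (j + e) * b"
\<comment> \<open>In the application e is the excess of the largest class over g and b is the size
  of the second class. The estimate for the other values of e uses e * g \<ge> 2 * g and e * e \<ge>
  2 * e.\<close>
proof (cases "e = 1")
  case True
  then have "(j + 1) * (g - 1) \<le> (j + e) * b" using assms by (intro mult_mono) auto
  then show ?thesis using assms True by (simp add: algebra_simps)
next
  case False
  define q r w x y where "q = e * g" and "r = e * e" and "w = e * j" and "x = j * g" and "y = (j + e) * b"
  have "(j + e) * (2 * g - 2 - e) \<le> (j + e) * (2 * b)" using assms by (intro mult_left_mono) auto
  then have "2 * x + 2 * q - 2 * j - 2 * e - w - r \<le> 2 * y"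
    by (simp add: q_def r_def w_def x_def y_def algebra_simps)
  moreover have "2 * g \<le> q" "2 * e \<le> r"
    unfolding q_def r_def by (rule mult_right_mono; use assms False in simp)+
  moreover have "e * (j + 2) \<le> e * g" using assms by (intro mult_left_mono) auto
  then have "w + 2 * e \<le> q" by (simp add: w_def q_def algebra_simps)
  ultimately have "x + w - j + g + 2 * e - 1 - q - r < y" using assms(1-3) by linarith
  then show ?thesis by (simp add: q_def r_def w_def x_def y_def algebra_simps)
qed

text \<open>The edges prescribed on S when m - 1 - j vertices are placed on P: the degree bounds allow maximum degree
  2 * j, and what is left of a 2-tree outside P has to fit in.\<close>

definition gadget :: "nat \<Rightarrow> nat \<Rightarrow> nat \<Rightarrow> nat set set" where
  "gadget p g j = (if g \<le> j + 1 then pairs {p..<p + 2 * j + 1}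
    else if j = 1 then {{p, p + 1}, {p + 1, p + 2}, {p + 2, p + 3}, {p + 3, p + 4}, {p + 5, p + 6}, {p + 6, p + 7}}
    else joins {p..<p + j + 1} {p + j + 1..<p + 3 * j + 1} \<union>
      (if 2 * j \<le> g then joins {p + 3 * j + 1} {p + 3 * j + 2..<p + 5 * j + 2} else {}))"

lemma gadget_pairs:
  assumes "1 \<le> j" "j + 1 \<le> 2 * g"
  shows "gadget p g j \<subseteq> pairs {p..<p + (2 * g + 2 + j)}"
proof -
  have "pairs {p..<p + 2 * j + 1} \<subseteq> pairs {p..<p + (2 * g + 2 + j)}"
    using assms by (force simp: pairs_def)
  moreover have "e \<in> pairs {p..<p + (2 * g + 2 + j)}"
    if "j = 1" "\<not> g \<le> j + 1" "e \<in> {{p, p + 1}, {p + 1, p + 2}, {p + 2, p + 3}, {p + 3, p + 4}, {p + 5, p + 6}, {p + 6, p + 7}}" for e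
    using that by (elim insertE emptyE) (simp_all add: pairs_iff)
  moreover have "joins {p..<p + j + 1} {p + j + 1..<p + 3 * j + 1} \<subseteq> pairs {p..<p + (2 * g + 2 + j)}" if "\<not> g \<le> j + 1"
  proof
    fix e assume "e \<in> joins {p..<p + j + 1} {p + j + 1..<p + 3 * j + 1}"
    then obtain x y where "e = {x, y}" "x \<in> {p..<p + j + 1}" "y \<in> {p + j + 1..<p + 3 * j + 1}" by (auto simp: joins_def)
    then show "e \<in> pairs {p..<p + (2 * g + 2 + j)}" using that by (simp add: pairs_iff)
  qed
  moreover have "joins {p + 3 * j + 1} {p + 3 * j + 2..<p + 5 * j + 2} \<subseteq> pairs {p..<p + (2 * g + 2 + j)}" if "2 * j \<le> g"
  proof
    fix e assume "e \<in> joins {p + 3 * j + 1} {p + 3 * j + 2..<p + 5 * j + 2}"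
    then obtain x y where "e = {x, y}" "x = p + 3 * j + 1" "y \<in> {p + 3 * j + 2..<p + 5 * j + 2}" by (auto simp: joins_def)
    then show "e \<in> pairs {p..<p + (2 * g + 2 + j)}" using that by (simp add: pairs_iff)
  qed
  ultimately show ?thesis unfolding gadget_def by (auto split: if_splits)
qed

lemma card_nb_pairs:
  assumes "finite Q"
  shows "card (nb (pairs Q) v) \<le> card Q - 1"
proof (cases "v \<in> Q")
  case True
  then have "nb (pairs Q) v = Q - {v}" unfolding set_eq_iff nb_iff pairs_iff by auto
  then show ?thesis using True by simp
next
  case False
  then have "nb (pairs Q) v = {}" by (auto simp: nb_iff pairs_iff)
  then show ?thesis by simp
qed

text \<open>The pieces are a complete graph on 2 * j + 1 vertices, or disjoint paths with five and
  three vertices, or a complete bipartite graph with sides j + 1 and 2 * j, accompanied by a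
  disjoint star with 2 * j leaves when there is room for it.\<close>

lemma card_nb_gadget:
  assumes "1 \<le> j"
  shows "card (nb (gadget p g j) v) \<le> 2 * j"
proof -
  consider "g \<le> j + 1" | "\<not> g \<le> j + 1" "j = 1" | "\<not> g \<le> j + 1" "j \<noteq> 1" by blast
  then show ?thesis
  proof cases
    case 1
    then show ?thesis using card_nb_pairs[of "{p..<p + 2 * j + 1}" v] by (simp add: gadget_def)
  next
    case 2
    let ?F = "gadget p g j"
    have F: "{v, w} \<in> ?F \<longleftrightarrow> {v, w} \<in> {{p, p + 1}, {p + 1, p + 2}, {p + 2, p + 3}, {p + 3, p + 4}, {p + 5, p + 6}, {p + 6, p + 7}}" for w
      using 2 by (simp add: gadget_def)
    have "nb ?F v \<subseteq> {v - 1, v + 1}"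
    proof
      fix w assume "w \<in> nb ?F v"
      then have "w = v + 1 \<or> v = w + 1" unfolding nb_iff F by (auto simp: doubleton_eq_iff)
      then show "w \<in> {v - 1, v + 1}" by auto
    qed
    from card_mono[OF _ this] show ?thesis using 2(2) card_insert_le_m1[of 2 "{v + 1}" "v - 1"] by simp
  next
    case 3
    define L M M' where "L = {p..<p + j + 1}" and "M = {p + j + 1..<p + 3 * j + 1}" and "M' = {p + 3 * j + 2..<p + 5 * j + 2}"
    let ?s = "p + 3 * j + 1"
    have "gadget p g j \<subseteq> joins L M \<union> joins {?s} M'" using 3 by (auto simp: gadget_def L_def M_def M'_def)
    then have sub: "nb (gadget p g j) v \<subseteq> nb (joins L M \<union> joins {?s} M') v" by (auto simp: nb_def)
    have c: "card L = j + 1" "card M = 2 * j" "card M' = 2 * j" by (simp_all add: L_def M_def M'_def)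
    have "\<exists>Q. nb (joins L M \<union> joins {?s} M') v \<subseteq> Q \<and> finite Q \<and> card Q \<le> 2 * j"
    proof -
      consider "v \<in> L" | "v \<in> M" | "v = ?s" | "v \<in> M'" | "v \<notin> L \<union> M \<union> {?s} \<union> M'" by blast
      then show ?thesis
      proof cases
        case 1
        then have "nb (joins L M \<union> joins {?s} M') v \<subseteq> M" by (auto simp: nb_iff joins_iff L_def M_def M'_def)
        then show ?thesis using c by (intro exI[of _ M]) (simp add: M_def)
      next
        case 2
        then have "nb (joins L M \<union> joins {?s} M') v \<subseteq> L" by (auto simp: nb_iff joins_iff L_def M_def M'_def)
        then show ?thesis using c assms by (intro exI[of _ L]) (simp add: L_def)
      next
        case 3
        then have "nb (joins L M \<union> joins {?s} M') v \<subseteq> M'" by (auto simp: nb_iff joins_iff L_def M_def M'_def)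
        then show ?thesis using c by (intro exI[of _ M']) (simp add: M'_def)
      next
        case 4
        then have "nb (joins L M \<union> joins {?s} M') v \<subseteq> {?s}" by (auto simp: nb_iff joins_iff L_def M_def M'_def)
        then show ?thesis using assms by (intro exI[of _ "{?s}"]) simp
      next
        case 5
        then have "nb (joins L M \<union> joins {?s} M') v \<subseteq> {}" by (auto simp: nb_iff joins_iff)
        then show ?thesis by (intro exI[of _ "{}"]) simp
      qed
    qed
    then show ?thesis using sub by (meson card_mono le_trans subset_trans)
  qed
qed

text \<open>The inequalities cover all residues: 2 * g is m, m + 2 or m + 1 for k mod 3 = 0, 1 or 2.
  They force the largest class to have at least g vertices.\<close>

locale sized_classes = colour_classes V T A B C
  for V :: "'a set" and T A B C +
  fixes k m g :: nat
  assumes size: "card V = k" "k = m + g" "2 \<le> g" "g + 2 \<le> m" "m \<le> 2 * g" "2 * g \<le> m + 2"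
begin

lemma sizes: "card A + card B + card C = m + g" "g \<le> card A" "card B \<le> card A" "card C \<le> card B"
  using card_V size order by auto

lemma deg_pos: "y \<in> B \<Longrightarrow> 1 \<le> card (nb T y \<inter> A)"
proof -
  assume "y \<in> B"
  then have "card (nb T y \<inter> A) \<noteq> 0" using pos(2) finABC(1) by simp
  then show ?thesis by simp
qed

text \<open>If the largest class has g + e vertices with e \<le> j, then j + 1 - e vertices of
  \<open>B\<close> have to leave P. The tree on \<open>A \<union> B\<close> has one edge less than
  vertices, so the lowest degrees are bounded by the average. Only for e = 0 may their sum exceed 2
  * j, and then by at most 2.\<close>

lemma lowest_degrees:
  assumes j: "1 \<le> j" "j + 2 \<le> g"
  shows "\<exists>Y\<subseteq>B. card C + card B + j + 1 \<le> m + card Y \<and>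
    (card Y \<le> j \<and> (\<Sum>y\<in>Y. card (nb T y \<inter> A)) \<le> 2 * j \<or>
     card Y = j + 1 \<and> card A = g \<and> (\<Sum>y\<in>Y. card (nb T y \<inter> A)) \<le> 2 * j + 2 \<and>
      (\<forall>x\<in>Y. \<forall>y\<in>B - Y. card (nb T x \<inter> A) \<le> card (nb T y \<inter> A)))"
proof (cases "g + j + 1 \<le> card A")
  case True
  then show ?thesis using sizes by (intro exI[of _ "{}"]) auto
next
  case False
  let ?d = "\<lambda>y. card (nb T y \<inter> A)"
  define e where "e = card A - g"
  define t where "t = j + 1 - e"
  have e: "card A = g + e" "e \<le> j" "t + e = j + 1" using False sizes(2) by (auto simp: e_def t_def)
  have bc: "card B + card C + e = m" using sizes(1) e(1) by simp
  have tB: "t \<le> card B" using bc sizes e j size by simp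
  obtain Y where Y: "Y \<subseteq> B" "card Y = t" "\<forall>x\<in>Y. \<forall>y\<in>B - Y. ?d x \<le> ?d y"
    "card B * sum ?d Y \<le> t * sum ?d B"
    using lowest_subset[OF finABC(2) tB, of ?d] by blast
  define s where "s = sum ?d Y"
  have total': "sum ?d B + 1 = card A + card B" by (rule total)
  have "int (card B * s) \<le> int (t * sum ?d B)" using Y(4) unfolding s_def by (simp only: of_nat_le_iff)
  moreover have "int (sum ?d B) = int g + int e + int (card B) - 1" using total' e(1) by linarith
  moreover have "int t = int j + 1 - int e" using e(3) by linarith
  ultimately have key: "int (card B) * int s \<le> (int j + 1 - int e) * (int g + int e + int (card B) - 1)"
    by (simp only: of_nat_mult)
  have cY: "card C + card B + j + 1 = m + card Y" using bc e(3) Y(2) by simp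
  show ?thesis
  proof (cases "e = 0")
    case True
    have "s \<le> 2 * j + 2"
    proof (rule ccontr)
      assume "\<not> ?thesis"
      then have "int (card B) * (2 * int j + 3) \<le> int (card B) * int s" by (intro mult_left_mono) auto
      moreover have "int g - 1 \<le> int (card B)" using bc sizes(4) size True by linarith
      then have "(int g - 1) * (int j + 2) \<le> int (card B) * (int j + 2)" by (intro mult_right_mono) auto
      ultimately show False using key True j by (simp add: algebra_simps)
    qed
    then show ?thesis using Y cY e True unfolding s_def by (intro exI[of _ Y]) auto
  next
    case False
    have "s \<le> 2 * j"
    proof (rule ccontr)
      assume "\<not> ?thesis"
      then have "int (card B) * (2 * int j + 1) \<le> int (card B) * int s" by (intro mult_left_mono) auto
      moreover have "(int j + 1 - int e) * (int g + int e - 1) < (int j + int e) * int (card B)"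
        by (rule light_numeric) (use bc sizes(4) size False e j in auto)
      ultimately show False using key by (simp add: algebra_simps)
    qed
    then show ?thesis using Y cY e(3) False unfolding s_def by (intro exI[of _ Y]) auto
  qed
qed

text \<open>Degrees with sum at most 2 * j + 2 and a union of at least 2 * j + 1 elements allow at
  most one coincidence among the neighbourhoods. Without one, y is a vertex of degree at least 2;
  otherwise y is a third vertex, away from the coincidence, which already saves one element in the
  rest.\<close>

lemma split_star:
  assumes Y: "Y \<subseteq> B" "card Y = j + 1" "2 \<le> j" "(\<Sum>y\<in>Y. card (nb T y \<inter> A)) \<le> 2 * j + 2"
    and big: "2 * j + 1 \<le> card (reach Y)"
  obtains y where "y \<in> Y" "card (nb T y \<inter> A) \<le> 2 * j" "card (reach (Y - {y})) \<le> 2 * j"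
    "reach (Y - {y}) \<inter> (nb T y \<inter> A) = {}"
proof -
  let ?N = "\<lambda>y. nb T y \<inter> A"
  let ?d = "\<lambda>y. card (?N y)"
  have fY: "finite Y" using Y(2) by (metis add_is_0 card.infinite zero_neq_one)
  have fN: "finite (?N y)" for y using finABC by simp
  have dpos: "1 \<le> ?d y" if "y \<in> Y" for y using deg_pos that Y(1) by blast
  have sumY: "(\<Sum>y\<in>Y. ?d y) = ?d y + (\<Sum>x\<in>Y - {y}. ?d x)" if "y \<in> Y" for y
    using that fY by (rule sum.remove[rotated])
  have rest: "j \<le> (\<Sum>x\<in>Y - {y}. ?d x)" if "y \<in> Y" for y
  proof -
    have "(\<Sum>x\<in>Y - {y}. 1) \<le> (\<Sum>x\<in>Y - {y}. ?d x)" using dpos by (intro sum_mono) auto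
    then show ?thesis using that Y(2) fY by simp
  qed
  have d2j: "?d y \<le> 2 * j" if "y \<in> Y" for y using sumY[OF that] rest[OF that] Y(3,4) by linarith
  have cut: "card (reach Z) \<le> (\<Sum>y\<in>Z. card (M y))" if "finite Z" "reach Z \<subseteq> (\<Union>y\<in>Z. M y)" "\<And>y. M y \<subseteq> ?N y" for Z M
  proof -
    have "finite (M y)" for y using that(3) fN finite_subset by metis
    then have "card (reach Z) \<le> card (\<Union>y\<in>Z. M y)" using that by (intro card_mono) auto
    then show ?thesis using card_UN_le[OF that(1), of M] by linarith
  qed
  show thesis
  proof (cases "\<exists>y1\<in>Y. \<exists>y2\<in>Y. y1 \<noteq> y2 \<and> ?N y1 \<inter> ?N y2 \<noteq> {}")
    case False
    obtain y where y: "y \<in> Y" "2 \<le> ?d y"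
    proof (rule ccontr)
      assume "\<not> thesis"
      then have "?d y \<le> 1" if "y \<in> Y" for y using that \<open>\<And>y. y \<in> Y \<Longrightarrow> 2 \<le> ?d y \<Longrightarrow> thesis\<close> by force
      then have "(\<Sum>y\<in>Y. ?d y) \<le> (\<Sum>y\<in>Y. 1)" by (intro sum_mono) auto
      then show False using card_reach_le[OF fY] big Y(2,3) by simp
    qed
    show thesis
    proof (rule that[OF y(1) d2j[OF y(1)]])
      show "card (reach (Y - {y})) \<le> 2 * j"
        using card_reach_le[of "Y - {y}"] fY sumY[OF y(1)] y(2) Y(4) by simp
      show "reach (Y - {y}) \<inter> (?N y) = {}" using False y(1) unfolding reach_def by blast
    qed
  next
    case True
    then obtain y1 y2 z where y12: "y1 \<in> Y" "y2 \<in> Y" "y1 \<noteq> y2" "z \<in> ?N y1" "z \<in> ?N y2" by blast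
    have "card {y1, y2} \<le> 2" by (simp add: card_insert_le_m1)
    then have "\<not> Y \<subseteq> {y1, y2}" using card_mono[of "{y1, y2}" Y] Y(2,3) by auto
    then obtain y where y: "y \<in> Y" "y \<noteq> y1" "y \<noteq> y2" by blast
    let ?M = "\<lambda>x. if x = y1 then ?N x - {z} else ?N x"
    have M1: "card (?M y1) + 1 = ?d y1" using y12 fN[of y1] card_Suc_Diff1[of "?N y1" z] by simp
    show thesis
    proof (rule that[OF y(1) d2j[OF y(1)]])
      have "reach (Y - {y}) \<subseteq> (\<Union>x\<in>Y - {y}. ?M x)"
      proof
        fix a assume "a \<in> reach (Y - {y})"
        then obtain x where "x \<in> Y - {y}" "a \<in> ?N x" by (auto simp: reach_def)
        then show "a \<in> (\<Union>x\<in>Y - {y}. ?M x)" using y12 y by (cases "x = y1 \<and> a = z") auto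
      qed
      then have "card (reach (Y - {y})) \<le> (\<Sum>x\<in>Y - {y}. card (?M x))" by (intro cut) (use fY in auto)
      moreover have "(\<Sum>x\<in>Y - {y}. card (?M x)) = card (?M y1) + (\<Sum>x\<in>Y - {y} - {y1}. card (?M x))"
        using fY y12 y by (intro sum.remove) auto
      moreover have "(\<Sum>x\<in>Y - {y}. ?d x) = ?d y1 + (\<Sum>x\<in>Y - {y} - {y1}. ?d x)"
        using fY y12 y by (intro sum.remove) auto
      moreover have "(\<Sum>x\<in>Y - {y} - {y1}. card (?M x)) = (\<Sum>x\<in>Y - {y} - {y1}. ?d x)" by (intro sum.cong) auto
      ultimately have "card (reach (Y - {y})) + 1 \<le> (\<Sum>x\<in>Y - {y}. ?d x)" using M1 by linarith
      then show "card (reach (Y - {y})) \<le> 2 * j" using sumY[OF y(1)] dpos[OF y(1)] Y(4) by linarith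
      show "reach (Y - {y}) \<inter> ?N y = {}"
      proof (rule ccontr)
        assume "reach (Y - {y}) \<inter> ?N y \<noteq> {}"
        then obtain z' y' where z': "y' \<in> Y" "y' \<noteq> y" "z' \<in> ?N y'" "z' \<in> ?N y" by (auto simp: reach_def)
        \<comment> \<open>A second coincidence would allow z and z' each to be dropped from one
          neighbourhood without changing the union, leaving at most 2 * j elements.\<close>
        let ?L = "\<lambda>x. if x = y1 then ?N x - {z} else if x = y then ?N x - {z'} else ?N x"
        have L1: "card (?L y) + 1 = ?d y" using z' y fN[of y] card_Suc_Diff1[of "?N y" z'] by simp
        have "reach Y \<subseteq> (\<Union>x\<in>Y. ?L x)"
        proof
          fix a assume "a \<in> reach Y"
          then obtain x where x: "x \<in> Y" "a \<in> ?N x" by (auto simp: reach_def)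
          consider "a = z" | "a \<noteq> z" "a = z'" | "a \<noteq> z" "a \<noteq> z'" by blast
          then show "a \<in> (\<Union>x\<in>Y. ?L x)"
          proof cases
            case 1 then show ?thesis using y12 y by (intro UN_I[of y2]) auto
          next
            case 2 then show ?thesis using z' by (intro UN_I[of y']) auto
          next
            case 3 then show ?thesis using x by (intro UN_I[of x]) auto
          qed
        qed
        then have "card (reach Y) \<le> (\<Sum>x\<in>Y. card (?L x))" by (intro cut[OF fY]) auto
        moreover have "(\<Sum>x\<in>Y. card (?L x)) = card (?L y) + (\<Sum>x\<in>Y - {y}. card (?L x))"
          using fY y by (intro sum.remove) auto
        moreover have "(\<Sum>x\<in>Y - {y}. card (?L x)) = (\<Sum>x\<in>Y - {y}. card (?M x))" by (intro sum.cong) auto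
        moreover have "(\<Sum>x\<in>Y - {y}. card (?M x)) = card (?M y1) + (\<Sum>x\<in>Y - {y} - {y1}. card (?M x))"
          using fY y12 y by (intro sum.remove) auto
        moreover have "(\<Sum>x\<in>Y - {y}. ?d x) = ?d y1 + (\<Sum>x\<in>Y - {y} - {y1}. ?d x)"
          using fY y12 y by (intro sum.remove) auto
        moreover have "(\<Sum>x\<in>Y - {y} - {y1}. card (?M x)) = (\<Sum>x\<in>Y - {y} - {y1}. ?d x)" by (intro sum.cong) auto
        ultimately have "card (reach Y) + 2 \<le> (\<Sum>x\<in>Y. ?d x)" using M1 L1 sumY[OF y(1)] by linarith
        then show False using Y(4) big by linarith
      qed
    qed
  qed
qed

end

lemma joinsI: "a \<in> A \<Longrightarrow> b \<in> C \<Longrightarrow> a \<noteq> b \<Longrightarrow> {a, b} \<in> joins A C"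
  by (auto simp: joins_def)

context sized_classes
begin

lemma placement_exists:
  assumes "Y \<subseteq> B" "finite L" "finite M" "card Y \<le> card L" "card (reach Y) \<le> card M" "L \<inter> M = {}"
  shows "\<exists>\<psi>. inj_on \<psi> (Y \<union> reach Y) \<and> (\<forall>y\<in>Y. \<psi> y \<in> L) \<and> (\<forall>a\<in>reach Y. \<psi> a \<in> M)"
proof -
  have fY: "finite Y" using finite_subset[OF assms(1) finABC(2)] .
  obtain \<chi> where \<chi>: "\<chi> ` Y \<subseteq> L" "inj_on \<chi> Y" using card_le_inj[OF fY assms(2,4)] by blast
  obtain \<psi> where "inj_on \<psi> (Y \<union> reach Y)" "\<And>y. y \<in> Y \<Longrightarrow> \<psi> y = \<chi> y" "\<And>a. a \<in> reach Y \<Longrightarrow> \<psi> a \<in> M"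
    using inj_extend[OF \<chi>(2) _ reach(1) assms(3,5) reach(3)[OF assms(1)]] \<chi>(1) assms(6) by blast
  then show ?thesis using \<chi>(1) by (intro exI[of _ \<psi>]) auto
qed

lemma reach_singleton: "reach {y} = nb T y \<inter> A"
  by (simp add: reach_def)

text \<open>Two common neighbours would give a cycle of length four: four edges on four vertices,
  contrary to \<open>sparse\<close>.\<close>

lemma shared_neighbour_unique:
  assumes "y1 \<in> B" "y2 \<in> B" "y1 \<noteq> y2" "z \<in> nb T y1 \<inter> A" "z \<in> nb T y2 \<inter> A" "x \<in> nb T y1 \<inter> A" "x \<in> nb T y2 \<inter> A"
  shows "x = z"
proof (rule ccontr)
  assume "x \<noteq> z"
  then have c: "card {x, z} = 2" "card {y1, y2} = 2" using assms(3) by auto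
  have "nb T y1 \<inter> {x, z} = {x, z}" "nb T y2 \<inter> {x, z} = {x, z}" using assms by auto
  then have "(\<Sum>y\<in>{y1, y2}. card (nb T y \<inter> {x, z})) = 4" using assms(3) c by simp
  moreover have "(\<Sum>y\<in>{y1, y2}. card (nb T y \<inter> {x, z})) < card {x, z} + card {y1, y2}"
    by (rule sparse) (use assms in auto)
  ultimately show False using c by simp
qed

context
  fixes n p j :: nat and E
  assumes pj: "p + j + 1 = m" "1 \<le> j" and n: "k + g < n"
    and E: "pairs {..<p} \<union> joins {..<p} {p..<p + (2 * g + 2 + j)} \<union> gadget p g j \<subseteq> E"
begin

lemma target: "pairs {..<p} \<union> joins {..<p} {p..<p + (2 * g + 2 + j)} \<subseteq> E" "gadget p g j \<subseteq> E"
  "finite {..<p}" "finite {p..<p + (2 * g + 2 + j)}" "{..<p} \<inter> {p..<p + (2 * g + 2 + j)} = {}"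
  "{..<p} \<union> {p..<p + (2 * g + 2 + j)} \<subseteq> {..<n}" "card V \<le> card {..<p} + card {p..<p + (2 * g + 2 + j)}"
  using E pj n size by auto

lemma gadget_move:
  assumes Y: "Y \<subseteq> B" "card C + card B + j + 1 \<le> m + card Y"
    and \<psi>: "inj_on \<psi> (Y \<union> reach Y)" "\<And>x. x \<in> Y \<union> reach Y \<Longrightarrow> \<psi> x \<in> {p..<p + (2 * g + 2 + j)}"
      "\<And>y a. y \<in> Y \<Longrightarrow> a \<in> nb T y \<inter> A \<Longrightarrow> {\<psi> y, \<psi> a} \<in> gadget p g j"
  shows "copy_in n E V T"
proof (rule copy_in_move[OF Y(1) _ target(1,3-7) \<psi>(1)])
  show "card C + card B \<le> card {..<p} + card Y" using Y(2) pj by simp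
  show "\<psi> ` (Y \<union> reach Y) \<subseteq> {p..<p + (2 * g + 2 + j)}" using \<psi>(2) by blast
  show "{\<psi> y, \<psi> a} \<in> E" if "y \<in> Y" "a \<in> nb T y \<inter> A" for y a using \<psi>(3)[OF that] target(2) by blast
qed

lemma gadget_large:
  assumes large: "g \<le> j + 1" and v: "v \<in> V" "card (nb T v) = 2"
  shows "copy_in n E V T"
proof -
  have gad: "gadget p g j = pairs {p..<p + 2 * j + 1}" using large by (simp add: gadget_def)
  \<comment> \<open>If p \<ge> 2, the neighbours of the degree-two vertex v are put into
    \<open>V1\<close>, so v needs no place in the complete graph; the remaining k - p - 1 = j + g
    vertices fit because g \<le> j + 1. If p \<le> 1, then g + 2 \<le> m already gives g \<le> j and
    all k - p vertices fit.\<close>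
  obtain V1 R where V1: "V1 \<subseteq> V" "card V1 = p" "R \<subseteq> V - V1" "p + card R + 2 * j + 1 \<ge> k" "\<And>a. a \<in> R \<Longrightarrow> nb T a \<subseteq> V1"
  proof (cases "2 \<le> p")
    case True
    have "nb T v \<subseteq> V - {v}" using nb_subset[OF on, of v] nb_irrefl[OF on, of v] by blast
    moreover have "p \<le> card (V - {v})" using V(1) v(1) size pj by simp
    ultimately obtain V1 where V1: "nb T v \<subseteq> V1" "V1 \<subseteq> V - {v}" "card V1 = p"
      using exists_subset_between[of "nb T v" p "V - {v}"] V(1) v True by auto
    then show thesis using that[of V1 "{v}"] v pj size large by auto
  next
    case False
    obtain V1 where "V1 \<subseteq> V" "card V1 = p"
      using obtain_subset_with_card_n[of p V] size pj by auto
    then show thesis using that[of V1 "{}"] False pj size by auto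
  qed
  have fin: "finite V1" "finite R" using V1(1,3) V(1) finite_subset by blast+
  define W where "W = V - V1 - R"
  have fW: "finite W" using V(1) by (simp add: W_def)
  have "card W = card (V - V1) - card R" unfolding W_def using fin V1(3) by (intro card_Diff_subset) auto
  also have "card (V - V1) = k - p" using fin V1(1,2) size(1) by (simp add: card_Diff_subset)
  finally have "card W \<le> card {p..<p + 2 * j + 1}" using V1(4) by simp
  then obtain \<psi> where \<psi>: "\<psi> ` W \<subseteq> {p..<p + 2 * j + 1}" "inj_on \<psi> W" using card_le_inj[OF fW] by blast
  have jg: "j \<le> 2 * g" using pj size by simp
  show ?thesis
  proof (rule copy_in_join[OF V(1) on V1(1) _ _ target(1,3-6) _ target(7) \<psi>(2)])
    show "W \<subseteq> V" "V1 \<inter> W = {}" by (auto simp: W_def)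
    show "card V1 \<le> card {..<p}" using V1(2) by simp
    show "\<psi> ` W \<subseteq> {p..<p + (2 * g + 2 + j)}" using \<psi>(1) jg by fastforce
    show "{\<psi> a, \<psi> b} \<in> E" if ab: "a \<in> W" "b \<in> W" "{a, b} \<in> T" for a b
    proof -
      have "\<psi> a \<noteq> \<psi> b" using inj_onD[OF \<psi>(2) _ ab(1,2)] edges_onD(1)[OF on ab(3)] by blast
      then have "{\<psi> a, \<psi> b} \<in> gadget p g j" unfolding gad pairs_iff using \<psi>(1) ab by blast
      then show ?thesis using target(2) by blast
    qed
    show "nb T a \<subseteq> V1" if "a \<in> V" "a \<notin> V1" "a \<notin> W" for a using that V1(5) by (auto simp: W_def)
  qed
qed

text \<open>Usually the moved vertices go to the side \<open>L\<close> and their neighbours to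
  \<open>M\<close> of the complete bipartite graph. If there are too many neighbours, one moved
  vertex and its neighbours are split off onto the star with centre \<open>s\<close>.\<close>

lemma gadget_mid:
  assumes j: "2 \<le> j" "j + 2 \<le> g"
  shows "copy_in n E V T"
proof -
  define L M M' s where "L = {p..<p + j + 1}" and "M = {p + j + 1..<p + 3 * j + 1}"
    and "M' = {p + 3 * j + 2..<p + 5 * j + 2}" and "s = p + 3 * j + 1"
  have gad: "joins L M \<subseteq> gadget p g j" "2 * j \<le> g \<Longrightarrow> joins {s} M' \<subseteq> gadget p g j"
    using j by (auto simp: gadget_def L_def M_def M'_def s_def)
  have c: "card L = j + 1" "card M = 2 * j" "card M' = 2 * j" "finite L" "finite M" "finite M'" "L \<inter> M = {}"
    "s \<notin> L" "s \<notin> M" "s \<notin> M'" "L \<inter> M' = {}" "M \<inter> M' = {}"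
    by (auto simp: L_def M_def M'_def s_def)
  have inS: "L \<union> M \<subseteq> {p..<p + (2 * g + 2 + j)}" "2 * j \<le> g \<Longrightarrow> insert s M' \<subseteq> {p..<p + (2 * g + 2 + j)}"
    using j by (auto simp: L_def M_def M'_def s_def)
  let ?d = "\<lambda>y. card (nb T y \<inter> A)"
  obtain Y where Y: "Y \<subseteq> B" "card C + card B + j + 1 \<le> m + card Y"
    and alt: "card Y \<le> j \<and> sum ?d Y \<le> 2 * j \<or> card Y = j + 1 \<and> card A = g \<and> sum ?d Y \<le> 2 * j + 2"
    using lowest_degrees[OF pj(2) j(2)] by blast
  have fY: "finite Y" using finite_subset[OF Y(1) finABC(2)] .
  have plain: "copy_in n E V T" if small: "card (reach Y) \<le> 2 * j"
  proof -
    have cY: "card Y \<le> card L" "card (reach Y) \<le> card M" using alt small c(1,2) by auto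
    obtain \<psi> where \<psi>: "inj_on \<psi> (Y \<union> reach Y)" "\<And>y. y \<in> Y \<Longrightarrow> \<psi> y \<in> L" "\<And>a. a \<in> reach Y \<Longrightarrow> \<psi> a \<in> M"
      using placement_exists[OF Y(1) c(4,5) cY c(7)] by blast
    show ?thesis
    proof (rule gadget_move[OF Y \<psi>(1)])
      show "\<psi> x \<in> {p..<p + (2 * g + 2 + j)}" if "x \<in> Y \<union> reach Y" for x using that \<psi>(2,3) inS(1) by blast
      show "{\<psi> y, \<psi> a} \<in> gadget p g j" if "y \<in> Y" "a \<in> nb T y \<inter> A" for y a
      proof -
        have "a \<in> reach Y" using that by (auto simp: reach_def)
        then have ya: "\<psi> y \<in> L" "\<psi> a \<in> M" using \<psi>(2)[OF that(1)] \<psi>(3) by simp_all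
        then have "\<psi> y \<noteq> \<psi> a" using c(7) by (metis IntI empty_iff)
        with ya show ?thesis by (intro subsetD[OF gad(1)] joinsI)
      qed
    qed
  qed
  show ?thesis
  proof (cases "card (reach Y) \<le> 2 * j")
    case True then show ?thesis by (rule plain)
  next
    case False
    then have big: "2 * j + 1 \<le> card (reach Y)" by simp
    have Y': "card Y = j + 1" "card A = g" "sum ?d Y \<le> 2 * j + 2"
      using alt card_reach_le[OF fY] big by auto
    \<comment> \<open>The star is part of the gadget only under this condition. It holds because the
      more than 2 * j reached vertices all lie in \<open>A\<close>, which has g elements
      here.\<close>
    have jg: "2 * j \<le> g" using big card_mono[OF finABC(1) reach(2), of Y] Y'(2) by simp
    obtain y where y: "y \<in> Y" "?d y \<le> 2 * j" "card (reach (Y - {y})) \<le> 2 * j" "reach (Y - {y}) \<inter> (nb T y \<inter> A) = {}"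
      by (rule split_star[OF Y(1) Y'(1) j(1) Y'(3) big])
    let ?Y = "Y - {y}"
    have Yy: "?Y \<subseteq> B" "card ?Y \<le> card L" using Y(1) Y'(1) fY y(1) c(1) by auto
    have cM: "card (reach ?Y) \<le> card M" using y(3) c(2) by simp
    obtain \<psi>1 where \<psi>1: "inj_on \<psi>1 (?Y \<union> reach ?Y)" "\<And>x. x \<in> ?Y \<Longrightarrow> \<psi>1 x \<in> L" "\<And>a. a \<in> reach ?Y \<Longrightarrow> \<psi>1 a \<in> M"
      using placement_exists[OF Yy(1) c(4,5) Yy(2) cM c(7)] by blast
    have im1: "\<psi>1 ` (?Y \<union> reach ?Y) \<subseteq> L \<union> M" using \<psi>1(2,3) by blast
    have yB: "y \<in> B" "y \<notin> A" using y(1) Y(1) V by auto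
    have d1: "{y} \<inter> (?Y \<union> reach ?Y) = {}" using yB reach(2)[of ?Y] by blast
    have i1: "\<psi>1 ` (?Y \<union> reach ?Y) \<inter> {s} = {}" using im1 c(8,9) by blast
    have t: "finite {y}" "finite {s}" "card {y} \<le> card {s}" by simp_all
    obtain \<psi>2 where \<psi>2: "inj_on \<psi>2 ((?Y \<union> reach ?Y) \<union> {y})" "\<And>w. w \<in> ?Y \<union> reach ?Y \<Longrightarrow> \<psi>2 w = \<psi>1 w"
      "\<And>x. x \<in> {y} \<Longrightarrow> \<psi>2 x \<in> {s}"
      using inj_extend[OF \<psi>1(1) i1 t d1] by blast
    let ?N = "nb T y \<inter> A"
    have i2: "\<psi>2 ` ((?Y \<union> reach ?Y) \<union> {y}) \<inter> M' = {}" using im1 \<psi>2(2,3) c(10-12) by fastforce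
    have d2: "?N \<inter> ((?Y \<union> reach ?Y) \<union> {y}) = {}" using y(4) Y(1) yB V by blast
    have f2: "finite ?N" "card ?N \<le> card M'" using finABC y(2) c(3) by auto
    obtain \<psi> where \<psi>: "inj_on \<psi> (((?Y \<union> reach ?Y) \<union> {y}) \<union> ?N)" "\<And>w. w \<in> (?Y \<union> reach ?Y) \<union> {y} \<Longrightarrow> \<psi> w = \<psi>2 w"
      "\<And>x. x \<in> ?N \<Longrightarrow> \<psi> x \<in> M'"
      using inj_extend[OF \<psi>2(1) i2 f2(1) c(6) f2(2) d2] by blast
    have val: "\<psi> y = s" "\<And>x. x \<in> ?Y \<Longrightarrow> \<psi> x \<in> L" "\<And>x. x \<in> reach ?Y \<Longrightarrow> \<psi> x \<in> M"
      using \<psi>(2) \<psi>2(2,3) \<psi>1(2,3) by auto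
    have eq: "((?Y \<union> reach ?Y) \<union> {y}) \<union> ?N = Y \<union> reach Y" using y(1) by (auto simp: reach_def)
    show ?thesis
    proof (rule gadget_move[OF Y \<psi>(1)[unfolded eq]])
      show "\<psi> x \<in> {p..<p + (2 * g + 2 + j)}" if "x \<in> Y \<union> reach Y" for x
        using that[folded eq] val \<psi>(3) inS(1) inS(2)[OF jg] by blast
      show "{\<psi> y', \<psi> a} \<in> gadget p g j" if y': "y' \<in> Y" "a \<in> nb T y' \<inter> A" for y' a
      proof (cases "y' = y")
        case True
        then have ya: "\<psi> y' \<in> {s}" "\<psi> a \<in> M'" using val(1) \<psi>(3) y'(2) by simp_all
        then have "\<psi> y' \<noteq> \<psi> a" using c(10) by (metis singletonD)
        with ya show ?thesis by (intro subsetD[OF gad(2)[OF jg]] joinsI)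
      next
        case False
        then have "a \<in> reach ?Y" using y' by (auto simp: reach_def)
        then have ya: "\<psi> y' \<in> L" "\<psi> a \<in> M" using val(2)[of y'] val(3) False y'(1) by simp_all
        then have "\<psi> y' \<noteq> \<psi> a" using c(7) by (metis IntI empty_iff)
        with ya show ?thesis by (intro subsetD[OF gad(1)] joinsI)
      qed
    qed
  qed
qed

text \<open>With maximum degree 2 the moved vertices and their neighbours must form paths. One
  vertex, or two with disjoint neighbourhoods, become midpoints of paths with at most two edges
  each; two with a common neighbour lie on the path with five vertices.\<close>

lemma gadget_one:
  assumes j: "j = 1" "3 \<le> g"
  shows "copy_in n E V T"
proof -
  have gad: "gadget p g j = {{p, p + 1}, {p + 1, p + 2}, {p + 2, p + 3}, {p + 3, p + 4}, {p + 5, p + 6}, {p + 6, p + 7}}"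
    using j by (simp add: gadget_def)
  have gadm: "{p + 1, p} \<in> gadget p g j" "{p + 1, p + 2} \<in> gadget p g j" "{p + 3, p + 2} \<in> gadget p g j"
    "{p + 3, p + 4} \<in> gadget p g j" "{p + 6, p + 5} \<in> gadget p g j" "{p + 6, p + 7} \<in> gadget p g j"
    unfolding gad insert_iff doubleton_eq_iff by simp_all
  let ?d = "\<lambda>y. card (nb T y \<inter> A)"
  obtain Y where Y: "Y \<subseteq> B" "card C + card B + j + 1 \<le> m + card Y"
    and alt: "card Y \<le> j \<and> sum ?d Y \<le> 2 * j \<or> card Y = j + 1 \<and> card A = g \<and> sum ?d Y \<le> 2 * j + 2 \<and>
      (\<forall>x\<in>Y. \<forall>y\<in>B - Y. ?d x \<le> ?d y)"
    using lowest_degrees[OF pj(2)] j by auto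
  have fY: "finite Y" using finite_subset[OF Y(1) finABC(2)] .
  show ?thesis
  proof (cases "card Y \<le> 1 \<and> sum ?d Y \<le> 2")
    case True
    then have t: "finite {p + 1}" "finite {p, p + 2}" "card Y \<le> card {p + 1}" "card (reach Y) \<le> card {p, p + 2}"
      "{p + 1} \<inter> {p, p + 2} = {}"
      using card_reach_le[OF fY] by auto
    obtain \<psi> where \<psi>: "inj_on \<psi> (Y \<union> reach Y)" "\<And>y. y \<in> Y \<Longrightarrow> \<psi> y \<in> {p + 1}" "\<And>a. a \<in> reach Y \<Longrightarrow> \<psi> a \<in> {p, p + 2}"
      using placement_exists[OF Y(1) t] by blast
    show ?thesis
    proof (rule gadget_move[OF Y \<psi>(1)])
      show "\<psi> x \<in> {p..<p + (2 * g + 2 + j)}" if "x \<in> Y \<union> reach Y" for x using that \<psi>(2)[of x] \<psi>(3)[of x] j by auto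
      show "{\<psi> y, \<psi> a} \<in> gadget p g j" if "y \<in> Y" "a \<in> nb T y \<inter> A" for y a
      proof -
        have "a \<in> reach Y" using that by (auto simp: reach_def)
        then have "\<psi> y = p + 1" "\<psi> a = p \<or> \<psi> a = p + 2" using \<psi>(2)[OF that(1)] \<psi>(3)[of a] by simp_all
        then show ?thesis by (elim disjE) (simp_all only: gadm)
      qed
    qed
  next
    case False
    then have Y': "card Y = 2" "card A = g" "sum ?d Y \<le> 4" "\<forall>x\<in>Y. \<forall>y\<in>B - Y. ?d x \<le> ?d y"
      using alt j by auto
    obtain y1 y2 where y12: "Y = {y1, y2}" "y1 \<noteq> y2" using Y'(1) by (auto simp: card_2_iff)
    \<comment> \<open>If y had degree at least 3, so would every vertex of \<open>B\<close> outside
      Y, since Y has the lowest degrees. The tree would then have too many edges.\<close>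
    have d2: "?d y \<le> 2" if y: "y \<in> Y" for y
    proof (rule ccontr)
      assume c: "\<not> ?d y \<le> 2"
      have "(\<Sum>x\<in>B - {y}. if x \<in> Y then 1 else 3) \<le> (\<Sum>x\<in>B - {y}. ?d x)"
        using deg_pos Y'(4) y c by (intro sum_mono) (auto intro: order_trans[of 3 "?d y"])
      moreover have "(\<Sum>x\<in>B. ?d x) = ?d y + (\<Sum>x\<in>B - {y}. ?d x)"
        using y Y(1) finABC by (intro sum.remove) auto
      moreover have "(\<Sum>x\<in>B - {y}. if x \<in> Y then 1 else 3 :: nat) = card (Y - {y}) + 3 * card (B - Y)"
      proof -
        have eq: "B - {y} = (Y - {y}) \<union> (B - Y)" using Y(1) y by auto
        have "(\<Sum>x\<in>B - {y}. if x \<in> Y then 1 else 3 :: nat)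
          = (\<Sum>x\<in>Y - {y}. if x \<in> Y then 1 else 3) + (\<Sum>x\<in>B - Y. if x \<in> Y then 1 else 3)"
          unfolding eq by (rule sum.union_disjoint) (use fY finABC in auto)
        also have "(\<Sum>x\<in>Y - {y}. if x \<in> Y then 1 else 3 :: nat) = (\<Sum>x\<in>Y - {y}. 1)" by (intro sum.cong) auto
        also have "(\<Sum>x\<in>B - Y. if x \<in> Y then 1 else 3 :: nat) = (\<Sum>x\<in>B - Y. 3)" by (intro sum.cong) auto
        finally show ?thesis by simp
      qed
      moreover have "card (Y - {y}) = 1" using Y'(1) y fY by simp
      moreover have "card (B - Y) = card B - 2" using Y(1) fY Y'(1) by (simp add: card_Diff_subset)
      ultimately have "3 + 1 + 3 * (card B - 2) \<le> (\<Sum>x\<in>B. ?d x)" using c by linarith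
      moreover have "3 \<le> card B" "g \<le> card B + 1" using sizes size Y'(2) j by auto
      ultimately show False using total Y'(2) j by linarith
    qed
    have N2: "card (nb T y1 \<inter> A) \<le> 2" "card (nb T y2 \<inter> A) \<le> 2" using d2 y12 by auto
    have yA: "y1 \<in> B" "y2 \<in> B" "y1 \<notin> A" "y2 \<notin> A" using y12 Y(1) V by auto
    let ?N1 = "nb T y1 \<inter> A" and ?N2 = "nb T y2 \<inter> A"
    have fN: "finite ?N1" "finite ?N2" using finABC by auto
    have reachY: "reach Y = ?N1 \<union> ?N2" by (simp add: reach_def y12)
    show ?thesis
    proof (cases "?N1 \<inter> ?N2 = {}")
      case True
      let ?f = "\<lambda>x. if x = y1 then p + 1 else p + 6"
      have t: "inj_on ?f {y1, y2}" "?f ` {y1, y2} \<inter> {p, p + 2} = {}" "finite {p, p + 2}"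
        "card ?N1 \<le> card {p, p + 2}" "?N1 \<inter> {y1, y2} = {}"
        using y12(2) N2 yA by (auto simp: inj_on_def)
      obtain \<psi>1 where \<psi>1: "inj_on \<psi>1 ({y1, y2} \<union> ?N1)" "\<And>w. w \<in> {y1, y2} \<Longrightarrow> \<psi>1 w = ?f w"
        "\<And>x. x \<in> ?N1 \<Longrightarrow> \<psi>1 x \<in> {p, p + 2}"
        using inj_extend[OF t(1,2) fN(1) t(3-5)] by blast
      have v1: "\<psi>1 y1 = p + 1" "\<psi>1 y2 = p + 6" using \<psi>1(2) y12(2) by auto
      have i: "\<psi>1 ` ({y1, y2} \<union> ?N1) \<inter> {p + 5, p + 7} = {}" using v1 \<psi>1(3) by fastforce
      have dj: "?N2 \<inter> ({y1, y2} \<union> ?N1) = {}" using True yA by blast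
      have t2: "finite {p + 5, p + 7}" "card ?N2 \<le> card {p + 5, p + 7}" using N2 by auto
      obtain \<psi> where \<psi>: "inj_on \<psi> (({y1, y2} \<union> ?N1) \<union> ?N2)" "\<And>w. w \<in> {y1, y2} \<union> ?N1 \<Longrightarrow> \<psi> w = \<psi>1 w"
        "\<And>x. x \<in> ?N2 \<Longrightarrow> \<psi> x \<in> {p + 5, p + 7}"
        using inj_extend[OF \<psi>1(1) i fN(2) t2 dj] by blast
      have val: "\<psi> y1 = p + 1" "\<psi> y2 = p + 6" "\<And>x. x \<in> ?N1 \<Longrightarrow> \<psi> x = p \<or> \<psi> x = p + 2"
        "\<And>x. x \<in> ?N2 \<Longrightarrow> \<psi> x = p + 5 \<or> \<psi> x = p + 7"
        using \<psi>(2,3) \<psi>1(3) v1 by auto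
      have eq: "({y1, y2} \<union> ?N1) \<union> ?N2 = Y \<union> reach Y" unfolding reachY using y12(1) by auto
      show ?thesis
      proof (rule gadget_move[OF Y \<psi>(1)[unfolded eq]])
        show "\<psi> x \<in> {p..<p + (2 * g + 2 + j)}" if "x \<in> Y \<union> reach Y" for x
        proof -
          have "x = y1 \<or> x = y2 \<or> x \<in> ?N1 \<or> x \<in> ?N2" using that[folded eq] by blast
          then show ?thesis using val j by (elim disjE) fastforce+
        qed
        show "{\<psi> y, \<psi> a} \<in> gadget p g j" if "y \<in> Y" "a \<in> nb T y \<inter> A" for y a
        proof (cases "y = y1")
          case True
          then have "\<psi> y = p + 1" "\<psi> a = p \<or> \<psi> a = p + 2" using val(1) val(3)[of a] that(2) by simp_all
          then show ?thesis by (elim disjE) (simp_all only: gadm)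
        next
          case False
          then have "y = y2" using that(1) y12 by blast
          then have "\<psi> y = p + 6" "\<psi> a = p + 5 \<or> \<psi> a = p + 7" using val(2) val(4)[of a] that(2) by simp_all
          then show ?thesis by (elim disjE) (simp_all only: gadm)
        qed
      qed
    next
      case False
      then obtain z where z: "z \<in> ?N1" "z \<in> ?N2" by blast
      have only: "x = z" if "x \<in> ?N1" "x \<in> ?N2" for x
        by (rule shared_neighbour_unique[OF yA(1,2) y12(2) z that])
      have zne: "z \<noteq> y1" "z \<noteq> y2" using z yA by auto
      \<comment> \<open>The common neighbour z is the middle of the path with five vertices, between
        y1 and y2; a further neighbour of either goes to an end.\<close>
      let ?f = "\<lambda>x. if x = y1 then p + 1 else if x = y2 then p + 3 else p + 2"
      have t: "inj_on ?f {y1, y2, z}" "?f ` {y1, y2, z} \<inter> {p} = {}" "finite (?N1 - {z})" "finite {p}"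
        "card (?N1 - {z}) \<le> card {p}" "(?N1 - {z}) \<inter> {y1, y2, z} = {}"
        using y12(2) zne z fN N2 yA by (auto simp: inj_on_def)
      have t2: "finite (?N2 - {z})" "finite {p + 4}" "card (?N2 - {z}) \<le> card {p + 4}" using z fN N2 by auto
      obtain \<psi>1 where \<psi>1: "inj_on \<psi>1 ({y1, y2, z} \<union> (?N1 - {z}))" "\<And>w. w \<in> {y1, y2, z} \<Longrightarrow> \<psi>1 w = ?f w"
        "\<And>x. x \<in> ?N1 - {z} \<Longrightarrow> \<psi>1 x \<in> {p}"
        using inj_extend[OF t] by blast
      have v1: "\<psi>1 y1 = p + 1" "\<psi>1 y2 = p + 3" "\<psi>1 z = p + 2" using \<psi>1(2) y12(2) zne by auto
      have i: "\<psi>1 ` ({y1, y2, z} \<union> (?N1 - {z})) \<inter> {p + 4} = {}" using v1 \<psi>1(3) by fastforce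
      have dj: "(?N2 - {z}) \<inter> ({y1, y2, z} \<union> (?N1 - {z})) = {}" using only yA by blast
      obtain \<psi> where \<psi>: "inj_on \<psi> (({y1, y2, z} \<union> (?N1 - {z})) \<union> (?N2 - {z}))"
        "\<And>w. w \<in> {y1, y2, z} \<union> (?N1 - {z}) \<Longrightarrow> \<psi> w = \<psi>1 w" "\<And>x. x \<in> ?N2 - {z} \<Longrightarrow> \<psi> x \<in> {p + 4}"
        using inj_extend[OF \<psi>1(1) i t2 dj] by blast
      have val: "\<psi> y1 = p + 1" "\<psi> y2 = p + 3" "\<psi> z = p + 2" "\<And>x. x \<in> ?N1 - {z} \<Longrightarrow> \<psi> x = p"
        "\<And>x. x \<in> ?N2 - {z} \<Longrightarrow> \<psi> x = p + 4"
        using \<psi>(2,3) \<psi>1(3) v1 by auto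
      have eq: "({y1, y2, z} \<union> (?N1 - {z})) \<union> (?N2 - {z}) = Y \<union> reach Y" unfolding reachY using y12(1) z by auto
      show ?thesis
      proof (rule gadget_move[OF Y \<psi>(1)[unfolded eq]])
        show "\<psi> x \<in> {p..<p + (2 * g + 2 + j)}" if "x \<in> Y \<union> reach Y" for x
        proof -
          have "x = y1 \<or> x = y2 \<or> x = z \<or> x \<in> ?N1 - {z} \<or> x \<in> ?N2 - {z}" using that[folded eq] by blast
          then show ?thesis using val(1-3) val(4,5)[of x] j by (elim disjE) auto
        qed
        show "{\<psi> y, \<psi> a} \<in> gadget p g j" if "y \<in> Y" "a \<in> nb T y \<inter> A" for y a
        proof (cases "y = y1")
          case True
          then have "a = z \<or> a \<in> ?N1 - {z}" using that by blast
          then have "\<psi> y = p + 1" "\<psi> a = p + 2 \<or> \<psi> a = p" using True val(1,3) val(4)[of a] by auto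
          then show ?thesis by (elim disjE) (simp_all only: gadm)
        next
          case False
          then have "y = y2" using that(1) y12 by blast
          then have "a = z \<or> a \<in> ?N2 - {z}" using that by blast
          then have "\<psi> y = p + 3" "\<psi> a = p + 2 \<or> \<psi> a = p + 4" using \<open>y = y2\<close> val(2,3) val(5)[of a] by auto
          then show ?thesis by (elim disjE) (simp_all only: gadm)
        qed
      qed
    qed
  qed
qed

lemma copy_in_gadget:
  assumes "v \<in> V" "card (nb T v) = 2"
  shows "copy_in n E V T"
proof (cases "g \<le> j + 1")
  case True then show ?thesis using gadget_large assms by blast
next
  case False
  then show ?thesis using gadget_one gadget_mid pj by (cases "j = 1") auto
qed

end

end

section \<open>Embedding with one or two edges outside the clique\<close>

context sized_classes
begin

text \<open>If all degrees from \<open>B\<close> into \<open>A\<close> were at least 2, the edge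
  count of the tree would give |B| \<le> g - 1, hence m = |B| + |C| \<le> 2 * g - 2.\<close>

lemma leaf_exists:
  assumes "card A = g" "2 * g \<le> m + 1"
  shows "\<exists>y\<in>B. card (nb T y \<inter> A) = 1"
proof (rule ccontr)
  assume c: "\<not> ?thesis"
  have "(\<Sum>y\<in>B. 2) \<le> (\<Sum>y\<in>B. card (nb T y \<inter> A))"
  proof (rule sum_mono)
    fix y assume "y \<in> B"
    then show "2 \<le> card (nb T y \<inter> A)" using deg_pos[of y] c by fastforce
  qed
  then show False using total sizes assms size by simp
qed

text \<open>When every vertex of \<open>B\<close> has degree 2, the tree is a tree on
  \<open>A\<close> with all edges subdivided. It has at least two leaves in \<open>A\<close>, and
  two of them can be chosen with different neighbours.\<close>

lemma double_star_exists:
  assumes g: "card A = g" "2 * g = m + 2" and deg: "\<And>y. y \<in> B \<Longrightarrow> card (nb T y \<inter> A) = 2"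
  obtains x1 x2 y1 y2 where "x1 \<in> A" "x2 \<in> A" "y1 \<in> B" "y2 \<in> B" "y1 \<noteq> y2"
    "nb T x1 \<inter> B = {y1}" "nb T x2 \<inter> B = {y2}"
proof -
  have cB: "card B = g - 1" using total deg g by simp
  define L where "L = {x \<in> A. card (nb T x \<inter> B) = 1}"
  have L: "L \<subseteq> A" "finite L" using finABC by (auto simp: L_def)
  have posA: "1 \<le> card (nb T x \<inter> B)" if "x \<in> A" for x
  proof -
    have "card (nb T x \<inter> B) \<noteq> 0" using pos(1)[OF that] finABC by simp
    then show ?thesis by simp
  qed
  have "(\<Sum>x\<in>A. card (nb T x \<inter> B)) = (\<Sum>y\<in>B. card (nb T y \<inter> A))"
    by (rule sum_card_nb_Int[symmetric]) (rule finABC)+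
  also have "\<dots> = 2 * (g - 1)" using deg cB by simp
  finally have sumA: "(\<Sum>x\<in>A. card (nb T x \<inter> B)) = 2 * (g - 1)" .
  have "(\<Sum>x\<in>A. card (nb T x \<inter> B)) = (\<Sum>x\<in>L. card (nb T x \<inter> B)) + (\<Sum>x\<in>A - L. card (nb T x \<inter> B))"
    using sum.subset_diff[OF L(1) finABC(1), of "\<lambda>x. card (nb T x \<inter> B)"] by simp
  moreover have "(\<Sum>x\<in>L. card (nb T x \<inter> B)) = card L" by (simp add: L_def)
  moreover have "(\<Sum>x\<in>A - L. 2) \<le> (\<Sum>x\<in>A - L. card (nb T x \<inter> B))"
  proof (rule sum_mono)
    fix x assume "x \<in> A - L"
    then show "2 \<le> card (nb T x \<inter> B)" using posA[of x] by (force simp: L_def)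
  qed
  moreover have "card (A - L) = g - card L" using L g by (simp add: card_Diff_subset)
  moreover have "card L \<le> g" using card_mono[OF finABC(1) L(1)] g by simp
  ultimately have cL: "2 \<le> card L" using sumA size by simp
  \<comment> \<open>If all leaves had the same neighbour y0, they would be exactly its two
    neighbours and this path would be a component; what remains has too many edges for a
    forest.\<close>
  have "\<exists>x1\<in>L. \<exists>x2\<in>L. nb T x1 \<inter> B \<noteq> nb T x2 \<inter> B"
  proof (rule ccontr)
    assume same: "\<not> ?thesis"
    obtain x0 where x0: "x0 \<in> L" using cL by fastforce
    then obtain y0 where y0: "nb T x0 \<inter> B = {y0}" by (auto simp: L_def card_1_singleton_iff)
    have leaf: "nb T x \<inter> B = {y0}" if "x \<in> L" for x using same x0 y0 that by blast
    have "L \<subseteq> nb T y0 \<inter> A" using leaf L(1) nb_sym by fastforce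
    moreover have y0B: "y0 \<in> B" using y0 by blast
    ultimately have L2: "card L = 2" "L = nb T y0 \<inter> A"
      using card_mono[of "nb T y0 \<inter> A" L] card_subset_eq[of "nb T y0 \<inter> A" L] finABC deg[OF y0B] cL by auto
    have "nb T y \<inter> (A - L) = nb T y \<inter> A" if y: "y \<in> B - {y0}" for y
    proof -
      have "x \<notin> nb T y" if "x \<in> L" for x
      proof
        assume "x \<in> nb T y"
        then have "y \<in> nb T x \<inter> B" using y nb_sym by fast
        then show False using leaf[OF that] y by blast
      qed
      then show ?thesis by blast
    qed
    then have "(\<Sum>y\<in>B - {y0}. card (nb T y \<inter> (A - L))) = (\<Sum>y\<in>B - {y0}. 2)"
      using deg by (intro sum.cong) auto
    moreover have "(\<Sum>y\<in>B - {y0}. card (nb T y \<inter> (A - L))) < card (A - L) + card (B - {y0})"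
    proof (rule sparse)
      have "card (A - L) \<noteq> 0" using L L2 g size by (simp add: card_Diff_subset)
      then have "A - L \<noteq> {}" by (metis card.empty)
      then show "A - L \<union> (B - {y0}) \<noteq> {}" by blast
    qed auto
    moreover have "card (B - {y0}) = g - 2" "card (A - L) = g - 2"
      using y0B finABC cB L L2 g by (simp_all add: card_Diff_subset)
    ultimately show False by simp
  qed
  then obtain x1 x2 where x: "x1 \<in> L" "x2 \<in> L" "nb T x1 \<inter> B \<noteq> nb T x2 \<inter> B" by blast
  obtain y1 y2 where y: "nb T x1 \<inter> B = {y1}" "nb T x2 \<inter> B = {y2}"
    using x(1,2) by (auto simp: L_def card_1_singleton_iff)
  then have "y1 \<in> B" "y2 \<in> B" "y1 \<noteq> y2" using x(3) by auto
  then show thesis using that[of x1 x2 y1 y2] x(1,2) L(1) y by blast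
qed

context
  fixes n :: nat and E P S
  assumes E: "pairs P \<union> joins P S \<subseteq> E" "finite P" "finite S" "P \<inter> S = {}" "P \<union> S \<subseteq> {..<n}"
    and cP: "card P + 1 = m" "card V \<le> card P + card S"
begin

lemma wide_copy: "g < card A \<Longrightarrow> copy_in n E V T"
  by (rule copy_in_move[where Y = "{}", OF _ _ E cP(2)]) (use sizes cP in \<open>auto simp: reach_def\<close>)

lemma star_copy:
  assumes y: "y \<in> B" "card (nb T y \<inter> A) \<le> card M" and M: "M \<subseteq> nb E s" "insert s M \<subseteq> S" "s \<notin> M"
  shows "copy_in n E V T"
proof -
  have "M \<subseteq> S" using M(2) by simp
  then have fM: "finite M" using E(3) by (rule finite_subset)
  have t: "{y} \<subseteq> B" "finite {s}" "finite M" "card {y} \<le> card {s}" "card (reach {y}) \<le> card M" "{s} \<inter> M = {}"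
    using y M fM by (simp_all add: reach_singleton)
  obtain \<psi> where \<psi>: "inj_on \<psi> ({y} \<union> reach {y})" "\<And>x. x \<in> {y} \<Longrightarrow> \<psi> x \<in> {s}" "\<And>a. a \<in> reach {y} \<Longrightarrow> \<psi> a \<in> M"
    using placement_exists[OF t] by blast
  show ?thesis
  proof (rule copy_in_move[OF t(1) _ E cP(2) \<psi>(1)])
    show "card C + card B \<le> card P + card {y}" using sizes cP by simp
    show "\<psi> ` ({y} \<union> reach {y}) \<subseteq> S" using \<psi>(2,3) M(2) by blast
    show "{\<psi> x, \<psi> a} \<in> E" if "x \<in> {y}" "a \<in> nb T x \<inter> A" for x a
    proof -
      have "a \<in> reach {y}" using that by (simp add: reach_singleton)
      then have "\<psi> a \<in> nb E s" using \<psi>(3) M(1) by blast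
      then show ?thesis using \<psi>(2)[OF that(1)] by (simp add: nb_def)
    qed
  qed
qed

text \<open>If the largest class has only g vertices, one vertex of \<open>B\<close> has to leave P.
  A vertex with a single neighbour in \<open>A\<close> creates just one edge there, which is mapped
  to pq.\<close>

lemma one_edge_copy:
  assumes "2 * g \<le> m + 1 \<or> (\<exists>y\<in>B. card (nb T y \<inter> A) = 1)" "p \<in> S" "q \<in> S" "p \<noteq> q" "{p, q} \<in> E"
  shows "copy_in n E V T"
proof (cases "g < card A")
  case True then show ?thesis by (rule wide_copy)
next
  case False
  then have "card A = g" using sizes(2) by simp
  then obtain y where "y \<in> B" "card (nb T y \<inter> A) = 1" using leaf_exists assms(1) by blast
  then show ?thesis using star_copy[of y "{q}" p] assms by (simp add: nb_def)
qed

text \<open>The two classes exchange roles. As |B| = g - 1, the class \<open>B\<close> together with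
  the leaves x1 and x2 can be placed on S, and \<open>C\<close> with the other vertices of
  \<open>A\<close> fits on P. The only edges inside S are those of the two leaves, and they are
  disjoint.\<close>

lemma matching_copy:
  assumes g: "card A = g" "2 * g = m + 2" "\<And>y. y \<in> B \<Longrightarrow> card (nb T y \<inter> A) = 2"
    and pq: "p \<in> S" "q \<in> S" "r \<in> S" "s \<in> S" "distinct [p, q, r, s]" "{p, q} \<in> E" "{r, s} \<in> E"
  shows "copy_in n E V T"
proof -
  obtain x1 x2 y1 y2 where x: "x1 \<in> A" "x2 \<in> A" "y1 \<in> B" "y2 \<in> B" "y1 \<noteq> y2"
    "nb T x1 \<inter> B = {y1}" "nb T x2 \<inter> B = {y2}"
    using double_star_exists[OF g] by blast
  have cB: "card B = g - 1" using total g by simp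
  have ne: "x1 \<noteq> x2" "x1 \<noteq> y1" "x1 \<noteq> y2" "x2 \<noteq> y1" "x2 \<noteq> y2" using x V by auto
  let ?W = "{x1, x2, y1, y2}" and ?V1 = "C \<union> (A - {x1, x2})"
  define f where "f = (\<lambda>x. if x = x1 then p else if x = y1 then q else if x = x2 then r else s)"
  have f: "f x1 = p" "f y1 = q" "f x2 = r" "f y2 = s" using ne x(5) by (auto simp: f_def)
  show ?thesis
  proof (rule copy_in_join[OF V(1) on _ _ _ E _ cP(2), where \<psi> = f])
    show "?V1 \<subseteq> V" "?W \<subseteq> V" using V x by auto
    show "?V1 \<inter> ?W = {}" using V x by blast
    have "card ?V1 = card C + card (A - {x1, x2})" using finABC V by (intro card_Un_disjoint) auto
    also have "card (A - {x1, x2}) = g - 2" using x ne finABC g by (subst card_Diff_subset) auto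
    finally show "card ?V1 \<le> card P" using sizes cB g cP size by simp
    show "inj_on f ?W" using pq(5) f by (simp add: inj_on_def)
    show "f ` ?W \<subseteq> S" using pq f by auto
    show "{f a, f b} \<in> E" if ab: "a \<in> ?W" "b \<in> ?W" "{a, b} \<in> T" for a b
    proof -
      have nbs: "b \<in> nb T a" "a \<in> nb T b" using ab(3) by (simp_all add: nb_def insert_commute)
      have "a \<noteq> b" using edges_onD(1)[OF on ab(3)] .
      have "a = x1 \<and> b = y1 \<or> a = y1 \<and> b = x1 \<or> a = x2 \<and> b = y2 \<or> a = y2 \<and> b = x2"
      proof -
        have i: "x2 \<notin> nb T x1" "x1 \<notin> nb T x2" "y2 \<notin> nb T y1" "y1 \<notin> nb T y2"
          using indep(1)[OF x(1)] indep(1)[OF x(2)] indep(2)[OF x(3)] indep(2)[OF x(4)] x(1-4) by auto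
        have j: "y2 \<notin> nb T x1" "y1 \<notin> nb T x2" using x(3-7) by auto
        then have "x1 \<notin> nb T y2" "x2 \<notin> nb T y1" using nb_sym by fast+
        then show ?thesis using ab(1,2) nbs \<open>a \<noteq> b\<close> i j by (elim insertE emptyE) simp_all
      qed
      moreover have sw: "{q, p} \<in> E" "{s, r} \<in> E" using pq(6,7) by (simp_all only: insert_commute[of q p] insert_commute[of s r])
      ultimately show ?thesis by (elim disjE conjE) (simp_all only: f pq(6,7) sw)
    qed
    show "nb T a \<subseteq> ?V1" if a: "a \<in> V" "a \<notin> ?V1" "a \<notin> ?W" for a
    proof -
      have aB: "a \<in> B" "a \<noteq> y1" "a \<noteq> y2" using a V by auto
      have "x1 \<notin> nb T a" "x2 \<notin> nb T a"
      proof -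
        have "a \<notin> nb T x1" "a \<notin> nb T x2" using x(6,7) aB by auto
        then show "x1 \<notin> nb T a" "x2 \<notin> nb T a" using nb_sym by fast+
      qed
      then show ?thesis using indep(2)[OF aB(1)] nb_subset[OF on, of a] V by blast
    qed
  qed
qed

text \<open>Without a vertex of degree 1 in the critical case, all degrees from \<open>B\<close>
  into \<open>A\<close> are 2. Two edges with a common end accommodate one moved vertex with its two
  neighbours; disjoint edges accommodate two leaves.\<close>

lemma two_edges_copy:
  assumes g: "2 * g = m + 2" and onE: "edges_on X E"
    and e: "e1 \<in> E" "e2 \<in> E" "e1 \<noteq> e2" "e1 \<subseteq> S" "e2 \<subseteq> S"
  shows "copy_in n E V T"
proof (cases "g < card A \<or> (\<exists>y\<in>B. card (nb T y \<inter> A) = 1)")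
  case True
  obtain p q where "e1 = {p, q}" "p \<noteq> q" using edges_on_obtain[OF onE e(1)] by blast
  then show ?thesis using True wide_copy one_edge_copy[of p q] e by blast
next
  case False
  then have cA: "card A = g" using sizes(2) by simp
  have ge: "2 \<le> card (nb T y \<inter> A)" if "y \<in> B" for y
    using False deg_pos[OF that] that by (metis One_nat_def Suc_1 Suc_leI le_neq_implies_less)
  have "(\<Sum>y\<in>B. 2) \<le> (\<Sum>y\<in>B. card (nb T y \<inter> A))" by (rule sum_mono) (rule ge)
  then have le: "(\<Sum>y\<in>B. card (nb T y \<inter> A)) \<le> (\<Sum>y\<in>B. 2)" "B \<noteq> {}"
    using total sizes cA g size by auto
  have deg2: "card (nb T y \<inter> A) = 2" if "y \<in> B" for y
  proof (rule ccontr)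
    assume "card (nb T y \<inter> A) \<noteq> 2"
    then have "2 < card (nb T y \<inter> A)" using ge[OF that] by simp
    then have "(\<Sum>y\<in>B. 2) < (\<Sum>y\<in>B. card (nb T y \<inter> A))"
      using that ge finABC(2) by (intro sum_strict_mono_ex1) auto
    then show False using le by simp
  qed
  obtain p q where pq: "e1 = {p, q}" "p \<noteq> q" using edges_on_obtain[OF onE e(1)] by blast
  obtain r s where rs: "e2 = {r, s}" "r \<noteq> s" using edges_on_obtain[OF onE e(2)] by blast
  have star: "copy_in n E V T" if abc: "{a, b} \<in> E" "{a, c} \<in> E" "a \<noteq> b" "a \<noteq> c" "b \<noteq> c" "a \<in> S" "b \<in> S" "c \<in> S" for a b c
  proof -
    obtain y where "y \<in> B" using le(2) by blast
    then show ?thesis using star_copy[of y "{b, c}" a] deg2[of y] abc by (simp add: nb_def)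
  qed
  have E': "{p, q} \<in> E" "{q, p} \<in> E" "{r, s} \<in> E" "{s, r} \<in> E" using e pq rs by (simp_all add: insert_commute)
  have S': "p \<in> S" "q \<in> S" "r \<in> S" "s \<in> S" using e pq rs by auto
  have ne: "\<not> (p = r \<and> q = s)" "\<not> (p = s \<and> q = r)" using e(3) pq rs by auto
  consider "distinct [p, q, r, s]" | "p = r" "q \<noteq> s" | "p = s" "q \<noteq> r" | "q = r" "p \<noteq> s" | "q = s" "p \<noteq> r"
    using ne pq(2) rs(2) by auto
  then show ?thesis
  proof cases
    case 1 then show ?thesis using matching_copy[OF cA g deg2 S' _ E'(1,3)] by blast
  next
    case 2 then show ?thesis using star[of p q s] E' S' pq rs by simp
  next
    case 3 then show ?thesis using star[of p q r] E' S' pq rs by simp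
  next
    case 4 then show ?thesis using star[of q p s] E' S' pq rs by simp
  next
    case 5 then show ?thesis using star[of q p r] E' S' pq rs by simp
  qed
qed

end

end

lemma (in heavy_top) full_target:
  assumes "clique E B" "joins B U \<subseteq> E"
  shows "pairs B \<union> joins B (full E) \<subseteq> E" "finite B" "finite (full E)" "B \<inter> full E = {}" "B \<union> full E \<subseteq> {..<n}"
    "card B + 1 = m" "k \<le> card B + card (full E)"
proof -
  have sub: "full E \<subseteq> {..<n}" "B \<inter> full E = {}" by (auto simp: full_def)
  then show fin: "finite (full E)" "B \<inter> full E = {}" "finite B" "B \<union> full E \<subseteq> {..<n}" "card B + 1 = m"
    using finite_subset[OF sub(1)] B k by auto
  show "pairs B \<union> joins B (full E) \<subseteq> E" using assms(1) joins_full[of "full E" E] by (simp add: clique_pairs)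
  have "card U \<le> card (full E)" using U_full[OF assms(2)] fin(1) by (intro card_mono)
  then show "k \<le> card B + card (full E)" using U B k by simp
qed

section \<open>Combining the light and the heavy case\<close>

context degree_sequence
begin

text \<open>One realization has to contain all 2-trees simultaneously, so every choice up to
  \<open>E\<close> depends on the degrees alone; colour classes enter only afterwards. Outside the
  light case, d (m - 2) \<ge> k + g, which is more than \<open>heavy_top\<close> requires.\<close>

theorem realization_with_two_trees:
  assumes E0: "realizes n d E0"
    and mg: "g + 2 \<le> m" "(k + g) * (k + g) + 2 \<le> n"
    and r1: "2 * g = m + 2 \<Longrightarrow> 2 \<le> \<eta> \<and> 20 * (g * g) + 2 \<le> n + 17 * g"
  shows "\<exists>E. realizes n d E \<and> (\<forall>V T. set_two_tree (V :: 'a set) T \<and> card V = k \<longrightarrow> copy_in n E V T)"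
proof -
  have sized: "\<exists>A B C. sized_classes V T A B C k m g" if T: "set_two_tree V T" "card V = k" for V :: "'a set" and T
  proof -
    obtain A B C where "colour_classes V T A B C" by (rule obtain_colour_classes[OF T(1)])
    then have "sized_classes V T A B C k m g"
      unfolding sized_classes_def sized_classes_axioms_def using T(2) k mg(1) by auto
    then show ?thesis by blast
  qed
  have edges: "finite V" "edges_on V T" if "set_two_tree V T" for V :: "'a set" and T
    using set_two_tree_edges that by auto
  show ?thesis
  proof (cases "d (m - 2) < k + g")
    case True
    obtain p j where pj: "p + j + 1 = m" "1 \<le> j" and
      ext: "\<And>F. F \<subseteq> pairs {p..<p + (2 * g + 2 + j)} \<Longrightarrow> (\<And>v. card (nb F v) \<le> 2 * j) \<Longrightarrow>
        \<exists>E. realizes n d E \<and> pairs {..<p} \<union> joins {..<p} {p..<p + (2 * g + 2 + j)} \<union> F \<subseteq> E"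
      using light_top[OF E0 mg(2) True] by blast
    have "j + 1 \<le> 2 * g" using pj k by simp
    then obtain E where E: "realizes n d E"
      "pairs {..<p} \<union> joins {..<p} {p..<p + (2 * g + 2 + j)} \<union> gadget p g j \<subseteq> E"
      using ext[OF gadget_pairs card_nb_gadget] pj(2) by blast
    have "k + g \<le> (k + g) * (k + g)" by (rule le_square)
    then have kgn: "k + g < n" using mg(2) by linarith
    have "copy_in n E V T" if T: "set_two_tree V T" "card V = k" for V :: "'a set" and T
    proof -
      obtain A B C where s: "sized_classes V T A B C k m g" using sized[OF T] by blast
      obtain v where "v \<in> V" "card (nb T v) = 2" using set_two_tree_degree_two[OF T(1)] by blast
      then show ?thesis by (rule sized_classes.copy_in_gadget[OF s pj kgn E(2)])
    qed
    then show ?thesis using E(1) by blast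
  next
    case False
    interpret h: heavy_top n k m g \<eta> d
      by unfold_locales (use False in simp)
    show ?thesis
    proof (cases "2 * g = m + 2")
      case True
      have "4 \<le> g" "k + 2 = 3 * g" using True mg(1) k by auto
      then obtain E where E: "realizes n d E" "has_clique n k E \<or> clique E h.B \<and> joins h.B h.U \<subseteq> E \<and> h.two_full E"
        using h.two_full_edges[OF E0] r1[OF True] by blast
      have onE: "edges_on {..<n} E" using E(1) by (simp add: realizes_def)
      have "copy_in n E V T" if T: "set_two_tree V T" "card V = k" for V :: "'a set" and T
      proof (cases "has_clique n k E")
        case True
        then show ?thesis using copy_in_clique edges[OF T(1)] T(2) by blast
      next
        case nc: False
        then have cl: "clique E h.B" "joins h.B h.U \<subseteq> E" and two_full: "h.two_full E" using E(2) by auto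
        obtain A B C where s: "sized_classes V T A B C k m g" using sized[OF T] by blast
        obtain e1 e2 where e: "e1 \<in> E" "e2 \<in> E" "e1 \<noteq> e2" "e1 \<subseteq> h.full E" "e2 \<subseteq> h.full E"
          using two_full unfolding h.two_full_def by blast
        note H = h.full_target[OF cl]
        have "card V \<le> card h.B + card (h.full E)" using H(7) T(2) by simp
        then show ?thesis
          by (rule sized_classes.two_edges_copy[OF s H(1-6) _ True onE e])
      qed
      then show ?thesis using E(1) by blast
    next
      case False
      then have g1: "2 * g \<le> m + 1" using k by linarith
      obtain E where E: "realizes n d E" "has_clique n k E \<or>
        clique E h.B \<and> joins h.B h.U \<subseteq> E \<and> (\<exists>p\<in>h.full E. \<exists>q\<in>h.full E. {p, q} \<in> E)"
        using h.one_full_edge[OF E0] by blast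
      have onE: "edges_on {..<n} E" using E(1) by (simp add: realizes_def)
      have "copy_in n E V T" if T: "set_two_tree V T" "card V = k" for V :: "'a set" and T
      proof (cases "has_clique n k E")
        case True
        then show ?thesis using copy_in_clique edges[OF T(1)] T(2) by blast
      next
        case nc: False
        then have cl: "clique E h.B" "joins h.B h.U \<subseteq> E" and one: "\<exists>p\<in>h.full E. \<exists>q\<in>h.full E. {p, q} \<in> E"
          using E(2) by auto
        obtain A B C where s: "sized_classes V T A B C k m g" using sized[OF T] by blast
        obtain p q where pq: "p \<in> h.full E" "q \<in> h.full E" "{p, q} \<in> E" using one by blast
        have "p \<noteq> q" using edges_onD(1)[OF onE pq(3)] .
        note H = h.full_target[OF cl]
        have "card V \<le> card h.B + card (h.full E)" using H(7) T(2) by simp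
        then show ?thesis
          by (rule sized_classes.one_edge_copy[OF s H(1-6) _ disjI1[OF g1] pq(1,2) \<open>p \<noteq> q\<close> pq(3)])
      qed
      then show ?thesis using E(1) by blast
    qed
  qed
qed

end

section \<open>Realizations as digraphs\<close>

definition edges_of :: "('a, 'b) pre_digraph \<Rightarrow> 'a set set" where
  "edges_of G = {{a, b} | a b. (a, b) \<in> arcs_ends G}"

lemma graph_arcs_ends:
  assumes "graph G" "(a, b) \<in> arcs_ends G"
  shows "(b, a) \<in> arcs_ends G" "a \<noteq> b" "a \<in> verts G" "b \<in> verts G"
proof -
  interpret graph G by (rule assms(1))
  show "(b, a) \<in> arcs_ends G" using arcs_ends_symmetric[OF sym_arcs assms(2)] .
  obtain e where e: "e \<in> arcs G" "a = tail G e" "b = head G e" using assms(2) by (auto simp: arcs_ends_conv)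
  show "a \<noteq> b" "a \<in> verts G" "b \<in> verts G" using e no_loops wellformed by auto
qed

lemma edges_of_iff:
  assumes "graph G"
  shows "{a, b} \<in> edges_of G \<longleftrightarrow> (a, b) \<in> arcs_ends G"
  using graph_arcs_ends(1)[OF assms] by (auto simp: edges_of_def doubleton_eq_iff)

lemma edges_on_edges_of:
  assumes "graph G"
  shows "edges_on (verts G) (edges_of G)"
  using graph_arcs_ends(2-4)[OF assms] by (auto simp: edges_of_def edges_on_def card_insert_if)

lemma out_degree_card_nb:
  assumes "graph G"
  shows "out_degree G v = card (nb (edges_of G) v)"
proof -
  interpret graph G by (rule assms)
  have "bij_betw (head G) (out_arcs G v) (nb (edges_of G) v)"
    unfolding bij_betw_def
  proof
    show "inj_on (head G) (out_arcs G v)"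
      using no_multi_arcs by (auto simp: inj_on_def out_arcs_def arc_to_ends_def)
    show "head G ` out_arcs G v = nb (edges_of G) v"
      unfolding set_eq_iff nb_iff edges_of_iff[OF assms] by (auto simp: arcs_ends_conv out_arcs_def image_iff)
  qed
  then show ?thesis unfolding out_degree_def by (rule bij_betw_same_card)
qed

lemma two_tree_set_two_tree: "two_tree G \<Longrightarrow> set_two_tree (verts G) (edges_of G)"
proof (induction rule: two_tree.induct)
  case (triangle G)
  then have G: "graph G" "card (verts G) = 3" "arcs_ends G = {(u, v). (u, v) \<in> verts G \<times> verts G \<and> u \<noteq> v}"
    by (simp_all add: complete_digraph_def)
  obtain a b c where abc: "verts G = {a, b, c}" "a \<noteq> b" "a \<noteq> c" "b \<noteq> c"
    using G(2) by (auto simp: card_3_iff)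
  have edges: "edges_of G = {{a, b}, {a, c}, {b, c}}"
  proof
    show "{{a, b}, {a, c}, {b, c}} \<subseteq> edges_of G"
      using edges_of_iff[OF G(1)] G(3) abc by auto
    show "edges_of G \<subseteq> {{a, b}, {a, c}, {b, c}}"
    proof
      fix e assume "e \<in> edges_of G"
      then obtain x y where e: "e = {x, y}" "x \<in> verts G" "y \<in> verts G" "x \<noteq> y"
        unfolding edges_of_def G(3) by auto
      then have "x = a \<or> x = b \<or> x = c" "y = a \<or> y = b \<or> y = c" using abc(1) by auto
      then show "e \<in> {{a, b}, {a, c}, {b, c}}" using e(1,4) by (elim disjE) (simp_all add: doubleton_eq_iff)
    qed
  qed
  show ?case unfolding abc(1) edges by (rule set_two_tree.triangle[OF abc(2-4)])
next
  case (extend G v x y)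
  note G = extend.hyps(1)
  interpret graph G by (rule G)
  let ?H = "pre_digraph.del_vert G v"
  have on: "edges_on (verts G) (edges_of G)" by (rule edges_on_edges_of[OF G])
  have xy: "x \<in> nb (edges_of G) v" "y \<in> nb (edges_of G) v" "{x, y} \<in> edges_of G"
    using extend.hyps(4,5,7) unfolding nb_iff edges_of_iff[OF G] .
  have fin: "finite (nb (edges_of G) v)" by (rule finite_nb[OF on]) simp
  \<comment> \<open>Degree two means that x and y are all the neighbours of v, so deleting v removes
    exactly two edges.\<close>
  have "{x, y} = nb (edges_of G) v"
    using xy extend.hyps(3,6) out_degree_card_nb[OF G, of v] by (intro card_subset_eq fin) auto
  then have nbv: "{v, w} \<in> edges_of G \<longleftrightarrow> w = x \<or> w = y" for w unfolding nb_iff[symmetric] by auto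
  have ends: "arcs_ends ?H = {(a, b) \<in> arcs_ends G. a \<noteq> v \<and> b \<noteq> v}"
    by (auto simp: arcs_ends_conv pre_digraph.del_vert_def)
  have H: "e \<in> edges_of ?H \<longleftrightarrow> e \<in> edges_of G \<and> v \<notin> e" for e
  proof
    assume "e \<in> edges_of ?H"
    then obtain a b where "e = {a, b}" "(a, b) \<in> arcs_ends G" "a \<noteq> v" "b \<noteq> v"
      unfolding edges_of_def ends by blast
    then show "e \<in> edges_of G \<and> v \<notin> e" using edges_of_iff[OF G, of a b] by simp
  next
    assume e: "e \<in> edges_of G \<and> v \<notin> e"
    then obtain a b where ab: "e = {a, b}" "(a, b) \<in> arcs_ends G" unfolding edges_of_def by blast
    then have "(a, b) \<in> arcs_ends ?H" unfolding ends using e by auto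
    then show "e \<in> edges_of ?H" unfolding edges_of_def using ab(1) by blast
  qed
  have vx: "x \<noteq> v" "y \<noteq> v" using edges_onD(1)[OF on, of v x] edges_onD(1)[OF on, of v y] nbv by auto
  have "edges_of G = insert {v, x} (insert {v, y} (edges_of ?H))"
  proof (rule set_eqI)
    fix e
    show "e \<in> edges_of G \<longleftrightarrow> e \<in> insert {v, x} (insert {v, y} (edges_of ?H))"
    proof (cases "v \<in> e")
      case True
      have "e \<in> edges_of G \<longleftrightarrow> e = {v, x} \<or> e = {v, y}"
      proof
        assume e: "e \<in> edges_of G"
        then obtain a b where ab: "e = {a, b}" using edges_on_obtain[OF on] by blast
        then have "e = {v, b} \<or> e = {v, a}" using True by (auto simp: doubleton_eq_iff)
        then show "e = {v, x} \<or> e = {v, y}" using e nbv[of a] nbv[of b] by auto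
      qed (use nbv in auto)
      then show ?thesis using True H[of e] by simp
    next
      case False
      then show ?thesis using H[of e] by auto
    qed
  qed
  moreover have "verts G = insert v (verts ?H)" "v \<notin> verts ?H"
    using extend.hyps(2) by (auto simp: pre_digraph.del_vert_def)
  moreover have "{x, y} \<in> edges_of ?H" using H[of "{x, y}"] xy(3) vx by simp
  ultimately show ?case using set_two_tree.extend[OF extend.IH _ _ extend.hyps(6), of v] by simp
qed

definition graph_of :: "nat \<Rightarrow> nat set set \<Rightarrow> nat pair_pre_digraph" where
  "graph_of n E = \<lparr>pverts = {..<n}, parcs = {(a, b). {a, b} \<in> E}\<rparr>"

lemma graph_with_projI:
  assumes "finite (pverts G)" "parcs G \<subseteq> pverts G \<times> pverts G" "\<And>a b. (a, b) \<in> parcs G \<Longrightarrow> (b, a) \<in> parcs G \<and> a \<noteq> b"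
  shows "graph (with_proj G)"
proof -
  have "finite (parcs G)" using assms(1,2) finite_subset by blast
  then show ?thesis
    by unfold_locales (use assms in \<open>auto simp: arc_to_ends_def symmetric_def sym_def\<close>)
qed

lemma graph_graph_of:
  assumes "edges_on {..<n} E"
  shows "graph (with_proj (graph_of n E))" "edges_of (with_proj (graph_of n E)) = E"
proof -
  show g: "graph (with_proj (graph_of n E))"
    by (rule graph_with_projI) (use edges_onD[OF assms] in \<open>auto simp: graph_of_def insert_commute\<close>)
  have "e \<in> edges_of (with_proj (graph_of n E)) \<longleftrightarrow> e \<in> E" for e
  proof
    assume "e \<in> E"
    moreover from this obtain a b where "e = {a, b}" using edges_on_obtain[OF assms] by blast
    ultimately show "e \<in> edges_of (with_proj (graph_of n E))" by (auto simp: edges_of_def graph_of_def)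
  qed (auto simp: edges_of_def graph_of_def)
  then show "edges_of (with_proj (graph_of n E)) = E" by blast
qed

lemma realization_graph_of:
  assumes "realizes (length ds) (\<lambda>i. ds ! i) E"
  shows "realization ds (with_proj (graph_of (length ds) E))"
proof -
  let ?n = "length ds" and ?G = "with_proj (graph_of (length ds) E)"
  have on: "edges_on {..<?n} E" using assms by (simp add: realizes_def)
  note g = graph_graph_of[OF on]
  have "image_mset (out_degree ?G) (mset_set {..<?n}) = image_mset (\<lambda>i. ds ! i) (mset_set {..<?n})"
    by (rule image_mset_cong) (use assms in \<open>simp add: out_degree_card_nb[OF g(1)] g(2) realizes_def\<close>)
  also have "\<dots> = mset (map (\<lambda>i. ds ! i) [0..<?n])"
    by (simp add: atLeast0LessThan)
  also have "\<dots> = mset ds" unfolding map_nth ..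
  finally have "image_mset (out_degree ?G) (mset_set {..<?n}) = mset ds" .
  moreover have "verts ?G = {..<?n}" by (simp add: graph_of_def)
  ultimately show ?thesis using g(1) by (simp only: realization_def)
qed

text \<open>Equality of multisets lifts to an enumeration of M in the order of the list ys; it will
  number the vertices of a realization by the positions in the degree sequence.\<close>

lemma image_mset_eq_mset:
  "image_mset f M = mset ys \<Longrightarrow> \<exists>xs. mset xs = M \<and> map f xs = ys"
proof (induction ys arbitrary: M)
  case (Cons y ys)
  then have "y \<in># image_mset f M" by simp
  then obtain x where x: "x \<in># M" "y = f x" by auto
  then have "image_mset f (M - {#x#}) = mset ys" using Cons.prems by (simp add: image_mset_Diff)
  then obtain xs where "mset xs = M - {#x#}" "map f xs = ys" using Cons.IH by blast
  then show ?case using x by (intro exI[of _ "x # xs"]) simp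
qed simp

lemma realization_realizes:
  assumes "realization ds G"
  obtains E h where "realizes (length ds) (\<lambda>i. ds ! i) E" "bij_betw h (verts G) {..<length ds}"
    "\<And>a b. {a, b} \<in> edges_of G \<Longrightarrow> {h a, h b} \<in> E"
proof -
  let ?n = "length ds"
  have G: "graph G" and ms: "image_mset (out_degree G) (mset_set (verts G)) = mset ds"
    using assms by (simp_all add: realization_def)
  interpret graph G by (rule G)
  obtain xs where xs: "mset xs = mset_set (verts G)" "map (out_degree G) xs = ds"
    using image_mset_eq_mset[OF ms] by blast
  have set: "set xs = verts G" using xs(1) by (metis finite_set_mset_mset_set finite_verts set_mset_mset)
  have len: "length xs = ?n" using xs(2) by auto
  have "card (verts G) = size (mset xs)" unfolding xs(1) by simp
  then have dist: "distinct xs" using set by (simp add: card_distinct)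
  have bij: "bij_betw ((!) xs) {..<?n} (verts G)"
    using bij_betw_nth[OF dist, of "{..<?n}" "verts G"] len set by simp
  define h where "h = the_inv_into {..<?n} ((!) xs)"
  have h: "bij_betw h (verts G) {..<?n}" unfolding h_def by (rule bij_betw_the_inv_into[OF bij])
  have xh: "xs ! h a = a" if "a \<in> verts G" for a
    unfolding h_def using f_the_inv_into_f_bij_betw[OF bij] that by blast
  have hx: "h (xs ! i) = i" if "i < ?n" for i
    unfolding h_def using the_inv_into_f_f[OF bij_betw_imp_inj_on[OF bij]] that by simp
  have xV: "xs ! i \<in> verts G" if "i < ?n" for i using bij that by (auto simp: bij_betw_def)
  have hV: "h a < ?n" if "a \<in> verts G" for a using h that by (auto simp: bij_betw_def)
  have on: "edges_on (verts G) (edges_of G)" by (rule edges_on_edges_of[OF G])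
  define E where "E = {{i, j} | i j. i < ?n \<and> j < ?n \<and> {xs ! i, xs ! j} \<in> edges_of G}"
  have E: "{i, j} \<in> E \<longleftrightarrow> i < ?n \<and> j < ?n \<and> {xs ! i, xs ! j} \<in> edges_of G" for i j
    unfolding E_def by (auto simp: doubleton_eq_iff insert_commute)
  have "edges_on {..<?n} E"
    unfolding edges_on_def
  proof
    fix e assume "e \<in> E"
    then obtain i j where e: "e = {i, j}" "i < ?n" "j < ?n" "{xs ! i, xs ! j} \<in> edges_of G" by (auto simp: E_def)
    then have "i \<noteq> j" using edges_onD(1)[OF on e(4)] by auto
    then show "e \<subseteq> {..<?n} \<and> card e = 2" using e by simp
  qed
  moreover have "card (nb E i) = ds ! i" if i: "i < ?n" for i
  proof -
    have "bij_betw h (nb (edges_of G) (xs ! i)) (nb E i)"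
      unfolding bij_betw_def
    proof
      have sub: "nb (edges_of G) (xs ! i) \<subseteq> verts G" by (rule nb_subset[OF on])
      then show "inj_on h (nb (edges_of G) (xs ! i))" using h by (auto simp: bij_betw_def intro: inj_on_subset)
      show "h ` nb (edges_of G) (xs ! i) = nb E i"
      proof (intro equalityI subsetI)
        fix j assume "j \<in> h ` nb (edges_of G) (xs ! i)"
        then obtain a where a: "j = h a" "a \<in> nb (edges_of G) (xs ! i)" by blast
        then have "a \<in> verts G" using sub by blast
        then show "j \<in> nb E i" using a xh hV i by (simp add: nb_iff E)
      next
        fix j assume "j \<in> nb E i"
        then have "j < ?n" "xs ! j \<in> nb (edges_of G) (xs ! i)" by (simp_all add: nb_iff E)
        then show "j \<in> h ` nb (edges_of G) (xs ! i)" using hx[of j] by (intro image_eqI[of _ _ "xs ! j"]) simp_all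
      qed
    qed
    then have "card (nb E i) = out_degree G (xs ! i)"
      unfolding out_degree_card_nb[OF G] by (rule bij_betw_same_card[symmetric])
    moreover have "ds ! i = out_degree G (xs ! i)"
      using nth_map[of i xs "out_degree G"] i len xs(2) by simp
    ultimately show ?thesis by simp
  qed
  ultimately have "realizes ?n (\<lambda>i. ds ! i) E" by (simp add: realizes_def)
  moreover have "{h a, h b} \<in> E" if ab: "{a, b} \<in> edges_of G" for a b
    using edges_onD(2,3)[OF on ab] xh hV ab by (simp add: E)
  ultimately show thesis using that h by blast
qed

lemma contains_copy_graph_of:
  assumes "copy_in n E (pverts T) (edges_of (with_proj T))" "edges_on {..<n} E" "graph (with_proj T)"
  shows "contains_copy (with_proj (graph_of n E)) (with_proj T)"
proof -
  obtain \<phi> where \<phi>: "inj_on \<phi> (pverts T)" "\<phi> ` pverts T \<subseteq> {..<n}"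
    "\<And>a b. {a, b} \<in> edges_of (with_proj T) \<Longrightarrow> {\<phi> a, \<phi> b} \<in> E"
    using assms(1) unfolding copy_in_def by blast
  interpret T: graph "with_proj T" by (rule assms(3))
  interpret G: graph "with_proj (graph_of n E)" by (rule graph_graph_of(1)[OF assms(2)])
  have T: "a \<in> pverts T \<and> b \<in> pverts T" if "(a, b) \<in> parcs T" for a b
    using graph_arcs_ends(3,4)[OF assms(3), of a b] that by simp
  have arc: "{\<phi> a, \<phi> b} \<in> E" if "(a, b) \<in> parcs T" for a b
    using \<phi>(3)[of a b] edges_of_iff[OF assms(3), of a b] that by simp
  let ?f = "\<lparr>iso_verts = \<phi>, iso_arcs = map_prod \<phi> \<phi>, iso_head = snd, iso_tail = fst\<rparr>"
  let ?H = "app_iso ?f (with_proj T)"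
  have "inj_on (map_prod \<phi> \<phi>) (parcs T)"
  proof -
    have "parcs T \<subseteq> pverts T \<times> pverts T" using T by auto
    then show ?thesis using map_prod_inj_on[OF \<phi>(1) \<phi>(1)] inj_on_subset by blast
  qed
  then have "pre_digraph.digraph_isomorphism (with_proj T) ?f"
    unfolding pre_digraph.digraph_isomorphism_def using \<phi>(1) T.wf_digraph by auto
  then have iso: "digraph_iso (with_proj T) ?H" unfolding digraph_iso_def by blast
  have "wf_digraph ?H"
    by unfold_locales (use T in \<open>auto simp: app_iso_def\<close>)
  then have "subgraph ?H (with_proj (graph_of n E))"
    unfolding subgraph_def compatible_def using \<phi>(2) arc G.wf_digraph by (auto simp: app_iso_def graph_of_def)
  then show ?thesis using iso unfolding contains_copy_def by blast
qed

lemma contains_copy_embedding: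
  assumes "contains_copy (with_proj G) (with_proj T)"
  obtains \<phi> where "inj_on \<phi> (pverts T)" "\<phi> ` pverts T \<subseteq> pverts G"
    "\<And>a b. (a, b) \<in> parcs T \<Longrightarrow> (\<phi> a, \<phi> b) \<in> parcs G"
proof -
  obtain f where sub: "subgraph (app_iso f (with_proj T)) (with_proj G)"
    and f: "pre_digraph.digraph_isomorphism (with_proj T) f"
    using assms unfolding contains_copy_def digraph_iso_def by blast
  \<comment> \<open>Compatibility of a subgraph fixes the tail and head maps of the copy, so the
    images of the arcs are determined by the images of the vertices.\<close>
  have ht: "iso_tail f = fst" "iso_head f = snd"
    using sub by (auto simp: subgraph_def compatible_def app_iso_def)
  have sub': "iso_verts f ` pverts T \<subseteq> pverts G" "iso_arcs f ` parcs T \<subseteq> parcs G"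
    using sub by (auto simp: subgraph_def app_iso_def)
  show thesis
  proof (rule that[of "iso_verts f"])
    show "inj_on (iso_verts f) (pverts T)" using f by (simp add: pre_digraph.digraph_isomorphism_def)
    show "iso_verts f ` pverts T \<subseteq> pverts G" by (rule sub'(1))
    fix a b assume ab: "(a, b) \<in> parcs T"
    then have "iso_verts f a = fst (iso_arcs f (a, b))" "iso_verts f b = snd (iso_arcs f (a, b))"
      using f ht by (auto simp: pre_digraph.digraph_isomorphism_def)
    then show "(iso_verts f a, iso_verts f b) \<in> parcs G" using sub'(2) ab by auto
  qed
qed

section \<open>The square of a path as a 2-tree\<close>

definition path_square :: "nat \<Rightarrow> nat pair_pre_digraph" where
  "path_square k = \<lparr>pverts = {..<k}, parcs = {(i, j). i < k \<and> j < k \<and> i \<noteq> j \<and> i \<le> j + 2 \<and> j \<le> i + 2}\<rparr>"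

lemma graph_path_square: "graph (with_proj (path_square k))"
  by (rule graph_with_projI) (auto simp: path_square_def)

lemma two_tree_path_square: "two_tree (with_proj (path_square (k + 3)))"
proof (induction k)
  case 0
  have "K\<^bsub>3\<^esub> (with_proj (path_square 3))"
    using graph_path_square[of 3] by (auto simp: complete_digraph_def path_square_def)
  then show ?case by (simp add: two_tree.triangle)
next
  case (Suc k)
  let ?G = "with_proj (path_square (Suc k + 3))"
  show ?case
  proof (rule two_tree.extend[where v = "k + 3" and x = "k + 2" and y = "k + 1"])
    show "graph ?G" by (rule graph_path_square)
    have "out_arcs ?G (k + 3) = {(k + 3, k + 2), (k + 3, k + 1)}"
      by (auto simp: out_arcs_def path_square_def)
    then show "out_degree ?G (k + 3) = 2" by (simp add: out_degree_def)
    have "pre_digraph.del_vert ?G (k + 3) = with_proj (path_square (k + 3))"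
      by (auto simp: pre_digraph.del_vert_def with_proj_def path_square_def)
    then show "two_tree (pre_digraph.del_vert ?G (k + 3))" using Suc.IH by simp
  qed (auto simp: path_square_def)
qed

section \<open>Sharpness\<close>

definition extremal_degree :: "nat \<Rightarrow> nat \<Rightarrow> bool \<Rightarrow> nat \<Rightarrow> nat" where
  "extremal_degree n m x v = (if v < m - 1 then n - 1 else if x \<and> v \<le> m then m else m - 1)"

definition extremal_edges :: "nat \<Rightarrow> nat \<Rightarrow> bool \<Rightarrow> nat set set" where
  "extremal_edges n m x = pairs {..<m - 1} \<union> joins {..<m - 1} {m - 1..<n} \<union> (if x then {{m - 1, m}} else {})"

lemma extremal_realizes:
  assumes "1 \<le> m" "m < n"
  shows "realizes n (extremal_degree n m x) (extremal_edges n m x)"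
proof -
  let ?E = "extremal_edges n m x"
  have on: "edges_on {..<n} ?E"
    unfolding edges_on_def
  proof
    fix e assume "e \<in> ?E"
    then obtain a b where "e = {a, b}" "a \<noteq> b" "a < n" "b < n"
      using assms unfolding extremal_edges_def pairs_def joins_def by (auto split: if_splits)
    then show "e \<subseteq> {..<n} \<and> card e = 2" by simp
  qed
  have iff: "w \<in> nb ?E v \<longleftrightarrow> v \<noteq> w \<and> (v < m - 1 \<and> w < n \<or> w < m - 1 \<and> v < n \<or>
      x \<and> (v = m - 1 \<and> w = m \<or> v = m \<and> w = m - 1))" for v w
  proof -
    have "{v, w} \<in> (if x then {{m - 1, m}} else {}) \<longleftrightarrow> x \<and> (v = m - 1 \<and> w = m \<or> v = m \<and> w = m - 1)"
      by (simp add: doubleton_eq_iff)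
    moreover have "m - 1 \<noteq> m" "m - 1 < n" using assms by auto
    ultimately show ?thesis
      unfolding nb_iff extremal_edges_def Un_iff pairs_iff joins_iff atLeastLessThan_iff lessThan_iff
      by (smt (verit) not_less order_less_trans)
  qed
  have "card (nb ?E v) = extremal_degree n m x v" if v: "v < n" for v
  proof -
    consider "v < m - 1" | "\<not> v < m - 1" "x" "v \<le> m" | "\<not> v < m - 1" "\<not> (x \<and> v \<le> m)" by blast
    then show ?thesis
    proof cases
      case 1
      then have "nb ?E v = {..<n} - {v}" unfolding set_eq_iff iff using assms v by auto
      then show ?thesis using 1 v by (simp add: extremal_degree_def)
    next
      case 2
      then have "v = m - 1 \<or> v = m" by auto
      then have "nb ?E v = insert (if v = m then m - 1 else m) {..<m - 1}"
        unfolding set_eq_iff iff using 2(2) v assms by auto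
      then show ?thesis using 2 assms by (auto simp: extremal_degree_def)
    next
      case 3
      then have "nb ?E v = {..<m - 1}" unfolding set_eq_iff iff using v assms by auto
      then show ?thesis using 3 by (cases x) (auto simp: extremal_degree_def)
    qed
  qed
  then show ?thesis using on by (simp add: realizes_def)
qed

text \<open>In every realization of this sequence the first m - 1 vertices have degree n - 1 and are
  adjacent to everything. The other degrees are thereby used up except for one at m - 1 and at m, if
  at all. So the argument excludes every realization, not just the one constructed.\<close>

lemma extremal_outside_edge:
  assumes E: "realizes n (extremal_degree n m x) E" and m: "1 \<le> m" "m < n"
    and ab: "{a, b} \<in> E" "m - 1 \<le> a" "m - 1 \<le> b"
  shows "x \<and> {a, b} = {m - 1, m}"
proof -
  have on: "edges_on {..<n} E" using E by (simp add: realizes_def)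
  have deg: "card (nb E v) = extremal_degree n m x v" if "v < n" for v using E that by (simp add: realizes_def)
  have sub: "{..<m - 1} \<subseteq> nb E v" if v: "m - 1 \<le> v" "v < n" for v
  proof
    fix u assume u: "u \<in> {..<m - 1}"
    have "nb E u \<subseteq> {..<n} - {u}" using nb_subset[OF on] nb_irrefl[OF on] by blast
    moreover have "card (nb E u) = card ({..<n} - {u})" using deg[of u] u m by (simp add: extremal_degree_def)
    ultimately have "nb E u = {..<n} - {u}" by (intro card_subset_eq) auto
    then have "v \<in> nb E u" using u v by auto
    then show "u \<in> nb E v" by (simp only: nb_sym)
  qed
  have one: "x \<and> v \<le> m" if v: "m - 1 \<le> v" "v < n" and w: "w \<in> nb E v" "m - 1 \<le> w" for v w
  proof (rule ccontr)
    assume "\<not> (x \<and> v \<le> m)"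
    then have "card (nb E v) = m - 1" using deg[OF v(2)] v(1) by (cases x) (auto simp: extremal_degree_def)
    then have "nb E v = {..<m - 1}"
      using card_subset_eq[OF _ sub[OF v]] finite_nb[OF on] by simp
    then show False using w by simp
  qed
  have "a < n" "b < n" "a \<noteq> b" using edges_onD[OF on ab(1)] by auto
  moreover have "b \<in> nb E a" "a \<in> nb E b" using ab(1) by (simp_all add: nb_iff insert_commute)
  ultimately have "x" "a \<le> m" "b \<le> m" using one[of a b] one[of b a] ab by auto
  then have "a = m - 1 \<and> b = m \<or> a = m \<and> b = m - 1" using ab(2,3) \<open>a \<noteq> b\<close> by linarith
  then show ?thesis using \<open>x\<close> by auto
qed

lemma same_block_exists:
  fixes f :: "nat \<Rightarrow> nat"
  assumes "finite X" "g < card X" "\<And>i. i \<in> X \<Longrightarrow> f i < g"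
  shows "\<exists>i\<in>X. \<exists>j\<in>X. i < j \<and> f i = f j"
proof -
  have "f ` X \<subseteq> {..<g}" using assms(3) by auto
  then have "card (f ` X) \<le> g" using card_mono[of "{..<g}" "f ` X"] by simp
  then have "\<not> inj_on f X" using card_image[of f X] assms(2) by auto
  then obtain i j where ij: "i \<in> X" "j \<in> X" "i \<noteq> j" "f i = f j" by (auto simp: inj_on_def)
  show ?thesis
  proof (cases "i < j")
    case True then show ?thesis using ij by blast
  next
    case False
    then have "j < i" using ij(3) by simp
    then show ?thesis using ij(1,2) ij(4)[symmetric] by blast
  qed
qed

text \<open>The square of a path is cut by i div 3, (i + 1) div 3 and (i + 2) div 3 into cliques in three ways;
  no pair of vertices lies in a common clique for all three of them.\<close>

lemma extremal_no_path_square: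
  assumes k: "3 \<le> k" "m = 2 * k div 3" "m < n"
    and E: "realizes n (extremal_degree n m (k mod 3 = 1)) E"
    and \<phi>: "inj_on \<phi> {..<k}" "\<And>i. i < k \<Longrightarrow> \<phi> i < n"
      "\<And>i j. i < j \<Longrightarrow> j < k \<Longrightarrow> j \<le> i + 2 \<Longrightarrow> {\<phi> i, \<phi> j} \<in> E"
  shows False
proof -
  define g where "g = k - m"
  define X where "X = {i. i < k \<and> m - 1 \<le> \<phi> i}"
  have m: "1 \<le> m" "m \<le> k" using k(1,2) by auto
  have "card {i. i < k \<and> \<phi> i < m - 1} \<le> card {..<m - 1}"
    by (rule card_inj_on_le[of \<phi>]) (use \<phi>(1) in \<open>auto simp: inj_on_def\<close>)
  moreover have "card {..<k} = card {i. i < k \<and> \<phi> i < m - 1} + card X"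
  proof -
    have "{..<k} = {i. i < k \<and> \<phi> i < m - 1} \<union> X" by (auto simp: X_def)
    moreover have "{i. i < k \<and> \<phi> i < m - 1} \<inter> X = {}" by (auto simp: X_def)
    ultimately show ?thesis by (simp add: card_Un_disjoint X_def)
  qed
  ultimately have gX: "g < card X" using m by (simp add: g_def)
  \<comment> \<open>More than g positions of the path are placed outside the clique, and there are
    only g blocks; two positions in one block are adjacent in the square, so their images form the
    only edge available there.\<close>
  have block: "\<exists>i\<in>X. \<exists>j\<in>X. i < j \<and> (i + s) div 3 = (j + s) div 3 \<and> k mod 3 = 1 \<and> {\<phi> i, \<phi> j} = {m - 1, m}"
    if s: "\<And>i. i < k \<Longrightarrow> (i + s) div 3 < g" for s
  proof -
    have "finite X" by (simp add: X_def)
    then obtain i j where ij: "i \<in> X" "j \<in> X" "i < j" "(i + s) div 3 = (j + s) div 3"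
      using same_block_exists[OF _ gX, of "\<lambda>i. (i + s) div 3"] s by (auto simp: X_def)
    then have "j \<le> i + 2" by linarith
    then have "{\<phi> i, \<phi> j} \<in> E" using \<phi>(3) ij by (simp add: X_def)
    then have "k mod 3 = 1 \<and> {\<phi> i, \<phi> j} = {m - 1, m}"
      using extremal_outside_edge[OF E m(1) k(3)] ij(1,2) by (simp add: X_def)
    then show ?thesis using ij by blast
  qed
  have "3 * m \<le> 2 * k" unfolding k(2) by simp
  then have "k \<le> g * 3" by (simp add: g_def)
  then have "(i + 0) div 3 < g" if "i < k" for i using that by (intro less_mult_imp_div_less) simp
  then have r1: "k mod 3 = 1" using block[of 0] by blast
  \<comment> \<open>For k = 3 * q + 1 the rounding gives g = q + 1, so that all three shifts have at
    most g blocks; this compensates for the additional edge.\<close>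
  have b: "(i + s) div 3 < g" if "i < k" "s \<le> 2" for i s
  proof -
    obtain q where q: "k = 3 * q + 1" using r1 by (metis mult_div_mod_eq)
    then have "m = 2 * q" by (simp add: k(2))
    then have "g = q + 1" using q by (simp add: g_def)
    then show ?thesis using that q by (intro less_mult_imp_div_less) simp
  qed
  have bl: "\<exists>i\<in>X. \<exists>j\<in>X. i < j \<and> (i + s) div 3 = (j + s) div 3 \<and> {\<phi> i, \<phi> j} = {m - 1, m}" if s: "s \<le> 2" for s
    using block[OF b[OF _ s]] by blast
  obtain i j where ij: "i \<in> X" "j \<in> X" "i < j" "(i + 0) div 3 = (j + 0) div 3" "{\<phi> i, \<phi> j} = {m - 1, m}"
    using bl[of 0] by blast
  have same: "(i + s) div 3 = (j + s) div 3" if s: "s \<le> 2" for s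
  proof -
    obtain i' j' where ij': "i' \<in> X" "j' \<in> X" "i' < j'" "(i' + s) div 3 = (j' + s) div 3" "{\<phi> i', \<phi> j'} = {m - 1, m}"
      using bl[OF s] by blast
    have X: "i < k" "j < k" "i' < k" "j' < k" using ij ij' by (auto simp: X_def)
    have inj: "u = v" if "\<phi> u = \<phi> v" "u < k" "v < k" for u v
      using inj_onD[OF \<phi>(1) that(1)] that(2,3) by simp
    have "\<phi> i = \<phi> i' \<and> \<phi> j = \<phi> j' \<or> \<phi> i = \<phi> j' \<and> \<phi> j = \<phi> i'"
      using ij(5) ij'(5) unfolding doubleton_eq_iff by metis
    then have "i = i' \<and> j = j' \<or> i = j' \<and> j = i'" using inj X by metis
    then show ?thesis using ij(3) ij'(3,4) by auto
  qed
  \<comment> \<open>With this shift i is the last position of its block, so the later position j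
    belongs to another one.\<close>
  define s a where "s = 2 - i mod 3" and "a = i div 3"
  have i: "i + s = 3 * a + 2" "s \<le> 2"
    using mult_div_mod_eq[of 3 i] mod_less_divisor[of 3 i] unfolding s_def a_def by linarith+
  then have "3 * a + 3 \<le> j + s" using ij(3) by simp
  then have "(3 * a + 3) div 3 \<le> (j + s) div 3" by (rule div_le_mono)
  moreover have "(i + s) div 3 = a" unfolding i(1) by simp
  ultimately show False using same[OF i(2)] by simp
qed

text \<open>The main term is the degree sum of the join of a clique on m - 1 vertices with an
  independent set; the sign term contributes one further edge exactly for residue 1.\<close>

lemma sigma_bound_eq:
  assumes "1 \<le> m" "m = 2 * k div 3"
  shows "sigma_bound k n = int (m - 1) * (2 * int n - int m) + (if k mod 3 = 1 then 2 else 0)"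
proof -
  have "k mod 3 = 0 \<or> k mod 3 = 1 \<or> k mod 3 = 2" by linarith
  then have "(-1 :: int) ^ (k mod 3) = (if k mod 3 = 1 then - 1 else 1)" by auto
  moreover have "int (2 * k div 3) = int m" "int (m - 1) = int m - 1" using assms by simp_all
  ultimately show ?thesis
    unfolding sigma_bound_def Let_def by (simp add: power2_eq_square algebra_simps)
qed

lemma sum_extremal_degree:
  assumes "1 \<le> m" "m < n"
  shows "(\<Sum>v<n. int (extremal_degree n m x v)) = int (m - 1) * (2 * int n - int m) + (if x then 2 else 0)"
proof -
  let ?d = "\<lambda>v. int (extremal_degree n m x v)"
  have eq: "{..<n} = {..<m - 1} \<union> ({m - 1, m} \<union> {m + 1..<n})" using assms by auto
  have "sum ?d {..<n} = sum ?d {..<m - 1} + (sum ?d {m - 1, m} + sum ?d {m + 1..<n})"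
    unfolding eq using assms by (subst sum.union_disjoint; (subst sum.union_disjoint)?) auto
  moreover have "sum ?d {..<m - 1} = (\<Sum>v<m - 1. int n - 1)"
    using assms by (intro sum.cong) (auto simp: extremal_degree_def)
  moreover have "sum ?d {m + 1..<n} = (\<Sum>v\<in>{m + 1..<n}. int m - 1)"
    using assms by (intro sum.cong) (auto simp: extremal_degree_def)
  moreover have "sum ?d {m - 1, m} = 2 * (if x then int m else int m - 1)"
    using assms by (auto simp: extremal_degree_def)
  moreover have "int (m - 1) = int m - 1" "int (n - (m + 1)) = int n - int m - 1" using assms by auto
  ultimately show ?thesis by (cases x) (simp_all add: algebra_simps)
qed

lemma sigma_bound_sharp:
  assumes k: "3 \<le> k" "2 * k div 3 < n"
  shows "\<exists>ds. graphic ds \<and> length ds = n \<and> int (sum_list ds) = sigma_bound k n \<and>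
    \<not> (\<exists>G :: nat pair_pre_digraph. realization ds (with_proj G) \<and> contains_every_two_tree k (with_proj G))"
proof -
  define m where "m = 2 * k div 3"
  have m: "1 \<le> m" "m < n" using k by (auto simp: m_def)
  let ?x = "k mod 3 = 1"
  let ?d = "extremal_degree n m ?x"
  define ds where "ds = map ?d [0..<n]"
  have len: "length ds = n" and nth: "\<And>i. i < n \<Longrightarrow> ds ! i = ?d i" by (simp_all add: ds_def)
  have real: "realizes n (\<lambda>i. ds ! i) E \<longleftrightarrow> realizes n ?d E" for E
    using nth by (auto simp: realizes_def)
  have "realization ds (with_proj (graph_of n (extremal_edges n m ?x)))"
    using realization_graph_of[of ds "extremal_edges n m ?x"] extremal_realizes[OF m, of ?x]
    unfolding len real by blast
  moreover have "sorted_wrt (\<ge>) ds"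
    unfolding sorted_wrt_iff_nth_less len
  proof (intro allI impI)
    fix i j assume "i < j" "j < n"
    then show "ds ! j \<le> ds ! i" using m by (auto simp: nth extremal_degree_def)
  qed
  moreover have "\<forall>e\<in>set ds. e \<le> length ds - 1"
    using m unfolding len by (auto simp: ds_def extremal_degree_def)
  ultimately have "graphic ds" unfolding graphic_def by blast
  moreover have "int (sum_list ds) = sigma_bound k n"
  proof -
    have "sum_list ds = (\<Sum>v<n. ?d v)" unfolding ds_def by (simp add: sum_list_distinct_conv_sum_set atLeast0LessThan)
    then show ?thesis
      using sum_extremal_degree[OF m, of ?x] unfolding sigma_bound_eq[OF m(1) m_def] by simp
  qed
  moreover have False if G: "realization ds (with_proj G)" "contains_every_two_tree k (with_proj G)"
    for G :: "nat pair_pre_digraph"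
  proof -
    obtain E h where E: "realizes n (\<lambda>i. ds ! i) E" and h: "bij_betw h (pverts G) {..<n}"
      and hE: "\<And>a b. {a, b} \<in> edges_of (with_proj G) \<Longrightarrow> {h a, h b} \<in> E"
      using realization_realizes[OF G(1)] unfolding len with_proj_simps(1) by blast
    have "two_tree (with_proj (path_square k))" using two_tree_path_square[of "k - 3"] k(1) by simp
    moreover have "card (pverts (path_square k)) = k" by (simp add: path_square_def)
    ultimately have "contains_copy (with_proj G) (with_proj (path_square k))"
      using G(2) unfolding contains_every_two_tree_def by blast
    then obtain \<phi> where \<phi>: "inj_on \<phi> (pverts (path_square k))" "\<phi> ` pverts (path_square k) \<subseteq> pverts G"
      "\<And>a b. (a, b) \<in> parcs (path_square k) \<Longrightarrow> (\<phi> a, \<phi> b) \<in> parcs G"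
      by (rule contains_copy_embedding) blast
    have pv: "pverts (path_square k) = {..<k}" by (simp add: path_square_def)
    show False
    proof (rule extremal_no_path_square[OF k(1) m_def m(2) E[unfolded real], where \<phi> = "h \<circ> \<phi>"])
      show "inj_on (h \<circ> \<phi>) {..<k}"
        using \<phi>(1,2) h unfolding pv bij_betw_def by (intro comp_inj_on) (auto intro: inj_on_subset)
      show "(h \<circ> \<phi>) i < n" if "i < k" for i
        using that \<phi>(2) h unfolding pv bij_betw_def by auto
      show "{(h \<circ> \<phi>) i, (h \<circ> \<phi>) j} \<in> E" if "i < j" "j < k" "j \<le> i + 2" for i j
      proof -
        have "(\<phi> i, \<phi> j) \<in> parcs G" by (rule \<phi>(3)) (use that in \<open>simp add: path_square_def\<close>)
        then have "{\<phi> i, \<phi> j} \<in> edges_of (with_proj G)" by (auto simp: edges_of_def)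
        then show ?thesis using hE by simp
      qed
    qed
  qed
  ultimately show ?thesis using len by blast
qed

section \<open>The threshold\<close>

lemma two_tree_graph: "two_tree G \<Longrightarrow> graph G"
  by (induction rule: two_tree.induct) (simp_all add: complete_digraph_def)

text \<open>If k mod 3 = 1, then N k is exactly what the last of these inequalities needs.\<close>

lemma parameters:
  fixes k n :: nat
  assumes "k = 6 \<or> 8 \<le> k" "N k \<le> n"
  defines "m \<equiv> 2 * k div 3"
  defines "g \<equiv> k - m"
  shows "k = m + g" "4 \<le> m" "2 \<le> g" "3 * m \<le> 2 * k" "3 * g \<le> k + 2" "g + 2 \<le> m"
    "2 * k * k \<le> n" "(k + g) * (k + g) + 2 \<le> n"
    "k mod 3 \<noteq> 1 \<Longrightarrow> 2 * g \<noteq> m + 2" "k mod 3 = 1 \<Longrightarrow> 20 * (g * g) + 2 \<le> n + 17 * g"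
proof -
  have "k mod 3 < 3" by simp
  then consider "k mod 3 = 0" | "k mod 3 = 1" | "k mod 3 = 2" by linarith
  then have "k = m + g \<and> 4 \<le> m \<and> 2 \<le> g \<and> 3 * m \<le> 2 * k \<and> 3 * g \<le> k + 2 \<and> g + 2 \<le> m \<and>
    2 * k * k \<le> n \<and> (k + g) * (k + g) + 2 \<le> n \<and>
    (k mod 3 \<noteq> 1 \<longrightarrow> 2 * g \<noteq> m + 2) \<and> (k mod 3 = 1 \<longrightarrow> 20 * (g * g) + 2 \<le> n + 17 * g)"
  proof cases
    case 1
    then obtain q where k: "k = 3 * q" by (metis mod_0_imp_dvd dvdE)
    have mg: "m = 2 * q" "g = q" by (simp_all add: m_def g_def k)
    have q: "2 \<le> q"
    proof (rule ccontr)
      assume "\<not> 2 \<le> q"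
      then have "q = 0 \<or> q = 1" by linarith
      then show False using assms(1) k by auto
    qed
    define r where "r = q * q"
    have "2 * q \<le> r" using q by (simp add: r_def)
    moreover have "20 * r \<le> n + q"
      using assms(2) unfolding k by (simp add: N_def power2_eq_square r_def)
    ultimately have "18 * r \<le> n \<and> 16 * r + 2 \<le> n"
      using q by simp
    then show ?thesis using q unfolding mg k r_def by (simp add: algebra_simps)
  next
    case 2
    then obtain q where k: "k = 3 * q + 1" by (metis mult_div_mod_eq)
    have dm: "(3 * q + 1) div 3 = q" "(3 * q + 1) mod 3 = 1" by (subst div_mult_self4 mod_mult_self4; simp)+
    have mg: "m = 2 * q" "g = q + 1" by (simp_all add: m_def g_def k)
    have q: "3 \<le> q"
    proof (rule ccontr)
      assume "\<not> 3 \<le> q"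
      then have "q = 0 \<or> q = 1 \<or> q = 2" by linarith
      then show False using assms(1) k by auto
    qed
    define r where "r = q * q"
    have "3 * q \<le> r" using q by (simp add: r_def)
    moreover have "20 * r + 23 * q + 5 \<le> n"
      using assms(2) unfolding k N_def Let_def dm by (simp add: power2_eq_square r_def)
    ultimately have "18 * r + 12 * q + 2 \<le> n \<and> 16 * r + 16 * q + 6 \<le> n \<and> 20 * r + 40 * q + 22 \<le> n + 17 * q + 17"
      using q by simp
    then show ?thesis using q unfolding mg k dm r_def by (simp add: algebra_simps)
  next
    case 3
    then obtain q where k: "k = 3 * q + 2" by (metis mult_div_mod_eq)
    have dm: "(3 * q + 2) div 3 = q" "(3 * q + 2) mod 3 = 2" by (subst div_mult_self4 mod_mult_self4; simp)+
    have mg: "m = 2 * q + 1" "g = q + 1" by (simp_all add: m_def g_def k)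
    have q: "2 \<le> q"
    proof (rule ccontr)
      assume "\<not> 2 \<le> q"
      then have "q = 0 \<or> q = 1" by linarith
      then show False using assms(1) k by auto
    qed
    define r where "r = q * q"
    have "2 * q \<le> r" using q by (simp add: r_def)
    moreover have "20 * r + 31 * q + 12 \<le> n"
      using assms(2) unfolding k N_def Let_def dm by (simp add: power2_eq_square r_def)
    ultimately have "18 * r + 24 * q + 8 \<le> n \<and> 16 * r + 24 * q + 11 \<le> n"
      using q by simp
    then show ?thesis using q unfolding mg k dm r_def by (simp add: algebra_simps)
  qed
  then show "k = m + g" "4 \<le> m" "2 \<le> g" "3 * m \<le> 2 * k" "3 * g \<le> k + 2" "g + 2 \<le> m"
    "2 * k * k \<le> n" "(k + g) * (k + g) + 2 \<le> n"
    "k mod 3 \<noteq> 1 \<Longrightarrow> 2 * g \<noteq> m + 2" "k mod 3 = 1 \<Longrightarrow> 20 * (g * g) + 2 \<le> n + 17 * g" by blast+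
qed

lemma sigma_bound_suffices:
  assumes kn: "k = 6 \<or> 8 \<le> k" "N k \<le> n"
    and ds: "graphic ds" "length ds = n" "sigma_bound k n < int (sum_list ds)"
  shows "\<exists>G :: nat pair_pre_digraph. realization ds (with_proj G) \<and> contains_every_two_tree k (with_proj G)"
proof -
  define m where "m = 2 * k div 3"
  define g where "g = k - m"
  define \<eta> :: nat where "\<eta> = (if k mod 3 = 1 then 2 else 1)"
  note par = parameters[OF kn, folded m_def, folded g_def]
  let ?d = "\<lambda>i. ds ! i"
  obtain E0 where E0: "realizes n ?d E0"
  proof -
    obtain G :: "nat pair_pre_digraph" where "realization ds (with_proj G)"
      using ds(1) unfolding graphic_def by blast
    then show thesis by (rule realization_realizes) (rule that, simp only: ds(2))
  qed
  have on: "edges_on {..<n} E0" using E0 by (simp add: realizes_def)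
  have sum: "sum_list ds = (\<Sum>v<n. ?d v)" using ds(2) by (simp add: sum_list_sum_nth atLeast0LessThan)
  have "(\<Sum>v<n. ?d v) = 2 * card E0" using sum_card_nb[OF on] E0 by (simp add: realizes_def)
  then have even: "even (int (sum_list ds))" unfolding sum by simp
  define b where "b = int (m - 1) * (2 * int n - int m)"
  have "even b"
  proof -
    have "even (int (m - 1) * int m)" using par(2) by (cases m) auto
    moreover have "b = 2 * (int (m - 1) * int n) - int (m - 1) * int m" by (simp add: b_def algebra_simps)
    ultimately show ?thesis by simp
  qed
  have bound: "sigma_bound k n = b + 2 * int \<eta> - 2"
    using sigma_bound_eq[OF _ m_def, of n] par(2) by (simp add: b_def \<eta>_def)
  \<comment> \<open>Both the degree sum and b are even, so exceeding b + 2 * \<eta> - 2 means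
    reaching b + 2 * \<eta>.\<close>
  have "b + 2 * int \<eta> \<le> int (sum_list ds)"
  proof -
    obtain s c where "int (sum_list ds) = 2 * s" "b = 2 * c" using even \<open>even b\<close> by (auto elim!: evenE)
    moreover from this have "c + int \<eta> - 1 < s" using bound ds(3) by simp
    then have "c + int \<eta> \<le> s" by simp
    ultimately show ?thesis by simp
  qed
  then have total: "int (m - 1) * (2 * int n - int m) + 2 * int \<eta> \<le> (\<Sum>v<n. int (?d v))"
    unfolding sum b_def by simp
  interpret degree_sequence n k m g \<eta> ?d
  proof
    show "?d j \<le> ?d i" if "i \<le> j" "j < n" for i j
    proof (cases "i = j")
      case False
      have "sorted_wrt (\<ge>) ds" using ds(1) by (simp add: graphic_def)
      then show ?thesis using that False ds(2) by (simp add: sorted_wrt_iff_nth_less)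
    qed simp
  qed (use par total in \<open>auto simp: \<eta>_def\<close>)
  have "\<exists>E. realizes n ?d E \<and> (\<forall>V T. set_two_tree (V :: nat set) T \<and> card V = k \<longrightarrow> copy_in n E V T)"
    by (rule realization_with_two_trees[OF E0 par(6,8)]) (use par(9,10) in \<open>auto simp: \<eta>_def\<close>)
  then obtain E where E: "realizes n ?d E"
    and copies: "\<And>V T. set_two_tree (V :: nat set) T \<Longrightarrow> card V = k \<Longrightarrow> copy_in n E V T" by blast
  have onE: "edges_on {..<n} E" using E by (simp add: realizes_def)
  have "realization ds (with_proj (graph_of n E))" using realization_graph_of[of ds E] E ds(2) by simp
  moreover have "contains_every_two_tree k (with_proj (graph_of n E))"
    unfolding contains_every_two_tree_def
  proof (intro allI impI)
    fix T :: "nat pair_pre_digraph"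
    assume T: "two_tree (with_proj T) \<and> card (pverts T) = k"
    then have "set_two_tree (pverts T) (edges_of (with_proj T))" using two_tree_set_two_tree[of "with_proj T"] by simp
    then have "copy_in n E (pverts T) (edges_of (with_proj T))" using T by (intro copies) auto
    then show "contains_copy (with_proj (graph_of n E)) (with_proj T)"
      by (rule contains_copy_graph_of) (use onE T two_tree_graph in auto)
  qed
  ultimately show ?thesis by blast
qed

theorem theorem1p5:
  fixes k n :: nat
  assumes "k = 6 \<or> k \<ge> 8" and "n \<ge> N k"
  shows "(\<forall>ds. graphic ds \<and> length ds = n \<and> int (sum_list ds) > sigma_bound k n \<longrightarrow>
            (\<exists>G :: nat pair_pre_digraph.
               realization ds (with_proj G) \<and> contains_every_two_tree k (with_proj G)))
       \<and> (\<exists>ds. graphic ds \<and> length ds = n \<and> int (sum_list ds) = sigma_bound k n \<and>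
            \<not> (\<exists>G :: nat pair_pre_digraph.
               realization ds (with_proj G) \<and> contains_every_two_tree k (with_proj G)))"
proof (intro conjI allI impI)
  have "2 * k div 3 < n"
  proof -
    have "k \<le> 2 * k * k" using assms(1) by auto
    also have "\<dots> \<le> n" by (rule parameters(7)[OF assms])
    finally show ?thesis using assms(1) by linarith
  qed
  then show "\<exists>ds. graphic ds \<and> length ds = n \<and> int (sum_list ds) = sigma_bound k n \<and>
      \<not> (\<exists>G :: nat pair_pre_digraph. realization ds (with_proj G) \<and> contains_every_two_tree k (with_proj G))"
    using assms(1) by (intro sigma_bound_sharp) auto
qed (use sigma_bound_suffices[OF assms] in blast)

end
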